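(* Let $\mathfrak{X}$ be a differentiable Deligne-Mumford stack. Then $C^\infty(\mathfrak{X})$ with the strong topology is a Baire space; that is, a countable intersection of dense open subsets of $C^\infty(\mathfrak{X})$ is again dense.
   Context: Manifolds are smooth, Hausdorff and second countable. A differentiable stack is a stack of groupoids over the site of smooth manifolds that admits an atlas (a representable surjective submersion from a manifold). A differentiable Deligne-Mumford stack is a differentiable stack $\mathfrak{X}$ that admits an étale surjection $X\to\mathfrak{X}$ from a manifold and whose diagonal $\mathfrak{X}\to\mathfrak{X}\times\mathfrak{X}$ is proper (equivalently, a stack represented by a proper étale Lie groupoid). $C^\infty(\mathfrak{X})$ is the set of morphisms $\mathfrak{X}\to\mathbb{R}$. A family of morphisms $A_i\to\mathfrak{X}$ is locally finite if for each $U\to\mathfrak{X}$ from a manifold and each $u\in U$ there is a neighbourhood $V$ of $u$ such that $V\times_{\mathfrak{X}}A_i$ is non-empty for only finitely many $i$. Given a locally finite family of étale morphisms $c_i\colon U_i\to\mathfrak{X}$ from open subsets of $\mathbb{R}^n$ ($n$ the dimension of $\mathfrak{X}$), compact subsets $K_i\subset U_i$, numbers $\epsilon_i>0$, an integer $r\ge0$ and $f\in C^\infty(\mathfrak{X})$, let $\mathcal{N}^r(c_i,K_i,\epsilon_i,f)$ be the set of $g\in C^\infty(\mathfrak{X})$ such that $|D^{\mathbf{r}}(g\circ c_i)(k)-D^{\mathbf{r}}(f\circ c_i)(k)|<\epsilon_i$ for all $i$, all $k\in K_i$ and all partial derivatives $D^{\mathbf{r}}$ of order $|\mathbf{r}|\le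 r$. The strong topology on $C^\infty(\mathfrak{X})$ is the topology with basis given by the sets $\mathcal{N}^r(c_i,K_i,\epsilon_i,f)$. *)

theory Defs
  imports "HOL-Analysis.Analysis"
begin

section \<open>Smooth functions on open subsets of Euclidean space\<close>

text \<open>Euclidean n-space is \<^const>\<open>Euclidean_space\<close> n of the library: the sequences of reals that
  vanish at every index from n on. \<^term>\<open>partials [i1, i2]\<close> is the iterated derivative
  "first in direction i2, then in direction i1".\<close>

type_synonym pt = "nat \<Rightarrow> real"

definition partial :: "nat \<Rightarrow> (pt \<Rightarrow> real) \<Rightarrow> pt \<Rightarrow> real" where
  "partial i f x = deriv (\<lambda>t. f (x(i := t))) (x i)"

primrec partials :: "nat list \<Rightarrow> (pt \<Rightarrow> real) \<Rightarrow> pt \<Rightarrow> real" where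
  "partials [] f = f"
| "partials (i # is) f = partial i (partials is f)"

text \<open>Only meaningful if U is open in Euclidean n-space; the values of f off U are then
  irrelevant.\<close>

definition smooth_on :: "nat \<Rightarrow> pt set \<Rightarrow> (pt \<Rightarrow> real) \<Rightarrow> bool" where
  "smooth_on n U f \<longleftrightarrow>
     (\<forall>is \<in> lists {..<n}.
        continuous_map (subtopology (Euclidean_space n) U) euclideanreal (partials is f) \<and>
        (\<forall>i<n. \<forall>x\<in>U. (\<lambda>t. partials is f (x(i := t))) differentiable (at (x i))))"

definition smooth_between :: "nat \<Rightarrow> pt set \<Rightarrow> nat \<Rightarrow> (pt \<Rightarrow> pt) \<Rightarrow> bool" where
  "smooth_between n U m g \<longleftrightarrow>
     g ` U \<subseteq> topspace (Euclidean_space m) \<and> (\<forall>i<m. smooth_on n U (\<lambda>x. g x i))"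


section \<open>The site of smooth manifolds\<close>

text \<open>Manifolds are of pure dimension, Hausdorff and second countable, and come with a (not
  necessarily maximal) smooth atlas; a chart is a pair of its domain and its coordinate map, whose
  values off the domain are irrelevant. Such a manifold has at most continuum many points, so
  manifolds whose points lie in \<^typ>\<open>pt\<close> represent all manifolds up to diffeomorphism, and the
  category of these is equivalent to the category of all manifolds.\<close>

record manifold =
  mdim :: nat
  mtop :: "pt topology"
  matlas :: "(pt set \<times> (pt \<Rightarrow> pt)) set"

abbreviation pts :: "manifold \<Rightarrow> pt set" where
  "pts M \<equiv> topspace (mtop M)"

definition is_chart :: "nat \<Rightarrow> pt topology \<Rightarrow> pt set \<Rightarrow> (pt \<Rightarrow> pt) \<Rightarrow> bool" where
  "is_chart n T V \<phi> \<longleftrightarrow>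
     openin T V \<and> openin (Euclidean_space n) (\<phi> ` V) \<and>
     homeomorphic_map (subtopology T V) (subtopology (Euclidean_space n) (\<phi> ` V)) \<phi>"

definition is_manifold :: "manifold \<Rightarrow> bool" where
  "is_manifold M \<longleftrightarrow>
     Hausdorff_space (mtop M) \<and> second_countable (mtop M) \<and>
     (\<forall>(V, \<phi>) \<in> matlas M. is_chart (mdim M) (mtop M) V \<phi>) \<and>
     (\<Union>(V, \<phi>) \<in> matlas M. V) = pts M \<and>
     (\<forall>(V, \<phi>) \<in> matlas M. \<forall>(W, \<psi>) \<in> matlas M.
        smooth_between (mdim M) (\<phi> ` (V \<inter> W)) (mdim M) (\<psi> \<circ> inv_into V \<phi>))"

definition open_sub :: "manifold \<Rightarrow> pt set \<Rightarrow> manifold" where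
  "open_sub M V = \<lparr>mdim = mdim M, mtop = subtopology (mtop M) V,
                   matlas = (\<lambda>(W, \<phi>). (W \<inter> V, \<phi>)) ` matlas M\<rparr>"

definition euclidean_open :: "nat \<Rightarrow> pt set \<Rightarrow> manifold" where
  "euclidean_open n U = \<lparr>mdim = n, mtop = subtopology (Euclidean_space n) U,
                         matlas = {(U, \<lambda>x. x)}\<rparr>"

text \<open>Maps are extensional (\<^const>\<open>undefined\<close> off the source), so that equality of functions is
  equality of maps; composition is \<^const>\<open>compose\<close>.\<close>

definition smooth_maps :: "manifold \<Rightarrow> manifold \<Rightarrow> (pt \<Rightarrow> pt) set" where
  "smooth_maps M N =
     {h \<in> extensional (pts M). continuous_map (mtop M) (mtop N) h \<and>
        (\<forall>(V, \<phi>) \<in> matlas M. \<forall>(W, \<psi>) \<in> matlas N.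
           smooth_between (mdim M) (\<phi> ` {u \<in> V. h u \<in> W}) (mdim N) (\<psi> \<circ> h \<circ> inv_into V \<phi>))}"

definition smooth_real_functions :: "manifold \<Rightarrow> (pt \<Rightarrow> real) set" where
  "smooth_real_functions M =
     {f \<in> extensional (pts M).
        \<forall>(V, \<phi>) \<in> matlas M. smooth_on (mdim M) (\<phi> ` V) (f \<circ> inv_into V \<phi>)}"

definition inclusion :: "pt set \<Rightarrow> pt \<Rightarrow> pt" where
  "inclusion V = (\<lambda>u\<in>V. u)"

text \<open>Etale map of manifolds: a local diffeomorphism.\<close>

definition local_diffeo :: "manifold \<Rightarrow> manifold \<Rightarrow> (pt \<Rightarrow> pt) \<Rightarrow> bool" where
  "local_diffeo M N h \<longleftrightarrow>
     h \<in> smooth_maps M N \<and>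
     (\<forall>u \<in> pts M. \<exists>V. openin (mtop M) V \<and> u \<in> V \<and> openin (mtop N) (h ` V) \<and> inj_on h V \<and>
        restrict (inv_into V h) (h ` V) \<in> smooth_maps (open_sub N (h ` V)) (open_sub M V))"

text \<open>Submersion: in all charts the Jacobian, as a linear map from Euclidean space of dimension
  \<^term>\<open>mdim M\<close> to that of dimension \<^term>\<open>mdim N\<close>, is surjective.\<close>

definition submersion :: "manifold \<Rightarrow> manifold \<Rightarrow> (pt \<Rightarrow> pt) \<Rightarrow> bool" where
  "submersion M N h \<longleftrightarrow>
     h \<in> smooth_maps M N \<and>
     (\<forall>(V, \<phi>) \<in> matlas M. \<forall>(W, \<psi>) \<in> matlas N. \<forall>u \<in> V. h u \<in> W \<longrightarrow>
        (\<forall>v::pt. \<exists>t::pt. \<forall>i < mdim N.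
           v i = (\<Sum>j<mdim M. partial j (\<lambda>x. (\<psi> \<circ> h \<circ> inv_into V \<phi>) x i) (\<phi> u) * t j)))"

definition surjective :: "manifold \<Rightarrow> manifold \<Rightarrow> (pt \<Rightarrow> pt) \<Rightarrow> bool" where
  "surjective M N h \<longleftrightarrow> h ` pts M = pts N"


section \<open>Stacks of groupoids over the site of manifolds\<close>

text \<open>A stack is given as a category fibred in groupoids over manifolds: \<^term>\<open>pob X\<close> and
  \<^term>\<open>par X\<close> are the projection functor on objects and arrows, and \<^term>\<open>comp X g f\<close> is
  "g after f".\<close>

record ('o, 'a) cat_over =
  Ob :: "'o set"
  Ar :: "'a set"
  src :: "'a \<Rightarrow> 'o"
  tgt :: "'a \<Rightarrow> 'o"
  idt :: "'o \<Rightarrow> 'a"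
  comp :: "'a \<Rightarrow> 'a \<Rightarrow> 'a"
  pob :: "'o \<Rightarrow> manifold"
  par :: "'a \<Rightarrow> pt \<Rightarrow> pt"

definition arr :: "('o, 'a) cat_over \<Rightarrow> 'a \<Rightarrow> 'o \<Rightarrow> 'o \<Rightarrow> bool" where
  "arr X a x y \<longleftrightarrow> x \<in> Ob X \<and> y \<in> Ob X \<and> a \<in> Ar X \<and> src X a = x \<and> tgt X a = y"

definition category :: "('o, 'a) cat_over \<Rightarrow> bool" where
  "category X \<longleftrightarrow>
     (\<forall>a \<in> Ar X. src X a \<in> Ob X \<and> tgt X a \<in> Ob X) \<and>
     (\<forall>x \<in> Ob X. arr X (idt X x) x x) \<and>
     (\<forall>a b x y z. arr X a x y \<and> arr X b y z \<longrightarrow> arr X (comp X b a) x z) \<and>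
     (\<forall>a x y. arr X a x y \<longrightarrow> comp X a (idt X x) = a \<and> comp X (idt X y) a = a) \<and>
     (\<forall>a b c w x y z. arr X a w x \<and> arr X b x y \<and> arr X c y z \<longrightarrow>
        comp X c (comp X b a) = comp X (comp X c b) a)"

definition over_manifolds :: "('o, 'a) cat_over \<Rightarrow> bool" where
  "over_manifolds X \<longleftrightarrow>
     (\<forall>x \<in> Ob X. is_manifold (pob X x)) \<and>
     (\<forall>a x y. arr X a x y \<longrightarrow> par X a \<in> smooth_maps (pob X x) (pob X y)) \<and>
     (\<forall>x \<in> Ob X. par X (idt X x) = inclusion (pts (pob X x))) \<and>
     (\<forall>a b x y z. arr X a x y \<and> arr X b y z \<longrightarrow>
        par X (comp X b a) = compose (pts (pob X x)) (par X b) (par X a))"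

definition fibred_in_groupoids :: "('o, 'a) cat_over \<Rightarrow> bool" where
  "fibred_in_groupoids X \<longleftrightarrow>
     category X \<and> over_manifolds X \<and>
     (\<forall>x \<in> Ob X. \<forall>V h. is_manifold V \<and> h \<in> smooth_maps V (pob X x) \<longrightarrow>
        (\<exists>y a. arr X a y x \<and> pob X y = V \<and> par X a = h)) \<and>
     (\<forall>a b x y z h. arr X a y x \<and> arr X b z x \<and> h \<in> smooth_maps (pob X z) (pob X y) \<and>
        par X b = compose (pts (pob X z)) (par X a) h \<longrightarrow>
        (\<exists>!c. arr X c z y \<and> par X c = h \<and> comp X a c = b))"

text \<open>\<^term>\<open>is_restriction X V r y x\<close>: the arrow r exhibits y as the restriction of x to the open
  set V (restrictions are unique up to unique isomorphism).\<close>

definition is_restriction :: "('o, 'a) cat_over \<Rightarrow> pt set \<Rightarrow> 'a \<Rightarrow> 'o \<Rightarrow> 'o \<Rightarrow> bool" where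
  "is_restriction X V r y x \<longleftrightarrow>
     arr X r y x \<and> pob X y = open_sub (pob X x) V \<and> par X r = inclusion V"

definition open_cover :: "manifold \<Rightarrow> pt set set \<Rightarrow> bool" where
  "open_cover M C \<longleftrightarrow> (\<forall>V \<in> C. openin (mtop M) V) \<and> \<Union>C = pts M"

text \<open>Gluing of morphisms between two objects x, y over the same manifold. The morphism from the
  restriction \<^term>\<open>x' V\<close> of x to the restriction of y is given by its composite
  \<^term>\<open>g V\<close> with the arrow from the latter to y.\<close>

definition morphisms_glue :: "('o, 'a) cat_over \<Rightarrow> bool" where
  "morphisms_glue X \<longleftrightarrow>
     (\<forall>x \<in> Ob X. \<forall>y \<in> Ob X. \<forall>C x' r g.
        pob X y = pob X x \<and> open_cover (pob X x) C \<and>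
        (\<forall>V \<in> C. is_restriction X V (r V) (x' V) x \<and> is_restriction X V (g V) (x' V) y) \<and>
        (\<forall>V \<in> C. \<forall>W \<in> C. \<forall>z s t.
           is_restriction X (V \<inter> W) s z (x' V) \<and> is_restriction X (V \<inter> W) t z (x' W) \<and>
           comp X (r V) s = comp X (r W) t \<longrightarrow> comp X (g V) s = comp X (g W) t)
        \<longrightarrow> (\<exists>!f. arr X f x y \<and> par X f = inclusion (pts (pob X x)) \<and>
                  (\<forall>V \<in> C. comp X f (r V) = g V)))"

text \<open>Gluing of objects. A descent datum consists of objects \<^term>\<open>x V\<close> over the members of the
  cover and, on every overlap, an isomorphism of the restrictions of \<^term>\<open>x V\<close> and
  \<^term>\<open>x W\<close>, given as an object \<^term>\<open>o2 V W\<close> over the overlap that is a restriction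
  of both, via \<^term>\<open>a V W\<close> and \<^term>\<open>b V W\<close>. The cocycle condition is expressed on an
  object z over the triple overlap with arrows s, t, u to the three double overlaps: if these have
  the same component to \<^term>\<open>x V\<close> and to \<^term>\<open>x W\<close>, they have the same component
  to the third object.\<close>

definition objects_glue :: "('o, 'a) cat_over \<Rightarrow> bool" where
  "objects_glue X \<longleftrightarrow>
     (\<forall>M C x o2 a b.
        is_manifold M \<and> open_cover M C \<and>
        (\<forall>V \<in> C. x V \<in> Ob X \<and> pob X (x V) = open_sub M V) \<and>
        (\<forall>V \<in> C. \<forall>W \<in> C. is_restriction X (V \<inter> W) (a V W) (o2 V W) (x V) \<and>
                         is_restriction X (V \<inter> W) (b V W) (o2 V W) (x W)) \<and>
        (\<forall>V \<in> C. \<forall>W \<in> C. \<forall>Z \<in> C. \<forall>z s t u.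
           is_restriction X (V \<inter> W \<inter> Z) s z (o2 V W) \<and>
           is_restriction X (V \<inter> W \<inter> Z) t z (o2 W Z) \<and>
           is_restriction X (V \<inter> W \<inter> Z) u z (o2 V Z) \<and>
           comp X (a V W) s = comp X (a V Z) u \<and> comp X (b V W) s = comp X (a W Z) t
           \<longrightarrow> comp X (b W Z) t = comp X (b V Z) u)
        \<longrightarrow> (\<exists>y e. y \<in> Ob X \<and> pob X y = M \<and>
               (\<forall>V \<in> C. is_restriction X V (e V) (x V) y) \<and>
               (\<forall>V \<in> C. \<forall>W \<in> C. comp X (e V) (a V W) = comp X (e W) (b V W))))"

definition stack :: "('o, 'a) cat_over \<Rightarrow> bool" where
  "stack X \<longleftrightarrow> fibred_in_groupoids X \<and> morphisms_glue X \<and> objects_glue X"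


section \<open>Differentiable Deligne-Mumford stacks\<close>

text \<open>By the 2-Yoneda lemma a morphism from a manifold U to the stack X is an object of X over U;
  this is how such morphisms are represented below. An arrow from z to x over a map f is the same
  thing as an isomorphism between z and the pullback of x along f. Hence, for x over U and y over
  V, a morphism from T to the 2-fibre product of U and V over X (a map from T to U, a map from T to
  V and a 2-isomorphism between the two composites to X) amounts to an object z over T with arrows
  to x and to y. A manifold, with its two projections, represents the fibre product if it carries
  a universal such span.\<close>

definition is_fibre_product ::
    "('o, 'a) cat_over \<Rightarrow> 'o \<Rightarrow> 'o \<Rightarrow> 'o \<Rightarrow> 'a \<Rightarrow> 'a \<Rightarrow> bool" where
  "is_fibre_product X x y w a b \<longleftrightarrow>
     arr X a w x \<and> arr X b w y \<and>
     (\<forall>z a' b'. arr X a' z x \<and> arr X b' z y \<longrightarrow>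
        (\<exists>!t. arr X t z w \<and> comp X a t = a' \<and> comp X b t = b'))"

definition fibre_product_nonempty :: "('o, 'a) cat_over \<Rightarrow> 'o \<Rightarrow> 'o \<Rightarrow> bool" where
  "fibre_product_nonempty X x y \<longleftrightarrow>
     (\<exists>z a b. arr X a z x \<and> arr X b z y \<and> pts (pob X z) \<noteq> {})"

text \<open>The morphism x is representable, and its base change along every morphism y from a manifold
  has the property P.\<close>

definition representable_with ::
    "(manifold \<Rightarrow> manifold \<Rightarrow> (pt \<Rightarrow> pt) \<Rightarrow> bool) \<Rightarrow> ('o, 'a) cat_over \<Rightarrow> 'o \<Rightarrow> bool" where
  "representable_with P X x \<longleftrightarrow>
     x \<in> Ob X \<and>
     (\<forall>y \<in> Ob X. \<exists>w a b. is_fibre_product X x y w a b \<and> P (pob X w) (pob X y) (par X b))"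

definition is_atlas :: "('o, 'a) cat_over \<Rightarrow> 'o \<Rightarrow> bool" where
  "is_atlas X x \<longleftrightarrow> representable_with (\<lambda>M N h. submersion M N h \<and> surjective M N h) X x"

definition etale :: "('o, 'a) cat_over \<Rightarrow> 'o \<Rightarrow> bool" where
  "etale X x \<longleftrightarrow> representable_with local_diffeo X x"

definition etale_surjection :: "('o, 'a) cat_over \<Rightarrow> 'o \<Rightarrow> bool" where
  "etale_surjection X x \<longleftrightarrow>
     representable_with (\<lambda>M N h. local_diffeo M N h \<and> surjective M N h) X x"

definition differentiable_stack :: "('o, 'a) cat_over \<Rightarrow> bool" where
  "differentiable_stack X \<longleftrightarrow> stack X \<and> (\<exists>x. is_atlas X x)"

text \<open>The diagonal of X is in general not representable by manifolds. As usual it is called proper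
  if its base change along the product of an atlas U with itself is proper, that is, if the map
  from the fibre product of U with U over X to the product of U with U is proper; this does not
  depend on the atlas.\<close>

definition proper_diagonal :: "('o, 'a) cat_over \<Rightarrow> bool" where
  "proper_diagonal X \<longleftrightarrow>
     (\<exists>x w a b. is_atlas X x \<and> is_fibre_product X x x w a b \<and>
        proper_map (mtop (pob X w)) (prod_topology (mtop (pob X x)) (mtop (pob X x)))
          (\<lambda>u. (par X a u, par X b u)))"

text \<open>The dimension n is that of the source of an etale surjection.\<close>

definition DM_stack :: "nat \<Rightarrow> ('o, 'a) cat_over \<Rightarrow> bool" where
  "DM_stack n X \<longleftrightarrow>
     differentiable_stack X \<and>
     (\<exists>x. etale_surjection X x \<and> mdim (pob X x) = n) \<and>
     proper_diagonal X"


section \<open>Smooth functions on a stack and the strong topology\<close>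

text \<open>A morphism from X to the real line is a functor over manifolds from X to the category of
  manifolds with a smooth real function; this means a smooth function \<^term>\<open>f x\<close> on
  \<^term>\<open>pob X x\<close> for every object x, compatible with all arrows. Under the identification of
  morphisms from U to X with objects over U, \<^term>\<open>f x\<close> is the composite of f with x.\<close>

definition C_infinity :: "('o, 'a) cat_over \<Rightarrow> ('o \<Rightarrow> pt \<Rightarrow> real) set" where
  "C_infinity X =
     {f \<in> extensional (Ob X).
        (\<forall>x \<in> Ob X. f x \<in> smooth_real_functions (pob X x)) \<and>
        (\<forall>a x y. arr X a x y \<longrightarrow> f x = compose (pts (pob X x)) (f y) (par X a))}"

definition locally_finite_family ::
    "('o, 'a) cat_over \<Rightarrow> 'i set \<Rightarrow> ('i \<Rightarrow> 'o) \<Rightarrow> bool" where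
  "locally_finite_family X I c \<longleftrightarrow>
     (\<forall>x \<in> Ob X. \<forall>u \<in> pts (pob X x).
        \<exists>V r y. openin (mtop (pob X x)) V \<and> u \<in> V \<and> is_restriction X V r y x \<and>
          finite {i \<in> I. fibre_product_nonempty X y (c i)})"

definition strong_data ::
    "nat \<Rightarrow> ('o, 'a) cat_over \<Rightarrow> 'i set \<Rightarrow> ('i \<Rightarrow> 'o) \<Rightarrow> ('i \<Rightarrow> pt set) \<Rightarrow> ('i \<Rightarrow> real) \<Rightarrow> bool" where
  "strong_data n X I c K \<epsilon> \<longleftrightarrow>
     locally_finite_family X I c \<and>
     (\<forall>i \<in> I. etale X (c i) \<and>
        (\<exists>U. openin (Euclidean_space n) U \<and> pob X (c i) = euclidean_open n U \<and>
             K i \<subseteq> U \<and> compactin (Euclidean_space n) (K i)) \<and>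
        \<epsilon> i > 0)"

definition strong_nbhd ::
    "nat \<Rightarrow> ('o, 'a) cat_over \<Rightarrow> nat \<Rightarrow> 'i set \<Rightarrow> ('i \<Rightarrow> 'o) \<Rightarrow> ('i \<Rightarrow> pt set) \<Rightarrow> ('i \<Rightarrow> real) \<Rightarrow>
     ('o \<Rightarrow> pt \<Rightarrow> real) \<Rightarrow> ('o \<Rightarrow> pt \<Rightarrow> real) set" where
  "strong_nbhd n X r I c K \<epsilon> f =
     {g \<in> C_infinity X.
        \<forall>i \<in> I. \<forall>k \<in> K i. \<forall>is \<in> lists {..<n}. length is \<le> r \<longrightarrow>
          \<bar>partials is (g (c i)) k - partials is (f (c i)) k\<bar> < \<epsilon> i}"

text \<open>A neighbourhood depends only on the set of triples (c i, K i, \<epsilon> i), so nothing is lost by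
  taking the index type to be that of such triples.\<close>

definition strong_basis :: "nat \<Rightarrow> ('o, 'a) cat_over \<Rightarrow> ('o \<Rightarrow> pt \<Rightarrow> real) set set" where
  "strong_basis n X =
     {N. \<exists>r (I :: ('o \<times> pt set \<times> real) set) c K \<epsilon> f.
           strong_data n X I c K \<epsilon> \<and> f \<in> C_infinity X \<and> N = strong_nbhd n X r I c K \<epsilon> f}"

text \<open>The intersection of two basic sets contains a basic set around each of its points (take the
  disjoint union of the two families and shrink the \<epsilon> i, using compactness of the K i), so the
  topology generated by these sets is the one having them as a basis.\<close>

definition strong_topology :: "nat \<Rightarrow> ('o, 'a) cat_over \<Rightarrow> ('o \<Rightarrow> pt \<Rightarrow> real) topology" where
  "strong_topology n X = topology_generated_by (strong_basis n X)"

end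

theory Submission
  imports Defs
begin

text \<open>Finite families are locally finite, so the strong topology refines uniform convergence of all
  derivatives on compact subsets of charts. An etale surjection from a second countable manifold
  provides countably many charts with compact subsets whose interiors cover everything, and a
  sequence of functions which is uniformly Cauchy, with all derivatives, on each of these converges
  to a smooth function on the stack: for an object y over a manifold, the value on y factors
  locally through one of the charts, so the chain rule transports convergence of derivatives from
  the charts to y. On the other hand each basic neighbourhood of g contains, by compactness of the
  sets K i, a smaller one lying in a set closed under such limits. Baire's argument then applies: at
  step k choose the next function in the k-th dense open set, inside the neighbourhoods chosen
  before, and within 1/2^k of the previous function on the first k charts up to order k.\<close>

section \<open>Differential calculus on open subsets of Euclidean space\<close>

text \<open>Completeness enters only through the coarser convergence of all derivatives on countably
  many charts. This is why every open set is entered through a pair \<open>B\<close> \<subseteq>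
  \<open>C\<close>: \<open>B\<close> is open, so that density can be applied to it, while
  \<open>C\<close> is stable under the coarse convergence, so that the limit cannot escape. As step
  k controls only the charts numbered up to k, the countable cover need not be locally finite. A
  second obstacle lies in the calculus. Points of all Euclidean spaces share one type and smoothness
  is phrased by iterated one-variable derivatives, so differentiability along curves has to be
  recovered from the mean value theorem before there is a chain rule. Higher derivatives of
  composites are never written out: a class of sequences closed under sums, products and
  differentiation takes the place of such a formula.\<close>

definition open_box :: "nat \<Rightarrow> pt \<Rightarrow> real \<Rightarrow> pt set" where
  "open_box n p d = {y. (\<forall>i<n. \<bar>y i - p i\<bar> < d) \<and> (\<forall>i\<ge>n. y i = 0)}"

text \<open>Boxes rather than Euclidean balls: on the way from the centre to a point of the box,
  coordinates can be exchanged one at a time without leaving the box.\<close>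

definition closed_box :: "nat \<Rightarrow> pt \<Rightarrow> real \<Rightarrow> pt set" where
  "closed_box n p d = {y. (\<forall>i<n. \<bar>y i - p i\<bar> \<le> d) \<and> (\<forall>i\<ge>n. y i = 0)}"

section \<open>Topology of Euclidean space and its boxes\<close>

lemma Euclidean_space_eq_top_of_set:
  "Euclidean_space n = top_of_set (topspace (Euclidean_space n))"
  by (simp add: Euclidean_space_def euclidean_product_topology)

lemma continuous_map_Euclidean_subspace:
  assumes "U \<subseteq> topspace (Euclidean_space n)"
  shows "continuous_map (subtopology (Euclidean_space n) U) (euclidean::'b::topological_space topology) f \<longleftrightarrow> continuous_on U f"
proof -
  have "subtopology (Euclidean_space n) U = top_of_set U"
    using assms by (metis Euclidean_space_eq_top_of_set inf.absorb2 subtopology_subtopology)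
  then show ?thesis by simp
qed

lemma openin_open_box: "openin (Euclidean_space n) (open_box n p d)"
proof -
  have 1: "open_box n p d = topspace (Euclidean_space n) \<inter> (\<Inter>i\<in>{..<n}. {y. \<bar>y i - p i\<bar> < d})"
    by (auto simp: open_box_def topspace_Euclidean_space)
  have "open (\<Inter>i\<in>{..<n}. {y::pt. \<bar>y i - p i\<bar> < d})"
    by (intro open_INT finite_lessThan ballI open_Collect_less continuous_intros) simp
  then show ?thesis
    unfolding 1 by (subst Euclidean_space_eq_top_of_set) (rule openin_open_Int)
qed

text \<open>Tychonoff's theorem: over all indices the box is a product of compact intervals,
  degenerate to {0} from \<open>n\<close> on.\<close>

lemma compactin_closed_box: "compactin (Euclidean_space n) (closed_box n p d)"
proof -
  have eq: "closed_box n p d = (\<Pi>\<^sub>E i\<in>UNIV. if i < n then {p i - d..p i + d} else {0})"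
    by (auto simp: closed_box_def PiE_iff abs_le_iff split: if_splits)
       (smt (verit) atLeastAtMost_iff singletonD leD not_le)+
  have "compactin (powertop_real UNIV) (closed_box n p d)"
    unfolding eq compactin_PiE by auto
  then show ?thesis
    by (auto simp: Euclidean_space_def compactin_subtopology closed_box_def)
qed

lemma open_box_subset_closed_box: "open_box n p d \<subseteq> closed_box n p d"
  by (auto simp: open_box_def closed_box_def intro: less_imp_le)

lemma closed_box_subset_open_box: "d < e \<Longrightarrow> closed_box n p d \<subseteq> open_box n p e"
  by (auto simp: open_box_def closed_box_def intro: le_less_trans)

lemma in_open_box: "p \<in> topspace (Euclidean_space n) \<Longrightarrow> 0 < d \<Longrightarrow> p \<in> open_box n p d"
  by (auto simp: open_box_def topspace_Euclidean_space)

text \<open>Only the first \<open>n\<close> coordinates are free in Euclidean space: beyond them the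
  points of the box agree with \<open>p\<close>, both being 0 there. So a minimum of finitely many
  radii fits a box into a basic open set of the product topology.\<close>

lemma open_box_subset_open:
  assumes "openin (Euclidean_space n) W" "p \<in> W"
  obtains d where "d > 0" "open_box n p d \<subseteq> W"
proof -
  obtain T where T: "open T" "W = topspace (Euclidean_space n) \<inter> T"
    using assms(1) Euclidean_space_eq_top_of_set by (metis openin_open)
  then have "openin (product_topology (\<lambda>i::nat. euclideanreal) UNIV) T" "p \<in> T"
    using assms(2) by (auto simp: euclidean_product_topology)
  from product_topology_open_contains_basis[OF this] obtain S where
    S: "p \<in> (\<Pi>\<^sub>E i\<in>UNIV. S i)" "\<And>i. open (S i)" "(\<Pi>\<^sub>E i\<in>UNIV. S i) \<subseteq> T"
    by auto
  have "\<exists>e>0. ball (p i) e \<subseteq> S i" for i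
    using S(1) S(2)[of i] by (auto simp: PiE_iff open_contains_ball)
  then obtain e where e: "\<And>i. e i > 0" "\<And>i. ball (p i) (e i) \<subseteq> S i" by metis
  \<comment> \<open>The 1 keeps the minimum meaningful for n = 0.\<close>
  define d where "d = Min (insert 1 (e ` {..<n}))"
  have d: "d > 0" "\<And>i. i < n \<Longrightarrow> d \<le> e i"
    using e(1) by (auto simp: d_def)
  have "open_box n p d \<subseteq> W"
  proof
    fix y assume y: "y \<in> open_box n p d"
    have "y i \<in> S i" for i
    proof (cases "i < n")
      case True
      then have "y i \<in> ball (p i) (e i)"
        using y d(2)[OF True] by (auto simp: open_box_def dist_real_def abs_minus_commute)
      then show ?thesis using e(2) by blast
    next
      case False
      then have "y i = p i"
        using y assms(2) T(2) by (auto simp: open_box_def topspace_Euclidean_space)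
      then show ?thesis using S(1) by (auto simp: PiE_iff)
    qed
    then have "y \<in> T" using S(3) by (auto simp: PiE_iff)
    then show "y \<in> W" using y T(2) by (auto simp: open_box_def topspace_Euclidean_space)
  qed
  with d(1) show thesis by (rule that)
qed

lemma continuous_on_open_box:
  assumes "openin (Euclidean_space n) W" "continuous_on W f" "p \<in> W" "(e::real) > 0"
  obtains d where "d > 0" "open_box n p d \<subseteq> W" "\<And>y. y \<in> open_box n p d \<Longrightarrow> \<bar>f y - f p\<bar> < e"
proof -
  have W: "W \<subseteq> topspace (Euclidean_space n)" using assms(1) openin_subset by blast
  have "continuous_map (subtopology (Euclidean_space n) W) euclideanreal f"
    using assms(2) continuous_map_Euclidean_subspace[OF W] by blast
  from openin_continuous_map_preimage[OF this, of "ball (f p) e"]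
  have "openin (Euclidean_space n) {x \<in> W. f x \<in> ball (f p) e}"
    using W assms(1) by (auto simp: Int_absorb1 openin_open_subtopology)
  from open_box_subset_open[OF this, of p] assms(3,4) obtain d where
    "d > 0" "open_box n p d \<subseteq> {x \<in> W. f x \<in> ball (f p) e}" by auto
  then show thesis by (intro that[of d]) (auto simp: dist_real_def abs_minus_commute)
qed

section \<open>Coordinate derivatives\<close>

lemma eventually_upd_in_open:
  assumes "openin (Euclidean_space n) U" "x \<in> U" "i < n"
  shows "eventually (\<lambda>t. x(i := t) \<in> U) (nhds (x i))"
proof -
  obtain d where d: "d > 0" "open_box n x d \<subseteq> U" using open_box_subset_open[OF assms(1,2)] .
  have "x \<in> topspace (Euclidean_space n)" using assms openin_subset by blast
  then have "x(i := t) \<in> U" if "dist t (x i) < d" for t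
    using that d assms(3) by (auto simp: open_box_def topspace_Euclidean_space dist_real_def subset_iff)
  then show ?thesis using d(1) eventually_nhds_metric by blast
qed

text \<open>A derivative along a coordinate sees only the points \<open>x(i := t)\<close> with t
  near \<open>x i\<close>, and these stay in the open set \<open>U\<close>. So arbitrary values off
  \<open>U\<close> do no harm.\<close>

lemma partial_cong:
  assumes "openin (Euclidean_space n) U" "x \<in> U" "i < n" "\<And>y. y \<in> U \<Longrightarrow> f y = g y"
  shows "partial i f x = partial i g x"
    "(\<lambda>t. f (x(i := t))) differentiable at (x i) \<Longrightarrow> (\<lambda>t. g (x(i := t))) differentiable at (x i)"
proof -
  have ev: "eventually (\<lambda>t. f (x(i := t)) = g (x(i := t))) (nhds (x i))"
    using eventually_upd_in_open[OF assms(1-3)] by eventually_elim (rule assms(4))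
  show "partial i f x = partial i g x"
    unfolding partial_def by (rule deriv_cong_ev[OF ev refl])
  assume "(\<lambda>t. f (x(i := t))) differentiable at (x i)"
  then obtain D where "((\<lambda>t. f (x(i := t))) has_field_derivative D) (at (x i))"
    using real_differentiable_def by blast
  then have "((\<lambda>t. g (x(i := t))) has_field_derivative D) (at (x i))"
    using DERIV_cong_ev[OF refl ev refl] by blast
  then show "(\<lambda>t. g (x(i := t))) differentiable at (x i)"
    using real_differentiable_def by blast
qed

lemma partials_cong:
  assumes U: "openin (Euclidean_space n) U" and fg: "\<And>y. y \<in> U \<Longrightarrow> f y = g y"
    and "is \<in> lists {..<n}" "x \<in> U"
  shows "partials is f x = partials is g x"
  using assms(3,4)
proof (induction "is" arbitrary: x)
  case (Cons i "is")
  then show ?case by (auto intro!: partial_cong(1)[OF U])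
qed (simp add: fg)

text \<open>Weaker than the usual C^1: continuity of the partial derivatives is not included. It is
  the condition that \<open>smooth_on\<close> imposes on each iterated derivative; imposed on all of
  them it also yields the continuity of the partials.\<close>

definition C1_on :: "nat \<Rightarrow> pt set \<Rightarrow> (pt \<Rightarrow> real) \<Rightarrow> bool" where
  "C1_on n U f \<longleftrightarrow> continuous_on U f \<and>
     (\<forall>i<n. \<forall>x\<in>U. (\<lambda>t. f (x(i := t))) differentiable (at (x i)))"

lemma smooth_on_iff_C1_on:
  assumes "openin (Euclidean_space n) U"
  shows "smooth_on n U f \<longleftrightarrow> (\<forall>is \<in> lists {..<n}. C1_on n U (partials is f))"
  using continuous_map_Euclidean_subspace[OF openin_subset[OF assms], where f = "partials is f" for "is"]
  by (simp add: smooth_on_def C1_on_def)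

lemma C1_on_cong:
  assumes U: "openin (Euclidean_space n) U" and fg: "\<And>y. y \<in> U \<Longrightarrow> f y = g y" and "C1_on n U f"
  shows "C1_on n U g"
proof -
  have "continuous_on U g"
    using assms(3) continuous_on_cong[of U U f g] fg by (simp add: C1_on_def)
  with assms(3) partial_cong(2)[of n U _ _ f g] U fg show ?thesis
    unfolding C1_on_def by blast
qed

lemma smooth_on_cong:
  assumes U: "openin (Euclidean_space n) U" and fg: "\<And>y. y \<in> U \<Longrightarrow> f y = g y" and "smooth_on n U f"
  shows "smooth_on n U g"
  using assms(3) C1_on_cong[OF U, of "partials is f" "partials is g" for "is"] partials_cong[of n U f g] U fg
  unfolding smooth_on_iff_C1_on[OF U] by blast

lemma C1_on_has_partial:
  assumes "C1_on n U f" "x \<in> U" "i < n"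
  shows "((\<lambda>t. f (x(i := t))) has_field_derivative partial i f x) (at (x i))"
  using assms unfolding C1_on_def partial_def
  by (meson DERIV_deriv_iff_real_differentiable)

lemma C1_on_has_partial':
  assumes "C1_on n U f" "x(i := s) \<in> U" "i < n"
  shows "((\<lambda>t. f (x(i := t))) has_field_derivative partial i f (x(i := s))) (at s)"
  using C1_on_has_partial[OF assms] by simp

lemma C1_onI:
  assumes "continuous_on U f"
    and "\<And>i x. i < n \<Longrightarrow> x \<in> U \<Longrightarrow> ((\<lambda>t. f (x(i := t))) has_field_derivative D i x) (at (x i))"
  shows "C1_on n U f" "\<And>i x. i < n \<Longrightarrow> x \<in> U \<Longrightarrow> partial i f x = D i x"
  using assms unfolding C1_on_def partial_def
  by (auto simp: real_differentiable_def intro: DERIV_imp_deriv)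

lemma C1_on_add:
  assumes "C1_on n U f" "C1_on n U g"
  shows "C1_on n U (\<lambda>x. f x + g x)"
    "\<And>i x. i < n \<Longrightarrow> x \<in> U \<Longrightarrow> partial i (\<lambda>x. f x + g x) x = partial i f x + partial i g x"
proof -
  have c: "continuous_on U (\<lambda>x. f x + g x)"
    using assms by (auto simp: C1_on_def intro: continuous_intros)
  have d: "((\<lambda>t. f (x(i := t)) + g (x(i := t))) has_field_derivative partial i f x + partial i g x) (at (x i))"
    if "i < n" "x \<in> U" for i x
    using C1_on_has_partial[OF assms(1) that(2,1)] C1_on_has_partial[OF assms(2) that(2,1)]
    by (rule DERIV_add)
  note * = C1_onI[of U "\<lambda>x. f x + g x", OF c d]
  show "C1_on n U (\<lambda>x. f x + g x)" by (rule *(1))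
  show "partial i (\<lambda>x. f x + g x) x = partial i f x + partial i g x" if "i < n" "x \<in> U" for i x
    using *(2)[of n i x] that by simp
qed

lemma C1_on_mult:
  assumes "C1_on n U f" "C1_on n U g"
  shows "C1_on n U (\<lambda>x. f x * g x)"
    "\<And>i x. i < n \<Longrightarrow> x \<in> U \<Longrightarrow>
      partial i (\<lambda>x. f x * g x) x = partial i f x * g x + f x * partial i g x"
proof -
  have c: "continuous_on U (\<lambda>x. f x * g x)"
    using assms by (auto simp: C1_on_def intro: continuous_intros)
  have d: "((\<lambda>t. f (x(i := t)) * g (x(i := t))) has_field_derivative
      partial i f x * g x + f x * partial i g x) (at (x i))"
    if "i < n" "x \<in> U" for i x
    using DERIV_mult[OF C1_on_has_partial[OF assms(1) that(2,1)] C1_on_has_partial[OF assms(2) that(2,1)]]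
    by (simp add: algebra_simps)
  note * = C1_onI[of U "\<lambda>x. f x * g x", OF c d]
  show "C1_on n U (\<lambda>x. f x * g x)" by (rule *(1))
  show "partial i (\<lambda>x. f x * g x) x = partial i f x * g x + f x * partial i g x" if "i < n" "x \<in> U" for i x
    using *(2)[of n i x] that by simp
qed

text \<open>Walk from \<open>p\<close> to \<open>y\<close> parallel to the axes and apply the mean
  value theorem on each leg. The radius is the sup-distance from \<open>p\<close> to
  \<open>y\<close>, so the intermediate points tend to \<open>p\<close> when \<open>y\<close> does;
  the inserted 0 covers n = 0.\<close>

lemma C1_on_increment:
  assumes f: "C1_on n U f" and p: "p \<in> topspace (Euclidean_space n)"
    and U: "open_box n p d \<subseteq> U" and y: "y \<in> open_box n p d"
  shows "\<exists>\<xi>. (\<forall>j<n. \<xi> j \<in> closed_box n p (Max (insert 0 ((\<lambda>i. \<bar>y i - p i\<bar>) ` {..<n})))) \<and>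
    f y - f p = (\<Sum>j<n. partial j f (\<xi> j) * (y j - p j))"
proof -
  define r where "r = Max (insert 0 ((\<lambda>i. \<bar>y i - p i\<bar>) ` {..<n}))"
  have r: "\<bar>y i - p i\<bar> \<le> r" if "i < n" for i using that by (auto simp: r_def)
  have r0: "r \<ge> 0" by (auto simp: r_def)
  \<comment> \<open>The corners of the walk: at \<open>z j\<close> the first j coordinates have
    already been replaced by those of \<open>y\<close>.\<close>
  define z where "z j = (\<lambda>i. if i < j then y i else p i)" for j
  have yi: "\<bar>y i - p i\<bar> < d" if "i < n" for i using y that by (auto simp: open_box_def)
  have ex: "\<exists>\<xi>. \<xi> \<in> closed_box n p r \<and> f (z (Suc j)) - f (z j) = partial j f \<xi> * (y j - p j)"
    if j: "j < n" for j
  proof -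
    have zj: "z j = (z j)(j := p j)" "z (Suc j) = (z j)(j := y j)" by (auto simp: z_def fun_eq_iff less_Suc_eq)
    have in1: "(z j)(j := t) \<in> closed_box n p r \<inter> U" if "t \<in> closed_segment (p j) (y j)" for t
    proof -
      have tp: "\<bar>t - p j\<bar> \<le> \<bar>y j - p j\<bar>"
        using that by (auto simp: closed_segment_eq_real_ivl split: if_splits)
      have "\<bar>((z j)(j := t)) i - p i\<bar> \<le> r \<and> \<bar>((z j)(j := t)) i - p i\<bar> < d" if "i < n" for i
        using tp r[OF that] yi[OF that] r0 by (auto simp: z_def)
      moreover have "((z j)(j := t)) i = 0" if "i \<ge> n" for i
        using that j p by (auto simp: z_def topspace_Euclidean_space)
      ultimately show ?thesis using U by (auto simp: open_box_def closed_box_def subset_iff)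
    qed
    have der: "((\<lambda>t. f ((z j)(j := t))) has_field_derivative partial j f ((z j)(j := t))) (at t)"
      if "t \<in> closed_segment (p j) (y j)" for t
      using C1_on_has_partial'[OF f _ j] in1[OF that] by blast
    \<comment> \<open>The mean value theorem wants ordered endpoints, hence the case split; for
      \<open>p j = y j\<close> both sides vanish and any point will do.\<close>
    have "\<exists>t\<in>closed_segment (p j) (y j).
        f ((z j)(j := y j)) - f ((z j)(j := p j)) = partial j f ((z j)(j := t)) * (y j - p j)"
    proof (cases "p j" "y j" rule: linorder_cases)
      case less
      then obtain t where "t > p j" "t < y j" "f ((z j)(j := y j)) - f ((z j)(j := p j)) = (y j - p j) * partial j f ((z j)(j := t))"
        using MVT2[OF less, of "\<lambda>t. f ((z j)(j := t))" "\<lambda>t. partial j f ((z j)(j := t))"] der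
        by (auto simp: closed_segment_eq_real_ivl)
      then show ?thesis by (intro bexI[of _ t]) (auto simp: closed_segment_eq_real_ivl mult.commute)
    next
      case greater
      then obtain t where "t > y j" "t < p j" "f ((z j)(j := p j)) - f ((z j)(j := y j)) = (p j - y j) * partial j f ((z j)(j := t))"
        using MVT2[OF greater, of "\<lambda>t. f ((z j)(j := t))" "\<lambda>t. partial j f ((z j)(j := t))"] der
        by (auto simp: closed_segment_eq_real_ivl)
      then show ?thesis by (intro bexI[of _ t]) (auto simp: closed_segment_eq_real_ivl algebra_simps)
    qed (auto intro: bexI[of _ "p j"])
    with in1 zj show ?thesis by (metis IntD1)
  qed
  then obtain \<xi> where \<xi>: "\<And>j. j < n \<Longrightarrow> \<xi> j \<in> closed_box n p r"
      "\<And>j. j < n \<Longrightarrow> f (z (Suc j)) - f (z j) = partial j f (\<xi> j) * (y j - p j)" by metis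
  have "z 0 = p" "z n = y"
    using p y by (auto simp: z_def fun_eq_iff open_box_def topspace_Euclidean_space)
  then have "f y - f p = (\<Sum>j<n. f (z (Suc j)) - f (z j))"
    using sum_lessThan_telescope[of "\<lambda>j. f (z j)" n] by simp
  also have "\<dots> = (\<Sum>j<n. partial j f (\<xi> j) * (y j - p j))"
    using \<xi>(2) by (intro sum.cong) auto
  finally show ?thesis using \<xi>(1) unfolding r_def by blast
qed

text \<open>Divide the increment formula by t - t0. The intermediate points converge to
  \<open>\<gamma> t0\<close>, where the partials are continuous. Membership of
  \<open>\<gamma> t\<close> in Euclidean space is a separate assumption because the derivative
  hypothesis says nothing about the coordinates from \<open>n\<close> on.\<close>

lemma has_derivative_along_curve:
  assumes W: "openin (Euclidean_space n) W" and f: "C1_on n W f"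
    and pf: "\<And>j. j < n \<Longrightarrow> continuous_on W (partial j f)"
    and \<gamma>: "\<And>j. j < n \<Longrightarrow> ((\<lambda>t. \<gamma> t j) has_field_derivative \<gamma>' j) (at t0)"
    and \<gamma>0: "\<gamma> t0 \<in> W" and \<gamma>E: "eventually (\<lambda>t. \<gamma> t \<in> topspace (Euclidean_space n)) (nhds t0)"
  shows "((\<lambda>t. f (\<gamma> t)) has_field_derivative (\<Sum>j<n. partial j f (\<gamma> t0) * \<gamma>' j)) (at t0)"
proof -
  define p where "p = \<gamma> t0"
  have p: "p \<in> topspace (Euclidean_space n)" using \<gamma>0 W openin_subset unfolding p_def by blast
  obtain d where d: "d > 0" "open_box n p d \<subseteq> W" using open_box_subset_open[OF W \<gamma>0] unfolding p_def .
  define r where "r y = Max (insert 0 ((\<lambda>i. \<bar>y i - p i\<bar>) ` {..<n}))" for y :: pt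
  \<comment> \<open>The implication sits below the quantifier so that one choice function
    \<open>\<xi>\<close> serves all \<open>y\<close>.\<close>
  have "\<exists>\<xi>. y \<in> open_box n p d \<longrightarrow> (\<forall>j<n. \<xi> j \<in> closed_box n p (r y)) \<and>
      f y - f p = (\<Sum>j<n. partial j f (\<xi> j) * (y j - p j))" for y
    using C1_on_increment[OF f p d(2), of y] unfolding r_def by blast
  then obtain \<xi> where \<xi>: "\<And>y j. y \<in> open_box n p d \<Longrightarrow> j < n \<Longrightarrow> \<xi> y j \<in> closed_box n p (r y)"
      "\<And>y. y \<in> open_box n p d \<Longrightarrow> f y - f p = (\<Sum>j<n. partial j f (\<xi> y j) * (y j - p j))" by metis
  have near: "eventually (\<lambda>t. \<gamma> t \<in> open_box n p e) (nhds t0)" if "e > 0" for e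
  proof -
    have "eventually (\<lambda>t. \<forall>j\<in>{..<n}. \<bar>\<gamma> t j - p j\<bar> < e) (nhds t0)"
    proof (intro eventually_ball_finite ballI)
      fix j assume "j \<in> {..<n}"
      then have "isCont (\<lambda>t. \<gamma> t j) t0" using \<gamma> DERIV_isCont by blast
      then have "((\<lambda>t. \<gamma> t j) \<longlongrightarrow> p j) (nhds t0)"
        by (metis isCont_def p_def tendsto_at_iff_tendsto_nhds)
      from tendstoD[OF this that] show "eventually (\<lambda>t. \<bar>\<gamma> t j - p j\<bar> < e) (nhds t0)"
        by (simp add: dist_real_def)
    qed simp
    with \<gamma>E show ?thesis
      by eventually_elim (auto simp: open_box_def topspace_Euclidean_space)
  qed
  have lim: "((\<lambda>t. partial j f (\<xi> (\<gamma> t) j)) \<longlongrightarrow> partial j f p) (at t0)" if j: "j < n" for j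
  proof (rule tendstoI)
    fix e :: real assume "e > 0"
    then obtain d' where d': "d' > 0" "open_box n p d' \<subseteq> W" "\<And>y. y \<in> open_box n p d' \<Longrightarrow> \<bar>partial j f y - partial j f p\<bar> < e"
      using continuous_on_open_box[OF W pf[OF j] \<gamma>0] unfolding p_def by metis
    \<comment> \<open>Radius \<open>d\<close> makes the increment formula available, radius
      \<open>d'\<close> makes the partial derivative vary by less than e.\<close>
    have "eventually (\<lambda>t. \<gamma> t \<in> open_box n p (min d d')) (at t0)"
      using near[of "min d d'"] d d' by (auto simp: eventually_at_filter elim: eventually_mono)
    then show "eventually (\<lambda>t. dist (partial j f (\<xi> (\<gamma> t) j)) (partial j f p) < e) (at t0)"
    proof eventually_elim
      case (elim t)
      have "r (\<gamma> t) < d'"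
        using elim d'(1) by (auto simp: r_def open_box_def)
      then have "\<xi> (\<gamma> t) j \<in> open_box n p d'"
        using \<xi>(1)[OF _ j, of "\<gamma> t"] elim closed_box_subset_open_box[of "r (\<gamma> t)" d' n p] by (auto simp: open_box_def)
      then show ?case using d'(3) by (simp add: dist_real_def)
    qed
  qed
  have "((\<lambda>t. \<Sum>j<n. partial j f (\<xi> (\<gamma> t) j) * ((\<gamma> t j - \<gamma> t0 j) / (t - t0))) \<longlongrightarrow>
      (\<Sum>j<n. partial j f p * \<gamma>' j)) (at t0)"
    using \<gamma> by (intro tendsto_sum tendsto_mult lim) (auto simp: has_field_derivative_iff)
  moreover have "eventually (\<lambda>t. (\<Sum>j<n. partial j f (\<xi> (\<gamma> t) j) * ((\<gamma> t j - \<gamma> t0 j) / (t - t0))) =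
      (f (\<gamma> t) - f (\<gamma> t0)) / (t - t0)) (at t0)"
    using near[OF d(1)] unfolding eventually_at_filter
    by eventually_elim (use \<xi>(2) in \<open>auto simp: p_def sum_divide_distrib\<close>)
  ultimately show ?thesis
    unfolding has_field_derivative_iff p_def
    by (rule Lim_transform_eventually)
qed

section \<open>Convergence of all partial derivatives\<close>

text \<open>Convergence of each derivative is only pointwise, with smoothness of the limit built in.
  This suffices for passing to the limit in non-strict inequalities, and it survives sums, products
  and composition without any estimates.\<close>

definition smooth_conv :: "nat \<Rightarrow> pt set \<Rightarrow> (nat \<Rightarrow> pt \<Rightarrow> real) \<Rightarrow> (pt \<Rightarrow> real) \<Rightarrow> bool" where
  "smooth_conv n U F f \<longleftrightarrow> (\<forall>k. smooth_on n U (F k)) \<and> smooth_on n U f \<and>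
     (\<forall>is \<in> lists {..<n}. \<forall>x\<in>U. (\<lambda>k. partials is (F k) x) \<longlonglongrightarrow> partials is f x)"

lemma smooth_conv_const: "smooth_on n U f \<Longrightarrow> smooth_conv n U (\<lambda>_. f) f"
  by (simp add: smooth_conv_def)

lemma smooth_conv_pointwise: "smooth_conv n U F f \<Longrightarrow> x \<in> U \<Longrightarrow> (\<lambda>k. F k x) \<longlonglongrightarrow> f x"
  unfolding smooth_conv_def by (auto dest!: bspec[where x = "[]"])

lemma smooth_conv_cong:
  assumes U: "openin (Euclidean_space n) U" and "smooth_conv n U F f"
    and "\<And>k x. x \<in> U \<Longrightarrow> F k x = G k x" "\<And>x. x \<in> U \<Longrightarrow> f x = g x"
  shows "smooth_conv n U G g"
proof -
  have "smooth_on n U (G k)" for k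
    using assms smooth_on_cong[OF U, of "F k" "G k"] by (auto simp: smooth_conv_def)
  moreover have "smooth_on n U g"
    using assms smooth_on_cong[OF U, of "f" "g"] by (auto simp: smooth_conv_def)
  moreover have "(\<lambda>k. partials is (G k) x) \<longlonglongrightarrow> partials is g x" if "is \<in> lists {..<n}" "x \<in> U" for "is" x
  proof -
    have "partials is (F k) x = partials is (G k) x" "partials is f x = partials is g x" for k
      using partials_cong[of n U "F k" "G k"] partials_cong[of n U f g] assms that by auto
    moreover have "(\<lambda>k. partials is (F k) x) \<longlonglongrightarrow> partials is f x"
      using assms(2) that unfolding smooth_conv_def by blast
    ultimately show ?thesis by simp
  qed
  ultimately show ?thesis by (simp add: smooth_conv_def)
qed

lemma C1_on_local:
  assumes "\<And>x. x \<in> U \<Longrightarrow> \<exists>D. openin (Euclidean_space n) D \<and> x \<in> D \<and> D \<subseteq> U \<and> C1_on n D f"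
  shows "C1_on n U f"
proof -
  obtain D where D: "\<And>x. x \<in> U \<Longrightarrow> openin (Euclidean_space n) (D x) \<and> x \<in> D x \<and> D x \<subseteq> U \<and> C1_on n (D x) f"
    using assms by metis
  then have U: "U \<subseteq> topspace (Euclidean_space n)" using openin_subset by blast
  have "continuous (at x within U) f" if x: "x \<in> U" for x
  proof -
    obtain T where T: "open T" "D x = topspace (Euclidean_space n) \<inter> T"
      using D[OF x] Euclidean_space_eq_top_of_set by (metis openin_open)
    have "at x within U = at x within D x"
      by (rule at_within_nhd[of x T]) (use T D[OF x] U in auto)
    moreover have "continuous (at x within D x) f"
      using D[OF x] by (auto simp: C1_on_def continuous_on_eq_continuous_within)
    ultimately show ?thesis by simp
  qed
  then have "continuous_on U f" by (simp add: continuous_on_eq_continuous_within)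
  then show ?thesis using D unfolding C1_on_def by blast
qed

text \<open>Needed because the factorisation of an object through a chart of the cover exists only
  near each point, and the chart changes with the point.\<close>

lemma smooth_conv_local:
  assumes U: "openin (Euclidean_space n) U"
    and "\<And>x. x \<in> U \<Longrightarrow> \<exists>D. openin (Euclidean_space n) D \<and> x \<in> D \<and> D \<subseteq> U \<and> smooth_conv n D F f"
  shows "smooth_conv n U F f"
proof -
  have "C1_on n U (partials is (F k))" "C1_on n U (partials is f)" if "is \<in> lists {..<n}" for k "is"
  proof -
    have ex: "\<exists>D. openin (Euclidean_space n) D \<and> x \<in> D \<and> D \<subseteq> U \<and> C1_on n D (partials is (F k))"
      "\<exists>D. openin (Euclidean_space n) D \<and> x \<in> D \<and> D \<subseteq> U \<and> C1_on n D (partials is f)"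
      if x: "x \<in> U" for x
    proof -
      obtain D where "openin (Euclidean_space n) D" "x \<in> D" "D \<subseteq> U" "smooth_conv n D F f"
        using assms(2)[OF x] by blast
      moreover from this have "C1_on n D (partials is (F k))" "C1_on n D (partials is f)"
        using \<open>is \<in> lists {..<n}\<close> unfolding smooth_conv_def smooth_on_iff_C1_on[OF \<open>openin (Euclidean_space n) D\<close>] by blast+
      ultimately show
        "\<exists>D. openin (Euclidean_space n) D \<and> x \<in> D \<and> D \<subseteq> U \<and> C1_on n D (partials is (F k))"
        "\<exists>D. openin (Euclidean_space n) D \<and> x \<in> D \<and> D \<subseteq> U \<and> C1_on n D (partials is f)"
        by blast+
    qed
    show "C1_on n U (partials is (F k))" by (rule C1_on_local[OF ex(1)])
    show "C1_on n U (partials is f)" by (rule C1_on_local[OF ex(2)])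
  qed
  moreover have "(\<lambda>k. partials is (F k) x) \<longlonglongrightarrow> partials is f x" if "is \<in> lists {..<n}" "x \<in> U" for "is" x
    using assms(2) that unfolding smooth_conv_def by blast
  ultimately show ?thesis
    unfolding smooth_conv_def smooth_on_iff_C1_on[OF U] by blast
qed

text \<open>A coinduction principle: membership in a class of convergent sequences that is stable under
  partial derivatives (up to equality on U) already gives convergence of all derivatives.\<close>

lemma smooth_conv_coinduct:
  assumes U: "openin (Euclidean_space n) U" and "S F f"
    and S: "\<And>F f. S F f \<Longrightarrow> (\<forall>k. C1_on n U (F k)) \<and> C1_on n U f \<and> (\<forall>x\<in>U. (\<lambda>k. F k x) \<longlonglongrightarrow> f x)"
    and ex: "\<And>F f i. S F f \<Longrightarrow> i < n \<Longrightarrow> \<exists>G g. S G g \<and>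
      (\<forall>x\<in>U. partial i f x = g x) \<and> (\<forall>k. \<forall>x\<in>U. partial i (F k) x = G k x)"
  shows "smooth_conv n U F f"
proof -
  have *: "\<exists>G g. S G g \<and> (\<forall>x\<in>U. partials is f x = g x) \<and> (\<forall>k. \<forall>x\<in>U. partials is (F k) x = G k x)"
    if "is \<in> lists {..<n}" for "is"
    using that
  proof (induction "is")
    case Nil
    then show ?case using assms(2) by auto
  next
    case (Cons i "is")
    then have i: "i < n" by auto
    from Cons obtain G g where G: "S G g" "\<And>x. x \<in> U \<Longrightarrow> partials is f x = g x"
      "\<And>k x. x \<in> U \<Longrightarrow> partials is (F k) x = G k x" by auto
    obtain H h where H: "S H h" "\<And>x. x \<in> U \<Longrightarrow> partial i g x = h x"
      "\<And>k x. x \<in> U \<Longrightarrow> partial i (G k) x = H k x" using ex[OF G(1) i] by blast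
    show ?case
      using H partial_cong(1)[OF U _ i G(2)] partial_cong(1)[OF U _ i G(3)]
      by (intro exI[of _ H] exI[of _ h]) simp
  qed
  have "C1_on n U (partials is (F k))" "C1_on n U (partials is f)"
    "\<forall>x\<in>U. (\<lambda>k. partials is (F k) x) \<longlonglongrightarrow> partials is f x"
    if il: "is \<in> lists {..<n}" for k "is"
  proof -
    obtain G g where G: "S G g" "\<And>x. x \<in> U \<Longrightarrow> partials is f x = g x"
      "\<And>k x. x \<in> U \<Longrightarrow> partials is (F k) x = G k x" using *[OF il] by blast
    show "C1_on n U (partials is (F k))"
      using S[OF G(1)] by (intro C1_on_cong[OF U G(3)[symmetric]]) blast+
    show "C1_on n U (partials is f)"
      using S[OF G(1)] by (intro C1_on_cong[OF U G(2)[symmetric]]) blast+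
    show "\<forall>x\<in>U. (\<lambda>k. partials is (F k) x) \<longlonglongrightarrow> partials is f x"
    proof
      fix x assume x: "x \<in> U"
      then have "(\<lambda>k. G k x) \<longlonglongrightarrow> g x" using S[OF G(1)] by blast
      then show "(\<lambda>k. partials is (F k) x) \<longlonglongrightarrow> partials is f x"
        unfolding G(2,3)[OF x] .
    qed
  qed
  then show ?thesis
    unfolding smooth_conv_def smooth_on_iff_C1_on[OF U] by blast
qed

lemma partials_append: "partials (is @ js) f = partials is (partials js f)"
  by (induction "is") auto

text \<open>The last letter of a word acts first, so the words applied to \<open>partial i f\<close>
  are the words applied to \<open>f\<close> that end in i.\<close>

lemma smooth_on_partial:
  assumes "smooth_on n U f" "i < n"
  shows "smooth_on n U (partial i f)"
  unfolding smooth_on_def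
proof
  fix "is" assume "is \<in> lists {..<n}"
  then have "is @ [i] \<in> lists {..<n}" using assms(2) by auto
  from bspec[OF assms(1)[unfolded smooth_on_def] this]
  show "continuous_map (subtopology (Euclidean_space n) U) euclideanreal (partials is (partial i f)) \<and>
      (\<forall>j<n. \<forall>x\<in>U. (\<lambda>t. partials is (partial i f) (x(j := t))) differentiable (at (x j)))"
    unfolding partials_append partials.simps .
qed

lemma smooth_conv_partial:
  assumes "smooth_conv n U F f" "i < n"
  shows "smooth_conv n U (\<lambda>k. partial i (F k)) (partial i f)"
proof -
  have "(\<lambda>k. partials is (partial i (F k)) x) \<longlonglongrightarrow> partials is (partial i f) x"
    if "is \<in> lists {..<n}" "x \<in> U" for "is" x
  proof -
    have "is @ [i] \<in> lists {..<n}" using that assms(2) by auto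
    then have "(\<lambda>k. partials (is @ [i]) (F k) x) \<longlonglongrightarrow> partials (is @ [i]) f x"
      using assms(1) that(2) unfolding smooth_conv_def by blast
    then show ?thesis unfolding partials_append partials.simps .
  qed
  then show ?thesis using assms smooth_on_partial by (simp add: smooth_conv_def)
qed

section \<open>Elementary smooth functions and the chain rule\<close>

lemma smooth_on_imp_C1_on:
  assumes "openin (Euclidean_space n) U" "smooth_on n U f"
  shows "C1_on n U f"
proof -
  have "[] \<in> lists {..<n}" by simp
  with assms have "C1_on n U (partials [] f)" unfolding smooth_on_iff_C1_on[OF assms(1)] by blast
  then show ?thesis by simp
qed

lemma smooth_on_imp_continuous_on:
  "openin (Euclidean_space n) U \<Longrightarrow> smooth_on n U f \<Longrightarrow> continuous_on U f"
  using smooth_on_imp_C1_on C1_on_def by blast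

lemma smooth_conv_C1:
  assumes "openin (Euclidean_space n) U" "smooth_conv n U F f"
  shows "C1_on n U (F k)" "C1_on n U f"
  using assms smooth_on_imp_C1_on by (auto simp: smooth_conv_def)

text \<open>Every iterated derivative is again a constant function, so the induction needs no more
  than the existence of some constant.\<close>

lemma smooth_on_const:
  assumes U: "openin (Euclidean_space n) U"
  shows "smooth_on n U (\<lambda>_. c)"
proof -
  have p: "partial i (\<lambda>_. c) = (\<lambda>_. 0)" for i c by (auto simp: partial_def fun_eq_iff)
  have "\<exists>c'. partials is (\<lambda>_. c) = (\<lambda>_. c')" for "is"
    by (induction "is") (auto simp: p)
  moreover have "C1_on n U (\<lambda>_. c')" for c' by (auto simp: C1_on_def)
  ultimately have "C1_on n U (partials is (\<lambda>_. c))" for "is" by (metis (no_types))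
  then show ?thesis unfolding smooth_on_iff_C1_on[OF U] by blast
qed

lemma smooth_on_coordinate:
  assumes U: "openin (Euclidean_space n) U"
  shows "smooth_on n U (\<lambda>x. x j)"
proof -
  have d: "((\<lambda>t. (x(i := t)) j) has_field_derivative (if i = j then 1 else 0)) (at (x i))" for i and x :: pt
    by (cases "i = j") auto
  have c: "continuous_on U (\<lambda>x. x j)"
    by (rule continuous_on_subset[OF continuous_on_product_coordinates subset_UNIV])
  have C1: "C1_on n U (\<lambda>x. x j)"
    unfolding C1_on_def by (intro conjI c allI impI ballI real_differentiable_def[THEN iffD2, OF exI, OF d])
  have p: "partial i (\<lambda>x. x j) = (\<lambda>_. if i = j then 1 else 0)" for i
    unfolding partial_def by (rule ext, rule DERIV_imp_deriv, rule d)
  have "C1_on n U (partials is (\<lambda>x. x j))" if "is \<in> lists {..<n}" for "is"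
  \<comment> \<open>The split is at the last letter because it is applied first: it already turns
    the coordinate into a constant.\<close>
  proof (cases "is" rule: rev_cases)
    case Nil
    then show ?thesis using C1 by simp
  next
    case (snoc js i)
    then have "js \<in> lists {..<n}" using that by auto
    then have "C1_on n U (partials js (\<lambda>_. if i = j then 1 else 0))"
      using smooth_on_const[OF U] unfolding smooth_on_iff_C1_on[OF U] by blast
    then show ?thesis by (simp add: snoc partials_append p)
  qed
  then show ?thesis unfolding smooth_on_iff_C1_on[OF U] by blast
qed

text \<open>\<open>smooth_between\<close> speaks only of the coordinates below the target dimension;
  the others vanish on \<open>U\<close>, since the image lies in Euclidean space.\<close>

lemma smooth_between_coordinate:
  "smooth_between m U n g \<Longrightarrow> smooth_on m U (\<lambda>x. g x j)" if U: "openin (Euclidean_space m) U"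
proof (cases "j < n")
  case False
  assume "smooth_between m U n g"
  with False show ?thesis
    by (intro smooth_on_cong[OF U _ smooth_on_const[OF U, of 0]])
       (auto simp: smooth_between_def topspace_Euclidean_space image_subset_iff)
qed (simp add: smooth_between_def)

lemma smooth_between_continuous_on:
  assumes U: "openin (Euclidean_space m) U" and g: "smooth_between m U n g"
  shows "continuous_on U g"
  using smooth_between_coordinate[OF U g]
  by (intro continuous_on_coordinatewise_then_product smooth_on_imp_continuous_on[OF U])

text \<open>For fixed \<open>x\<close> and \<open>i\<close> this is differentiation of
  \<open>f\<close> along the curve t \<mapsto> \<open>g (x(i := t))\<close>.\<close>

lemma C1_on_compose:
  assumes D: "openin (Euclidean_space m) D" and W: "openin (Euclidean_space n) W"
    and g: "smooth_between m D n g" "g ` D \<subseteq> W" and f: "smooth_on n W f"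
  shows "C1_on m D (\<lambda>x. f (g x))"
    "\<And>i x. i < m \<Longrightarrow> x \<in> D \<Longrightarrow> partial i (\<lambda>x. f (g x)) x = (\<Sum>j<n. partial j f (g x) * partial i (\<lambda>x. g x j) x)"
proof -
  have f1: "C1_on n W f" by (rule smooth_on_imp_C1_on[OF W f])
  have f2: "continuous_on W (partial j f)" if "j < n" for j
    by (rule smooth_on_imp_continuous_on[OF W smooth_on_partial[OF f that]])
  have gj: "C1_on m D (\<lambda>x. g x j)" for j
    by (rule smooth_on_imp_C1_on[OF D smooth_between_coordinate[OF D g(1)]])
  have c: "continuous_on D (\<lambda>x. f (g x))"
    by (rule continuous_on_compose2[OF smooth_on_imp_continuous_on[OF W f]
          smooth_between_continuous_on[OF D g(1)] g(2)])
  have d: "((\<lambda>t. f (g (x(i := t)))) has_field_derivative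
      (\<Sum>j<n. partial j f (g x) * partial i (\<lambda>x. g x j) x)) (at (x i))" if "i < m" "x \<in> D" for i x
  proof -
    have "eventually (\<lambda>t. g (x(i := t)) \<in> topspace (Euclidean_space n)) (nhds (x i))"
      using eventually_upd_in_open[OF D that(2,1)] by eventually_elim (use g in \<open>auto simp: smooth_between_def\<close>)
    with has_derivative_along_curve[OF W f1 f2, of "\<lambda>t. g (x(i := t))" "\<lambda>j. partial i (\<lambda>x. g x j) x" "x i"]
      C1_on_has_partial[OF gj that(2,1)] g(2) that(2)
    show ?thesis by auto
  qed
  note * = C1_onI[of D "\<lambda>x. f (g x)", OF c d]
  show "C1_on m D (\<lambda>x. f (g x))" by (rule *(1))
  show "partial i (\<lambda>x. f (g x)) x = (\<Sum>j<n. partial j f (g x) * partial i (\<lambda>x. g x j) x)" if "i < m" "x \<in> D" for i x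
    using *(2)[of m i x] that by simp
qed

text \<open>The algebra generated by the convergent sequences on \<open>D\<close> and the pullbacks
  along \<open>g\<close> of those on \<open>W\<close>. It is stable under differentiation: by the
  chain rule a derivative of a pullback is a sum of pullbacks times derivatives of coordinates of
  \<open>g\<close>, and the product rule handles the rest. This makes it a witness for the
  coinduction principle.\<close>

inductive smooth_conv_algebra for n W m D g where
  base: "smooth_conv m D F f \<Longrightarrow> smooth_conv_algebra n W m D g F f"
| pull: "smooth_conv n W F f \<Longrightarrow> smooth_conv_algebra n W m D g (\<lambda>k x. F k (g x)) (\<lambda>x. f (g x))"
| add: "smooth_conv_algebra n W m D g F f \<Longrightarrow> smooth_conv_algebra n W m D g G h \<Longrightarrow>
    smooth_conv_algebra n W m D g (\<lambda>k x. F k x + G k x) (\<lambda>x. f x + h x)"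
| mult: "smooth_conv_algebra n W m D g F f \<Longrightarrow> smooth_conv_algebra n W m D g G h \<Longrightarrow>
    smooth_conv_algebra n W m D g (\<lambda>k x. F k x * G k x) (\<lambda>x. f x * h x)"

lemma smooth_conv_algebra_sum:
  assumes D: "openin (Euclidean_space m) D" and "\<And>j. j < N \<Longrightarrow> smooth_conv_algebra n W m D g (F j) (f j)"
  shows "smooth_conv_algebra n W m D g (\<lambda>k x. \<Sum>j<N. F j k x) (\<lambda>x. \<Sum>j<(N::nat). f j x)"
  using assms(2)
proof (induction N)
  case 0
  then show ?case using smooth_conv_algebra.base[OF smooth_conv_const[OF smooth_on_const[OF D, of 0]]] by simp
next
  case (Suc N)
  then show ?case by (auto intro: smooth_conv_algebra.add)
qed

lemma smooth_conv_compose: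
  assumes D: "openin (Euclidean_space m) D" and W: "openin (Euclidean_space n) W"
    and g: "smooth_between m D n g" "g ` D \<subseteq> W" and F: "smooth_conv n W F f"
  shows "smooth_conv m D (\<lambda>k x. F k (g x)) (\<lambda>x. f (g x))"
proof (rule smooth_conv_coinduct[OF D, where S = "smooth_conv_algebra n W m D g"])
  show "smooth_conv_algebra n W m D g (\<lambda>k x. F k (g x)) (\<lambda>x. f (g x))"
    using F by (rule smooth_conv_algebra.pull)
next
  fix F f assume "smooth_conv_algebra n W m D g F f"
  then show *: "(\<forall>k. C1_on m D (F k)) \<and> C1_on m D f \<and> (\<forall>x\<in>D. (\<lambda>k. F k x) \<longlonglongrightarrow> f x)"
  proof induction
    case (base F f)
    then show ?case using smooth_conv_C1[OF D] smooth_conv_pointwise by blast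
  next
    case (pull F f)
    then have "smooth_on n W (F k)" "smooth_on n W f" for k by (auto simp: smooth_conv_def)
    then show ?case using pull C1_on_compose(1)[OF D W g] smooth_conv_pointwise[OF pull] g(2) by blast
  next
    case (add F f G h)
    then show ?case by (auto intro: C1_on_add tendsto_add)
  next
    case (mult F f G h)
    then show ?case by (auto intro: C1_on_mult tendsto_mult)
  qed
next
  fix F f i assume *: "smooth_conv_algebra n W m D g F f" and i: "i < m"
  \<comment> \<open>The \<open>C1_on\<close> claims are carried through the induction because the
    sum and product rules for partial derivatives require them of both operands.\<close>
  from * have "(\<forall>k. C1_on m D (F k)) \<and> C1_on m D f \<and> (\<exists>G h. smooth_conv_algebra n W m D g G h \<and>
      (\<forall>x\<in>D. partial i f x = h x) \<and> (\<forall>k. \<forall>x\<in>D. partial i (F k) x = G k x))"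
  proof induction
    case (base F f)
    have "smooth_conv_algebra n W m D g (\<lambda>k. partial i (F k)) (partial i f)"
      by (rule smooth_conv_algebra.base[OF smooth_conv_partial[OF base i]])
    then have "\<exists>K l. smooth_conv_algebra n W m D g K l \<and> (\<forall>x\<in>D. partial i f x = l x) \<and>
        (\<forall>k. \<forall>x\<in>D. partial i (F k) x = K k x)"
      by (intro exI[of _ "\<lambda>k. partial i (F k)"] exI[of _ "partial i f"]) simp
    then show ?case using smooth_conv_C1[OF D base] by simp
  next
    case (pull F f)
    then have s: "smooth_on n W (F k)" "smooth_on n W f" for k by (auto simp: smooth_conv_def)
    have "smooth_conv_algebra n W m D g (\<lambda>k x. \<Sum>j<n. partial j (F k) (g x) * partial i (\<lambda>x. g x j) x)
      (\<lambda>x. \<Sum>j<n. partial j f (g x) * partial i (\<lambda>x. g x j) x)"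
    proof (intro smooth_conv_algebra_sum[OF D] smooth_conv_algebra.mult)
      fix j assume "j < n"
      then show "smooth_conv_algebra n W m D g (\<lambda>k x. partial j (F k) (g x)) (\<lambda>x. partial j f (g x))"
        by (rule smooth_conv_algebra.pull[OF smooth_conv_partial[OF pull]])
      show "smooth_conv_algebra n W m D g (\<lambda>k x. partial i (\<lambda>x. g x j) x) (\<lambda>x. partial i (\<lambda>x. g x j) x)"
        by (rule smooth_conv_algebra.base[OF smooth_conv_const[OF smooth_on_partial[OF smooth_between_coordinate[OF D g(1)] i]]])
    qed
    then have "\<exists>K l. smooth_conv_algebra n W m D g K l \<and> (\<forall>x\<in>D. partial i (\<lambda>x. f (g x)) x = l x) \<and>
        (\<forall>k. \<forall>x\<in>D. partial i (\<lambda>x. F k (g x)) x = K k x)"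
      using C1_on_compose(2)[OF D W g s(1) i] C1_on_compose(2)[OF D W g s(2) i]
      by (intro exI[of _ "\<lambda>k x. \<Sum>j<n. partial j (F k) (g x) * partial i (\<lambda>x. g x j) x"]
          exI[of _ "\<lambda>x. \<Sum>j<n. partial j f (g x) * partial i (\<lambda>x. g x j) x"]) simp
    then show ?case using C1_on_compose(1)[OF D W g s(1)] C1_on_compose(1)[OF D W g s(2)] by simp
  next
    case (add F f G h)
    then obtain F' f' G' h' where "smooth_conv_algebra n W m D g F' f'" "smooth_conv_algebra n W m D g G' h'"
      and P: "\<forall>x\<in>D. partial i f x = f' x" "\<forall>k. \<forall>x\<in>D. partial i (F k) x = F' k x"
      "\<forall>x\<in>D. partial i h x = h' x" "\<forall>k. \<forall>x\<in>D. partial i (G k) x = G' k x" by blast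
    have C: "C1_on m D (F k)" "C1_on m D f" "C1_on m D (G k)" "C1_on m D h" for k
      using add.IH by blast+
    have c1: "C1_on m D (\<lambda>x. F k x + G k x)" "C1_on m D (\<lambda>x. f x + h x)" for k
      using C by (simp_all add: C1_on_add(1))
    have "smooth_conv_algebra n W m D g (\<lambda>k x. F' k x + G' k x) (\<lambda>x. f' x + h' x)"
      by (rule smooth_conv_algebra.add) fact+
    moreover have "partial i (\<lambda>x. f x + h x) x = f' x + h' x"
      "partial i (\<lambda>x. F k x + G k x) x = F' k x + G' k x" if "x \<in> D" for k x
      using P that C1_on_add(2)[OF C(1,3) i that] C1_on_add(2)[OF C(2,4) i that] by simp_all
    ultimately have "smooth_conv_algebra n W m D g (\<lambda>k x. F' k x + G' k x) (\<lambda>x. f' x + h' x) \<and>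
        (\<forall>x\<in>D. partial i (\<lambda>x. f x + h x) x = f' x + h' x) \<and>
        (\<forall>k. \<forall>x\<in>D. partial i (\<lambda>x. F k x + G k x) x = F' k x + G' k x)"
      by simp
    then have "\<exists>K l. smooth_conv_algebra n W m D g K l \<and> (\<forall>x\<in>D. partial i (\<lambda>x. f x + h x) x = l x) \<and>
        (\<forall>k. \<forall>x\<in>D. partial i (\<lambda>x. F k x + G k x) x = K k x)"
      by (intro exI[of _ "\<lambda>k x. F' k x + G' k x"] exI[of _ "\<lambda>x. f' x + h' x"])
    with c1 show ?case by simp
  next
    case (mult F f G h)
    then obtain F' f' G' h' where "smooth_conv_algebra n W m D g F' f'" "smooth_conv_algebra n W m D g G' h'"
      and P: "\<forall>x\<in>D. partial i f x = f' x" "\<forall>k. \<forall>x\<in>D. partial i (F k) x = F' k x"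
      "\<forall>x\<in>D. partial i h x = h' x" "\<forall>k. \<forall>x\<in>D. partial i (G k) x = G' k x" by blast
    have C: "C1_on m D (F k)" "C1_on m D f" "C1_on m D (G k)" "C1_on m D h" for k
      using mult.IH by blast+
    have c1: "C1_on m D (\<lambda>x. F k x * G k x)" "C1_on m D (\<lambda>x. f x * h x)" for k
      using C by (simp_all add: C1_on_mult(1))
    have "smooth_conv_algebra n W m D g (\<lambda>k x. F' k x * G k x + F k x * G' k x) (\<lambda>x. f' x * h x + f x * h' x)"
      by (intro smooth_conv_algebra.add; rule smooth_conv_algebra.mult) fact+
    moreover have "partial i (\<lambda>x. f x * h x) x = f' x * h x + f x * h' x"
      "partial i (\<lambda>x. F k x * G k x) x = F' k x * G k x + F k x * G' k x" if "x \<in> D" for k x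
      using P that C1_on_mult(2)[OF C(1,3) i that] C1_on_mult(2)[OF C(2,4) i that] by simp_all
    ultimately have "smooth_conv_algebra n W m D g (\<lambda>k x. F' k x * G k x + F k x * G' k x) (\<lambda>x. f' x * h x + f x * h' x) \<and>
        (\<forall>x\<in>D. partial i (\<lambda>x. f x * h x) x = f' x * h x + f x * h' x) \<and>
        (\<forall>k. \<forall>x\<in>D. partial i (\<lambda>x. F k x * G k x) x = F' k x * G k x + F k x * G' k x)"
      by simp
    then have "\<exists>K l. smooth_conv_algebra n W m D g K l \<and> (\<forall>x\<in>D. partial i (\<lambda>x. f x * h x) x = l x) \<and>
        (\<forall>k. \<forall>x\<in>D. partial i (\<lambda>x. F k x * G k x) x = K k x)"
      by (intro exI[of _ "\<lambda>k x. F' k x * G k x + F k x * G' k x"] exI[of _ "\<lambda>x. f' x * h x + f x * h' x"])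
    with c1 show ?case by simp
  qed
  then show "\<exists>G h. smooth_conv_algebra n W m D g G h \<and>
      (\<forall>x\<in>D. partial i f x = h x) \<and> (\<forall>k. \<forall>x\<in>D. partial i (F k) x = G k x)" by blast
qed

section \<open>Restriction and composition of smooth maps\<close>

lemma C1_on_subset: "C1_on n U f \<Longrightarrow> U' \<subseteq> U \<Longrightarrow> C1_on n U' f"
  unfolding C1_on_def using continuous_on_subset by blast

lemma smooth_conv_subset:
  assumes "openin (Euclidean_space n) U" "openin (Euclidean_space n) U'" "U' \<subseteq> U" "smooth_conv n U F f"
  shows "smooth_conv n U' F f"
proof -
  have "C1_on n U' (partials is (F k))" "C1_on n U' (partials is f)"
    if "is \<in> lists {..<n}" for k "is"
    using assms(4) that C1_on_subset[OF _ assms(3)]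
    unfolding smooth_conv_def smooth_on_iff_C1_on[OF assms(1)] by blast+
  moreover have "\<forall>is\<in>lists {..<n}. \<forall>x\<in>U'. (\<lambda>k. partials is (F k) x) \<longlonglongrightarrow> partials is f x"
    using assms(3,4) unfolding smooth_conv_def by blast
  ultimately show ?thesis
    unfolding smooth_conv_def smooth_on_iff_C1_on[OF assms(2)] by blast
qed

text \<open>A single function is a constant sequence, so facts on smooth functions are read off from
  those on convergent sequences; the same device gives \<open>smooth_on_compose\<close>.\<close>

lemma smooth_on_subset:
  assumes "openin (Euclidean_space n) U" "openin (Euclidean_space n) U'" "U' \<subseteq> U" "smooth_on n U f"
  shows "smooth_on n U' f"
  using smooth_conv_subset[OF assms(1-3) smooth_conv_const[OF assms(4)]] by (simp add: smooth_conv_def)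

lemma smooth_on_compose:
  assumes "openin (Euclidean_space m) D" "openin (Euclidean_space n) W"
    "smooth_between m D n g" "g ` D \<subseteq> W" "smooth_on n W f"
  shows "smooth_on m D (\<lambda>x. f (g x))"
  using smooth_conv_compose[OF assms(1-4) smooth_conv_const[OF assms(5)]] by (simp add: smooth_conv_def)

lemma smooth_between_compose:
  assumes "openin (Euclidean_space m) D" "openin (Euclidean_space n) W"
    "smooth_between m D n g" "g ` D \<subseteq> W" "smooth_between n W k h"
  shows "smooth_between m D k (\<lambda>x. h (g x))"
proof -
  have 1: "smooth_on m D (\<lambda>x. h (g x) i)" if "i < k" for i
    using smooth_on_compose[OF assms(1-4), of "\<lambda>y. h y i"] assms(5) that by (simp add: smooth_between_def)
  have "(\<lambda>x. h (g x)) ` D = h ` g ` D" by (simp add: image_image)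
  also have "\<dots> \<subseteq> h ` W" by (rule image_mono[OF assms(4)])
  also have "\<dots> \<subseteq> topspace (Euclidean_space k)" using assms(5) by (simp add: smooth_between_def)
  finally show ?thesis using 1 by (simp add: smooth_between_def)
qed

lemma smooth_between_cong:
  assumes "openin (Euclidean_space m) D" "\<And>x. x \<in> D \<Longrightarrow> g x = h x" "smooth_between m D n g"
  shows "smooth_between m D n h"
proof -
  have "smooth_on m D (\<lambda>x. h x i)" if "i < n" for i
  proof (rule smooth_on_cong[OF assms(1)])
    show "smooth_on m D (\<lambda>x. g x i)" using assms(3) that unfolding smooth_between_def by blast
    show "g x i = h x i" if "x \<in> D" for x using assms(2)[OF that] by simp
  qed
  moreover have "h ` D = g ` D" by (rule image_cong[OF refl assms(2)[symmetric]])
  ultimately show ?thesis using assms(3) unfolding smooth_between_def by presburger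
qed

lemma smooth_between_subset:
  assumes "openin (Euclidean_space m) U" "openin (Euclidean_space m) U'" "U' \<subseteq> U" "smooth_between m U n g"
  shows "smooth_between m U' n g"
  unfolding smooth_between_def
proof (intro conjI allI impI)
  show "g ` U' \<subseteq> topspace (Euclidean_space n)"
    using assms(3,4) unfolding smooth_between_def by blast
  show "smooth_on m U' (\<lambda>x. g x i)" if "i < n" for i
    using assms(4) that unfolding smooth_between_def by (blast intro: smooth_on_subset[OF assms(1-3)])
qed

lemma smooth_between_id:
  assumes "openin (Euclidean_space n) U"
  shows "smooth_between n U n (\<lambda>x. x)"
  using smooth_on_coordinate[OF assms] openin_subset[OF assms] by (simp add: smooth_between_def)

text \<open>\<open>L is\<close> is the candidate for the derivative of the limit along the word. The
  classical exchange of limit and derivative, used on one-dimensional slices, shows that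
  differentiating \<open>L is\<close> in direction i gives \<open>L (i # is)\<close>. The sequences
  of derivatives along all words are then a class to which the coinduction principle
  applies.\<close>

lemma smooth_conv_of_uniform_limits:
  assumes U: "openin (Euclidean_space n) U" and F: "\<And>k. smooth_on n U (F k)"
    and L: "\<And>is. is \<in> lists {..<n} \<Longrightarrow> uniform_limit U (\<lambda>k. partials is (F k)) (L is) sequentially"
  shows "smooth_conv n U F (L [])"
proof -
  have C: "C1_on n U (partials is (F k))" if "is \<in> lists {..<n}" for k "is"
    using F that unfolding smooth_on_iff_C1_on[OF U] by blast
  have lim: "(\<lambda>k. partials is (F k) x) \<longlonglongrightarrow> L is x" if "is \<in> lists {..<n}" "x \<in> U" for "is" x
    using tendsto_uniform_limitI[OF L[OF that(1)] that(2)] .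
  have cont: "continuous_on U (L is)" if "is \<in> lists {..<n}" for "is"
    using C[OF that] by (intro uniform_limit_theorem[OF _ L[OF that]]) (auto simp: C1_on_def)
  have der: "((\<lambda>t. L is (x(i := t))) has_field_derivative L (i # is) x) (at (x i))"
    if il: "is \<in> lists {..<n}" and i: "i < n" and x: "x \<in> U" for "is" i x
  proof -
    have il': "i # is \<in> lists {..<n}" using il i by simp
    obtain d where d: "d > 0" "open_box n x d \<subseteq> U" using open_box_subset_open[OF U x] .
    \<comment> \<open>An interval around \<open>x i\<close> on which the slice stays in
      \<open>U\<close>; its convexity is required for the exchange of limit and derivative.\<close>
    define S where "S = ball (x i) d"
    have xE: "x \<in> topspace (Euclidean_space n)" using x openin_subset[OF U] by blast
    have inU: "x(i := t) \<in> U" if "t \<in> S" for t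
      using that d xE i unfolding S_def
      by (auto simp: open_box_def topspace_Euclidean_space dist_real_def abs_minus_commute subset_iff)
    have "\<exists>g. \<forall>t\<in>S. (\<lambda>k. partials is (F k) (x(i := t))) \<longlonglongrightarrow> g t \<and>
        (g has_derivative (\<lambda>h. h * L (i # is) (x(i := t)))) (at t within S)"
    proof (rule has_derivative_sequence[where f' = "\<lambda>k t h. h * partials (i # is) (F k) (x(i := t))"])
      show "convex S" by (simp add: S_def)
      show "((\<lambda>t. partials is (F k) (x(i := t))) has_derivative
          (\<lambda>h. h * partials (i # is) (F k) (x(i := t)))) (at t within S)" if "t \<in> S" for k t
        using C1_on_has_partial'[OF C[OF il] inU[OF that] i]
        by (auto simp: has_field_derivative_def mult.commute[of _ "partial i _ _"] intro: has_derivative_at_withinI)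
      show "\<forall>\<^sub>F k in sequentially. \<forall>t\<in>S. \<forall>h.
          norm (h * partials (i # is) (F k) (x(i := t)) - h * L (i # is) (x(i := t))) \<le> e * norm h"
        if "e > 0" for e
        using uniform_limitD[OF L[OF il'] that]
      proof eventually_elim
        case (elim k)
        show ?case
        proof (intro ballI allI)
          fix t h assume "t \<in> S"
          then have "dist (partials (i # is) (F k) (x(i := t))) (L (i # is) (x(i := t))) < e"
            using elim inU by blast
          then have "\<bar>h\<bar> * \<bar>partials (i # is) (F k) (x(i := t)) - L (i # is) (x(i := t))\<bar> \<le> \<bar>h\<bar> * e"
            by (intro mult_left_mono) (auto simp: dist_real_def)
          then show "norm (h * partials (i # is) (F k) (x(i := t)) - h * L (i # is) (x(i := t))) \<le> e * norm h"
            by (simp add: abs_mult mult.commute flip: right_diff_distrib)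
        qed
      qed
      show "x i \<in> S" using d by (simp add: S_def)
      show "(\<lambda>k. partials is (F k) (x(i := x i))) \<longlonglongrightarrow> L is x"
        using lim[OF il x] by simp
    qed
    then obtain g where g: "\<And>t. t \<in> S \<Longrightarrow> (\<lambda>k. partials is (F k) (x(i := t))) \<longlonglongrightarrow> g t"
      "\<And>t. t \<in> S \<Longrightarrow> (g has_derivative (\<lambda>h. h * L (i # is) (x(i := t)))) (at t within S)" by blast
    have S: "open S" "x i \<in> S" using d by (auto simp: S_def)
    \<comment> \<open>The exchange theorem provides some limit function on the slice; uniqueness of
      limits identifies it with \<open>L is\<close>.\<close>
    have gL: "g t = L is (x(i := t))" if "t \<in> S" for t
      using LIMSEQ_unique[OF g(1)[OF that] lim[OF il inU[OF that]]] .
    have "(g has_derivative (\<lambda>h. h * L (i # is) x)) (at (x i))"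
      using g(2)[OF S(2)] at_within_open[OF S(2,1)] by simp
    then have "((\<lambda>t. L is (x(i := t))) has_derivative (\<lambda>h. h * L (i # is) x)) (at (x i))"
      by (rule has_derivative_transform_within_open[OF _ S]) (rule gL)
    then show ?thesis by (simp add: has_field_derivative_def mult.commute[of _ "L (i # is) x"])
  qed
  show ?thesis
  proof (rule smooth_conv_coinduct[OF U, where S = "\<lambda>G g. \<exists>is\<in>lists {..<n}. G = (\<lambda>k. partials is (F k)) \<and> g = L is"])
    show "\<exists>is\<in>lists {..<n}. F = (\<lambda>k. partials is (F k)) \<and> L [] = L is"
      by (rule bexI[of _ "[]"]) auto
  next
    fix G g assume "\<exists>is\<in>lists {..<n}. G = (\<lambda>k. partials is (F k)) \<and> g = L is"
    then obtain "is" where il: "is \<in> lists {..<n}" and eq: "G = (\<lambda>k. partials is (F k))" "g = L is" by blast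
    show "(\<forall>k. C1_on n U (G k)) \<and> C1_on n U g \<and> (\<forall>x\<in>U. (\<lambda>k. G k x) \<longlonglongrightarrow> g x)"
      unfolding eq by (intro conjI allI ballI C[OF il] C1_onI(1)[OF cont[OF il] der[OF il]] lim[OF il])
    fix i assume i: "i < n"
    have "i # is \<in> lists {..<n}" using i il by simp
    moreover have "\<forall>x\<in>U. partial i (L is) x = L (i # is) x"
      by (intro ballI C1_onI(2)[OF cont[OF il] der[OF il] i])
    moreover have "\<forall>k. \<forall>x\<in>U. partial i (partials is (F k)) x = partials (i # is) (F k) x" by simp
    ultimately show "\<exists>H h. (\<exists>is\<in>lists {..<n}. H = (\<lambda>k. partials is (F k)) \<and> h = L is) \<and>
      (\<forall>x\<in>U. partial i g x = h x) \<and> (\<forall>k. \<forall>x\<in>U. partial i (G k) x = H k x)"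
      unfolding eq by (intro exI[of _ "\<lambda>k. partials (i # is) (F k)"] exI[of _ "L (i # is)"] conjI bexI[of _ "i # is"] refl)
  qed
qed

lemma smooth_conv_if_uniformly_Cauchy:
  assumes U: "openin (Euclidean_space n) U" and F: "\<And>k. smooth_on n U (F k)"
    and "\<And>is. is \<in> lists {..<n} \<Longrightarrow> uniformly_Cauchy_on U (\<lambda>k. partials is (F k))"
  shows "\<exists>f. smooth_conv n U F f"
proof -
  have "\<exists>l. uniform_limit U (\<lambda>k. partials is (F k)) l sequentially" if "is \<in> lists {..<n}" for "is"
    using assms(3)[OF that] unfolding uniformly_convergent_eq_Cauchy[symmetric] uniformly_convergent_on_def .
  then obtain L where "\<And>is. is \<in> lists {..<n} \<Longrightarrow> uniform_limit U (\<lambda>k. partials is (F k)) (L is) sequentially"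
    by metis
  from smooth_conv_of_uniform_limits[OF U F this] show ?thesis by blast
qed

section \<open>Smooth maps of manifolds\<close>

lemma is_chart_subset: "is_chart n T V \<phi> \<Longrightarrow> V \<subseteq> topspace T"
  by (simp add: is_chart_def openin_subset)

lemma is_chart_inj_on: "is_chart n T V \<phi> \<Longrightarrow> inj_on \<phi> V"
  using is_chart_subset[of n T V \<phi>] by (auto simp: is_chart_def homeomorphic_map_def Int_absorb1)

lemma is_chart_open_image:
  assumes "is_chart n T V \<phi>" "openin T S" "S \<subseteq> V"
  shows "openin (Euclidean_space n) (\<phi> ` S)"
proof -
  have "openin (subtopology T V) S"
    using assms by (auto simp: is_chart_def openin_open_subtopology)
  then have "openin (subtopology (Euclidean_space n) (\<phi> ` V)) (\<phi> ` S)"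
    using assms(1) homeomorphic_map_openness_eq by (metis is_chart_def)
  then show ?thesis
    using assms(1) by (auto simp: is_chart_def openin_open_subtopology)
qed

lemma is_chart_open_preimage:
  assumes "is_chart n T V \<phi>" "openin (Euclidean_space n) S"
  shows "openin T {x \<in> V. \<phi> x \<in> S}"
proof -
  have "continuous_map (subtopology T V) (Euclidean_space n) \<phi>"
    using assms(1) by (auto simp: is_chart_def dest!: homeomorphic_imp_continuous_map intro: continuous_map_into_fulltopology)
  from openin_continuous_map_preimage[OF this assms(2)]
  show ?thesis
    using assms(1) is_chart_subset[OF assms(1)]
    by (auto simp: is_chart_def openin_open_subtopology Int_absorb1)
qed

text \<open>The preimage of \<open>S\<close> under the inverse is \<phi>(V \<inter> S), so
  continuity comes from the openness of charts.\<close>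

lemma is_chart_continuous_inverse:
  assumes "is_chart n T V \<phi>"
  shows "continuous_map (subtopology (Euclidean_space n) (\<phi> ` V)) T (inv_into V \<phi>)"
  unfolding continuous_map_def
proof (intro conjI allI impI)
  have E: "\<phi> ` V \<subseteq> topspace (Euclidean_space n)" and O: "openin (Euclidean_space n) (\<phi> ` V)" and V: "openin T V"
    using assms openin_subset by (auto simp: is_chart_def)
  show "inv_into V \<phi> \<in> topspace (subtopology (Euclidean_space n) (\<phi> ` V)) \<rightarrow> topspace T"
    using is_chart_subset[OF assms] by (auto intro!: subsetD[OF is_chart_subset[OF assms]] inv_into_into)
  fix S assume "openin T S"
  then have "openin (Euclidean_space n) (\<phi> ` (V \<inter> S))"
    using V by (intro is_chart_open_image[OF assms]) auto
  moreover have "{x \<in> topspace (subtopology (Euclidean_space n) (\<phi> ` V)). inv_into V \<phi> x \<in> S} = \<phi> ` (V \<inter> S)"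
    using E is_chart_inj_on[OF assms] by (auto simp: inv_into_f_f)
  ultimately show "openin (subtopology (Euclidean_space n) (\<phi> ` V))
      {x \<in> topspace (subtopology (Euclidean_space n) (\<phi> ` V)). inv_into V \<phi> x \<in> S}"
    using O by (auto simp: openin_open_subtopology)
qed

lemma is_chart_open_sub:
  assumes "is_chart n T V \<phi>" "openin T P"
  shows "is_chart n (subtopology T P) (V \<inter> P) \<phi>"
  unfolding is_chart_def
proof (intro conjI)
  have V: "openin T V" using assms by (simp add: is_chart_def)
  then show "openin (subtopology T P) (V \<inter> P)" by (simp add: openin_subtopology_Int)
  show "openin (Euclidean_space n) (\<phi> ` (V \<inter> P))"
    using V assms by (intro is_chart_open_image[OF assms(1)]) auto
  have "homeomorphic_map (subtopology (subtopology T V) (V \<inter> P))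
      (subtopology (subtopology (Euclidean_space n) (\<phi> ` V)) (\<phi> ` (V \<inter> P))) \<phi>"
  proof (rule homeomorphic_map_subtopologies)
    show "homeomorphic_map (subtopology T V) (subtopology (Euclidean_space n) (\<phi> ` V)) \<phi>"
      using assms(1) by (simp add: is_chart_def)
    show "\<phi> ` (topspace (subtopology T V) \<inter> (V \<inter> P)) =
        topspace (subtopology (Euclidean_space n) (\<phi> ` V)) \<inter> \<phi> ` (V \<inter> P)"
      using is_chart_subset[OF assms(1)] openin_subset[of "Euclidean_space n" "\<phi> ` V"] assms(1)
      by (auto simp: is_chart_def)
  qed
  moreover have "V \<inter> (V \<inter> P) = V \<inter> P" "P \<inter> (V \<inter> P) = V \<inter> P" "\<phi> ` V \<inter> \<phi> ` (V \<inter> P) = \<phi> ` (V \<inter> P)"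
    by blast+
  ultimately show "homeomorphic_map (subtopology (subtopology T P) (V \<inter> P))
      (subtopology (Euclidean_space n) (\<phi> ` (V \<inter> P))) \<phi>"
    by (simp only: subtopology_subtopology)
qed

section \<open>Smoothness in charts\<close>

lemma manifold_chart: "is_manifold M \<Longrightarrow> (V, \<phi>) \<in> matlas M \<Longrightarrow> is_chart (mdim M) (mtop M) V \<phi>"
  unfolding is_manifold_def by blast

lemma chart_at:
  assumes "is_manifold M" "u \<in> pts M"
  obtains V \<phi> where "(V, \<phi>) \<in> matlas M" "u \<in> V"
  using assms unfolding is_manifold_def by blast

lemma chart_transition:
  assumes "is_manifold M" "(V, \<phi>) \<in> matlas M" "(W, \<psi>) \<in> matlas M"
  shows "smooth_between (mdim M) (\<phi> ` (V \<inter> W)) (mdim M) (\<psi> \<circ> inv_into V \<phi>)"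
proof -
  have "\<forall>(V, \<phi>) \<in> matlas M. \<forall>(W, \<psi>) \<in> matlas M.
        smooth_between (mdim M) (\<phi> ` (V \<inter> W)) (mdim M) (\<psi> \<circ> inv_into V \<phi>)"
    using assms(1) by (simp add: is_manifold_def)
  from bspec[OF bspec[OF this assms(2), simplified] assms(3)] show ?thesis by simp
qed

lemma smooth_maps_iff:
  "h \<in> smooth_maps M N \<longleftrightarrow> h \<in> extensional (pts M) \<and> continuous_map (mtop M) (mtop N) h \<and>
    (\<forall>c \<in> matlas M. \<forall>d \<in> matlas N. smooth_between (mdim M) (snd c ` {u \<in> fst c. h u \<in> fst d}) (mdim N)
      (snd d \<circ> h \<circ> inv_into (fst c) (snd c)))"
  by (simp add: smooth_maps_def case_prod_beta)

lemma smooth_maps_chart: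
  assumes "h \<in> smooth_maps M N" "(V, \<phi>) \<in> matlas M" "(W, \<psi>) \<in> matlas N"
  shows "smooth_between (mdim M) (\<phi> ` {u \<in> V. h u \<in> W}) (mdim N) (\<psi> \<circ> h \<circ> inv_into V \<phi>)"
  using bspec[OF bspec[OF conjunct2[OF conjunct2[OF assms(1)[unfolded smooth_maps_iff]]] assms(2)] assms(3)] by simp

lemma smooth_mapsI:
  assumes "h \<in> extensional (pts M)" "continuous_map (mtop M) (mtop N) h"
    "\<And>V \<phi> W \<psi>. (V, \<phi>) \<in> matlas M \<Longrightarrow> (W, \<psi>) \<in> matlas N \<Longrightarrow>
      smooth_between (mdim M) (\<phi> ` {u \<in> V. h u \<in> W}) (mdim N) (\<psi> \<circ> h \<circ> inv_into V \<phi>)"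
  shows "h \<in> smooth_maps M N"
  unfolding smooth_maps_iff by (intro conjI ballI assms) simp_all

lemma smooth_maps_continuous: "h \<in> smooth_maps M N \<Longrightarrow> continuous_map (mtop M) (mtop N) h"
  by (simp add: smooth_maps_def)

lemma smooth_maps_in_pts: "h \<in> smooth_maps M N \<Longrightarrow> u \<in> pts M \<Longrightarrow> h u \<in> pts N"
  using smooth_maps_continuous continuous_map_image_subset_topspace by blast

lemma smooth_maps_extensional: "h \<in> smooth_maps M N \<Longrightarrow> h \<in> extensional (pts M)"
  by (simp add: smooth_maps_def)

lemma openin_chart_preimage:
  assumes "is_chart m T V \<phi>" "continuous_map T T' h" "openin T' W"
  shows "openin T {u \<in> V. h u \<in> W}"
  using openin_continuous_map_preimage_gen[OF assms(2) _ assms(3)] assms(1) by (simp add: is_chart_def)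

text \<open>Shrinking a chart domain from \<open>V\<close> to \<open>V'\<close> turns
  \<open>inv_into V \<phi>\<close> into a different function, which agrees with the old one only on
  the image of \<open>V'\<close>. This lemma absorbs that change, together with a change of the map
  off \<open>A'\<close>; the smoothness proofs for restricted maps rely on it.\<close>

lemma chart_expression_restrict:
  assumes ch: "is_chart m T V \<phi>" and A: "openin T A" "A \<subseteq> V" "smooth_between m (\<phi> ` A) n (f \<circ> inv_into V \<phi>)"
    and A': "openin T A'" "A' \<subseteq> A" "A' \<subseteq> V'" "V' \<subseteq> V" and fg: "\<And>u. u \<in> A' \<Longrightarrow> g u = f u"
  shows "smooth_between m (\<phi> ` A') n (g \<circ> inv_into V' \<phi>)"
proof (rule smooth_between_cong)
  show O: "openin (Euclidean_space m) (\<phi> ` A')"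
    using A A' by (intro is_chart_open_image[OF ch]) auto
  have "openin (Euclidean_space m) (\<phi> ` A)"
    using A by (intro is_chart_open_image[OF ch]) auto
  from smooth_between_subset[OF this O image_mono[OF A'(2)] A(3)]
  show "smooth_between m (\<phi> ` A') n (f \<circ> inv_into V \<phi>)" .
  fix x assume "x \<in> \<phi> ` A'"
  then obtain u where u: "u \<in> A'" "x = \<phi> u" by blast
  have "inv_into V \<phi> x = u" "inv_into V' \<phi> x = u"
    using u A A' is_chart_inj_on[OF ch] inj_on_subset[OF is_chart_inj_on[OF ch] A'(4)]
    by (auto intro: inv_into_f_f)
  then show "(f \<circ> inv_into V \<phi>) x = (g \<circ> inv_into V' \<phi>) x"
    using fg[OF u(1)] by simp
qed

section \<open>Open submanifolds\<close>

lemma open_sub_simps [simp]: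
  "mdim (open_sub M P) = mdim M" "mtop (open_sub M P) = subtopology (mtop M) P"
  by (simp_all add: open_sub_def)

lemma pts_open_sub: "openin (mtop M) P \<Longrightarrow> pts (open_sub M P) = P"
  using openin_subset by fastforce

lemma matlas_open_sub:
  assumes "(V, \<phi>) \<in> matlas (open_sub M P)"
  obtains V' where "(V', \<phi>) \<in> matlas M" "V = V' \<inter> P"
  using assms by (auto simp: open_sub_def)

lemma matlas_open_subI: "(V, \<phi>) \<in> matlas M \<Longrightarrow> (V \<inter> P, \<phi>) \<in> matlas (open_sub M P)"
  by (auto simp: open_sub_def intro: rev_image_eqI)

lemma open_sub_open_sub: "open_sub (open_sub M A) B = open_sub M (A \<inter> B)"
  by (simp add: open_sub_def subtopology_subtopology image_image case_prod_beta Int_assoc)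

text \<open>Equality of records, not just a diffeomorphism, because \<open>is_restriction\<close>
  asks for the literal manifold. It makes an identity arrow a restriction to the whole
  manifold.\<close>

lemma open_sub_pts:
  assumes "is_manifold M"
  shows "open_sub M (pts M) = M"
proof -
  have "(\<lambda>(W, \<phi>). (W \<inter> pts M, \<phi>)) ` matlas M = id ` matlas M"
    using is_chart_subset[OF manifold_chart[OF assms]]
    by (intro image_cong) (auto simp: Int_absorb2)
  then show ?thesis by (simp add: open_sub_def)
qed

lemma is_manifold_open_sub:
  assumes M: "is_manifold M" and P: "openin (mtop M) P"
  shows "is_manifold (open_sub M P)"
  unfolding is_manifold_def
proof (intro conjI)
  show "Hausdorff_space (mtop (open_sub M P))" "second_countable (mtop (open_sub M P))"
    using M by (auto simp: is_manifold_def Hausdorff_space_subtopology second_countable_subtopology)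
  show "\<forall>(V, \<phi>)\<in>matlas (open_sub M P). is_chart (mdim (open_sub M P)) (mtop (open_sub M P)) V \<phi>"
    using is_chart_open_sub[OF manifold_chart[OF M] P] by (auto elim!: matlas_open_sub)
  show "(\<Union>(V, \<phi>)\<in>matlas (open_sub M P). V) = pts (open_sub M P)"
  proof -
    have "(\<Union>(V, \<phi>)\<in>matlas (open_sub M P). V) = (\<Union>(V, \<phi>)\<in>matlas M. V) \<inter> P"
      by (auto simp: open_sub_def)
    then show ?thesis using M P openin_subset[OF P] by (auto simp: is_manifold_def)
  qed
  have "smooth_between (mdim M) (\<phi> ` ((V \<inter> P) \<inter> (W \<inter> P))) (mdim M) (\<psi> \<circ> inv_into (V \<inter> P) \<phi>)"
    if "(V, \<phi>) \<in> matlas M" "(W, \<psi>) \<in> matlas M" for V \<phi> W \<psi>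
  proof (rule chart_expression_restrict[OF manifold_chart[OF M that(1)] _ _ chart_transition[OF M that]])
    show "openin (mtop M) (V \<inter> W)" "openin (mtop M) ((V \<inter> P) \<inter> (W \<inter> P))"
      using manifold_chart[OF M] that P by (auto simp: is_chart_def)
  qed auto
  then show "\<forall>(V, \<phi>)\<in>matlas (open_sub M P). \<forall>(W, \<psi>)\<in>matlas (open_sub M P).
      smooth_between (mdim (open_sub M P)) (\<phi> ` (V \<inter> W)) (mdim (open_sub M P)) (\<psi> \<circ> inv_into V \<phi>)"
    by (auto elim!: matlas_open_sub)
qed

lemma smooth_maps_restrict:
  assumes h: "h \<in> smooth_maps M N" and M: "is_manifold M" and N: "is_manifold N"
    and P: "openin (mtop M) P"
  shows "restrict h P \<in> smooth_maps (open_sub M P) N"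
proof (rule smooth_mapsI)
  have hc: "continuous_map (mtop M) (mtop N) h" using h by (rule smooth_maps_continuous)
  show "restrict h P \<in> extensional (pts (open_sub M P))" by (simp only: pts_open_sub[OF P]) simp
  have "continuous_map (subtopology (mtop M) P) (mtop N) (restrict h P)"
    by (rule continuous_map_eq[OF continuous_map_from_subtopology[OF hc]]) auto
  then show "continuous_map (mtop (open_sub M P)) (mtop N) (restrict h P)" by simp
  fix V \<phi> W \<psi> assume "(V, \<phi>) \<in> matlas (open_sub M P)" and W: "(W, \<psi>) \<in> matlas N"
  then obtain V' where V': "(V', \<phi>) \<in> matlas M" "V = V' \<inter> P" by (auto elim: matlas_open_sub)
  note ch = manifold_chart[OF M V'(1)]
  have Wo: "openin (mtop N) W" using manifold_chart[OF N W] by (simp add: is_chart_def)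
  have Vo: "openin (mtop M) {u \<in> V'. h u \<in> W}" by (rule openin_chart_preimage[OF ch hc Wo])
  have eq: "{u \<in> V. restrict h P u \<in> W} = {u \<in> V'. h u \<in> W} \<inter> P"
    unfolding V'(2) by auto
  have "smooth_between (mdim M) (\<phi> ` ({u \<in> V'. h u \<in> W} \<inter> P)) (mdim N) ((\<psi> \<circ> restrict h P) \<circ> inv_into V \<phi>)"
    by (rule chart_expression_restrict[OF ch Vo _ smooth_maps_chart[OF h V'(1) W]])
       (use Vo P V'(2) in auto)
  then show "smooth_between (mdim (open_sub M P)) (\<phi> ` {u \<in> V. restrict h P u \<in> W}) (mdim N)
      (\<psi> \<circ> restrict h P \<circ> inv_into V \<phi>)"
    unfolding eq by simp
qed

lemma smooth_maps_into_open_sub: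
  assumes h: "h \<in> smooth_maps M N" and M: "is_manifold M" and P: "h ` pts M \<subseteq> P"
  shows "h \<in> smooth_maps M (open_sub N P)"
proof (rule smooth_mapsI)
  show "h \<in> extensional (pts M)" using h by (rule smooth_maps_extensional)
  show "continuous_map (mtop M) (mtop (open_sub N P)) h"
    using smooth_maps_continuous[OF h] P by (auto simp: continuous_map_in_subtopology)
  fix V \<phi> W \<psi> assume V: "(V, \<phi>) \<in> matlas M" and "(W, \<psi>) \<in> matlas (open_sub N P)"
  then obtain W' where W': "(W', \<psi>) \<in> matlas N" "W = W' \<inter> P" by (auto elim: matlas_open_sub)
  have "{u \<in> V. h u \<in> W} = {u \<in> V. h u \<in> W'}"
    using W'(2) P is_chart_subset[OF manifold_chart[OF M V]] by auto
  then show "smooth_between (mdim M) (\<phi> ` {u \<in> V. h u \<in> W}) (mdim (open_sub N P)) (\<psi> \<circ> h \<circ> inv_into V \<phi>)"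
    using smooth_maps_chart[OF h V W'(1)] by simp
qed

text \<open>The chart expressions of the identity are the transition maps of the atlas.\<close>

lemma inclusion_pts_smooth:
  assumes M: "is_manifold M"
  shows "inclusion (pts M) \<in> smooth_maps M M"
proof (rule smooth_mapsI)
  show "inclusion (pts M) \<in> extensional (pts M)" by (simp add: inclusion_def)
  show "continuous_map (mtop M) (mtop M) (inclusion (pts M))"
    by (rule continuous_map_eq[OF continuous_map_id]) (auto simp: inclusion_def)
  fix V \<phi> W \<psi> assume VW: "(V, \<phi>) \<in> matlas M" "(W, \<psi>) \<in> matlas M"
  note ch = manifold_chart[OF M VW(1)] manifold_chart[OF M VW(2)]
  have VM: "V \<subseteq> pts M" using is_chart_subset[OF ch(1)] .
  have eq: "{u \<in> V. inclusion (pts M) u \<in> W} = V \<inter> W"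
    using VM by (auto simp: inclusion_def)
  have o: "openin (mtop M) (V \<inter> W)" using ch by (auto simp: is_chart_def)
  show "smooth_between (mdim M) (\<phi> ` {u \<in> V. inclusion (pts M) u \<in> W}) (mdim M) (\<psi> \<circ> inclusion (pts M) \<circ> inv_into V \<phi>)"
    unfolding eq
    by (rule chart_expression_restrict[OF ch(1) o _ chart_transition[OF M VW] o])
       (use VM in \<open>auto simp: inclusion_def\<close>)
qed

lemma inclusion_smooth:
  assumes M: "is_manifold M" and P: "openin (mtop M) P"
  shows "inclusion P \<in> smooth_maps (open_sub M P) M"
proof -
  have "restrict (inclusion (pts M)) P = inclusion P"
    using openin_subset[OF P] by (auto simp: inclusion_def fun_eq_iff)
  then show ?thesis using smooth_maps_restrict[OF inclusion_pts_smooth[OF M] M M P] by simp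
qed

section \<open>Open subsets of Euclidean space as manifolds, and local diffeomorphisms\<close>

lemma second_countable_Euclidean_space: "second_countable (Euclidean_space n)"
proof -
  obtain B :: "pt set set" where "countable B" "topological_basis B"
    using ex_countable_basis by blast
  then have "second_countable (euclidean :: pt topology)"
    unfolding second_countable_def open_openin[symmetric]
    using topological_basis_open[OF \<open>topological_basis B\<close>] topological_basisE[OF \<open>topological_basis B\<close>]
    by (intro exI[of _ B]) metis
  then show ?thesis
    by (subst Euclidean_space_eq_top_of_set) (rule second_countable_subtopology)
qed

lemma euclidean_open_simps [simp]:
  "mdim (euclidean_open n U) = n" "mtop (euclidean_open n U) = subtopology (Euclidean_space n) U"
  "matlas (euclidean_open n U) = {(U, \<lambda>x. x)}"
  by (simp_all add: euclidean_open_def)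

lemma pts_euclidean_open: "openin (Euclidean_space n) U \<Longrightarrow> pts (euclidean_open n U) = U"
  using openin_subset by fastforce

lemma inv_into_ident: "x \<in> U \<Longrightarrow> inv_into U (\<lambda>x. x) x = x"
  by (rule inv_into_f_f) (auto simp: inj_on_def)

lemma is_manifold_euclidean_open:
  assumes U: "openin (Euclidean_space n) U"
  shows "is_manifold (euclidean_open n U)"
proof -
  have "Hausdorff_space (subtopology (Euclidean_space n) U)"
    using Hausdorff_Euclidean_space Hausdorff_space_subtopology by blast
  moreover have "second_countable (subtopology (Euclidean_space n) U)"
    by (rule second_countable_subtopology[OF second_countable_Euclidean_space])
  moreover have "is_chart n (subtopology (Euclidean_space n) U) U (\<lambda>x. x)"
  proof -
    have "homeomorphic_map (subtopology (Euclidean_space n) U) (subtopology (Euclidean_space n) U) id" by simp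
    then show ?thesis using U by (simp add: is_chart_def subtopology_subtopology openin_open_subtopology id_def)
  qed
  moreover have "smooth_between n U n ((\<lambda>x. x) \<circ> inv_into U (\<lambda>x. x))"
    by (rule smooth_between_cong[OF U _ smooth_between_id[OF U]]) (simp add: inv_into_ident)
  ultimately show ?thesis
    using openin_subset[OF U] by (auto simp: is_manifold_def)
qed

text \<open>Read in a chart on \<open>W\<close>, the inverse of the chart on \<open>V\<close> is the
  transition map from \<open>V\<close> to \<open>W\<close>.\<close>

lemma chart_inverse_smooth:
  assumes M: "is_manifold M" and V: "(V, \<phi>) \<in> matlas M"
  shows "restrict (inv_into V \<phi>) (\<phi> ` V) \<in> smooth_maps (euclidean_open (mdim M) (\<phi> ` V)) M"
proof (rule smooth_mapsI)
  note ch = manifold_chart[OF M V]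
  have O: "openin (Euclidean_space (mdim M)) (\<phi> ` V)" using ch by (simp add: is_chart_def)
  show "restrict (inv_into V \<phi>) (\<phi> ` V) \<in> extensional (pts (euclidean_open (mdim M) (\<phi> ` V)))"
    by (simp only: pts_euclidean_open[OF O]) simp
  have "continuous_map (subtopology (Euclidean_space (mdim M)) (\<phi> ` V)) (mtop M) (restrict (inv_into V \<phi>) (\<phi> ` V))"
    by (rule continuous_map_eq[OF is_chart_continuous_inverse[OF ch]]) auto
  then show "continuous_map (mtop (euclidean_open (mdim M) (\<phi> ` V))) (mtop M) (restrict (inv_into V \<phi>) (\<phi> ` V))"
    by simp
  fix V' \<phi>' W \<psi> assume "(V', \<phi>') \<in> matlas (euclidean_open (mdim M) (\<phi> ` V))" and W: "(W, \<psi>) \<in> matlas M"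
  then have eq: "V' = \<phi> ` V" "\<phi>' = (\<lambda>x. x)" by simp_all
  have inj: "inv_into V \<phi> (\<phi> u) = u" if "u \<in> V" for u
    using that is_chart_inj_on[OF ch] by simp
  have img: "\<phi>' ` {u \<in> V'. restrict (inv_into V \<phi>) (\<phi> ` V) u \<in> W} = \<phi> ` (V \<inter> W)"
    unfolding eq by (auto simp: inj image_iff) (metis inj)+
  have "openin (Euclidean_space (mdim M)) (\<phi> ` (V \<inter> W))"
    using ch manifold_chart[OF M W] by (intro is_chart_open_image[OF ch]) (auto simp: is_chart_def)
  then have "smooth_between (mdim M) (\<phi> ` (V \<inter> W)) (mdim M)
      (\<psi> \<circ> restrict (inv_into V \<phi>) (\<phi> ` V) \<circ> inv_into V' \<phi>')"
  proof (rule smooth_between_cong[OF _ _ chart_transition[OF M V W]])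
    fix x assume "x \<in> \<phi> ` (V \<inter> W)"
    then have "x \<in> \<phi> ` V" by blast
    then show "(\<psi> \<circ> inv_into V \<phi>) x = (\<psi> \<circ> restrict (inv_into V \<phi>) (\<phi> ` V) \<circ> inv_into V' \<phi>') x"
      unfolding eq by (simp only: o_def inv_into_ident restrict_apply' refl)
  qed
  then show "smooth_between (mdim (euclidean_open (mdim M) (\<phi> ` V))) (\<phi>' ` {u \<in> V'. restrict (inv_into V \<phi>) (\<phi> ` V) u \<in> W})
      (mdim M) (\<psi> \<circ> restrict (inv_into V \<phi>) (\<phi> ` V) \<circ> inv_into V' \<phi>')"
    unfolding img euclidean_open_simps .
qed

text \<open>The target has the identity as its only chart, so the expressions to be checked are
  those of \<open>a\<close> relative to the chart on \<open>V\<close>.\<close>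

lemma chart_compose_smooth:
  assumes N: "is_manifold N" and M: "is_manifold M" and V: "(V, \<phi>) \<in> matlas M" and a: "a \<in> smooth_maps N M"
    and P: "P = {u \<in> pts N. a u \<in> V}"
  shows "openin (mtop N) P"
    and "(\<lambda>u\<in>P. \<phi> (a u)) \<in> smooth_maps (open_sub N P) (euclidean_open (mdim M) (\<phi> ` V))"
proof -
  note ch = manifold_chart[OF M V]
  have ac: "continuous_map (mtop N) (mtop M) a" using a by (rule smooth_maps_continuous)
  have Vo: "openin (mtop M) V" using ch by (simp add: is_chart_def)
  show Po: "openin (mtop N) P"
    unfolding P by (rule openin_continuous_map_preimage[OF ac Vo])
  show "(\<lambda>u\<in>P. \<phi> (a u)) \<in> smooth_maps (open_sub N P) (euclidean_open (mdim M) (\<phi> ` V))"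
  proof (rule smooth_mapsI)
    show "(\<lambda>u\<in>P. \<phi> (a u)) \<in> extensional (pts (open_sub N P))" by (simp only: pts_open_sub[OF Po]) simp
    have "continuous_map (subtopology (mtop N) P) (subtopology (mtop M) V) a"
      using continuous_map_from_subtopology[OF ac] P by (auto simp: continuous_map_in_subtopology)
    moreover have "continuous_map (subtopology (mtop M) V) (subtopology (Euclidean_space (mdim M)) (\<phi> ` V)) \<phi>"
      using ch by (simp add: is_chart_def homeomorphic_imp_continuous_map)
    ultimately have "continuous_map (subtopology (mtop N) P) (subtopology (Euclidean_space (mdim M)) (\<phi> ` V)) (\<phi> \<circ> a)"
      by (rule continuous_map_compose)
    then have "continuous_map (subtopology (mtop N) P) (subtopology (Euclidean_space (mdim M)) (\<phi> ` V)) (\<lambda>u\<in>P. \<phi> (a u))"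
      by (rule continuous_map_eq) auto
    then show "continuous_map (mtop (open_sub N P)) (mtop (euclidean_open (mdim M) (\<phi> ` V))) (\<lambda>u\<in>P. \<phi> (a u))"
      by simp
    fix V' \<phi>' W \<psi> assume "(V', \<phi>') \<in> matlas (open_sub N P)" "(W, \<psi>) \<in> matlas (euclidean_open (mdim M) (\<phi> ` V))"
    then obtain V1 where V1: "(V1, \<phi>') \<in> matlas N" "V' = V1 \<inter> P" and W: "W = \<phi> ` V" "\<psi> = (\<lambda>x. x)"
      by (auto elim: matlas_open_sub)
    note ch1 = manifold_chart[OF N V1(1)]
    have o: "openin (mtop N) {u \<in> V1. a u \<in> V}" by (rule openin_chart_preimage[OF ch1 ac Vo])
    have eq: "{u \<in> V'. (\<lambda>u\<in>P. \<phi> (a u)) u \<in> W} = {u \<in> V1. a u \<in> V}"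
      using is_chart_subset[OF ch1] unfolding V1(2) W P by auto
    show "smooth_between (mdim (open_sub N P)) (\<phi>' ` {u \<in> V'. (\<lambda>u\<in>P. \<phi> (a u)) u \<in> W})
      (mdim (euclidean_open (mdim M) (\<phi> ` V))) (\<psi> \<circ> (\<lambda>u\<in>P. \<phi> (a u)) \<circ> inv_into V' \<phi>')"
      unfolding eq euclidean_open_simps open_sub_simps
      by (rule chart_expression_restrict[OF ch1 o _ smooth_maps_chart[OF a V1(1) V] o])
         (use is_chart_subset[OF ch1] in \<open>auto simp: V1(2) P W\<close>)
  qed
qed

text \<open>A neighbourhood \<open>V0\<close> on which \<open>b\<close> is invertible is cut down to
  \<open>V0 \<inter> P\<close>, and the inverse is restricted accordingly.\<close>

lemma local_diffeo_restrict:
  assumes b: "local_diffeo N Y b" and N: "is_manifold N" and Y: "is_manifold Y" and P: "openin (mtop N) P"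
  shows "local_diffeo (open_sub N P) Y (restrict b P)"
  unfolding local_diffeo_def
proof (intro conjI ballI)
  have bs: "b \<in> smooth_maps N Y" using b by (simp add: local_diffeo_def)
  show "restrict b P \<in> smooth_maps (open_sub N P) Y"
    by (rule smooth_maps_restrict[OF bs N Y P])
  fix u assume "u \<in> pts (open_sub N P)"
  then have u: "u \<in> P" "u \<in> pts N" by auto
  then obtain V0 where V0: "openin (mtop N) V0" "u \<in> V0" "openin (mtop Y) (b ` V0)" "inj_on b V0"
    "restrict (inv_into V0 b) (b ` V0) \<in> smooth_maps (open_sub Y (b ` V0)) (open_sub N V0)"
    using b unfolding local_diffeo_def by blast
  define \<beta> where "\<beta> = restrict (inv_into V0 b) (b ` V0)"
  have \<beta>b: "\<beta> (b v) = v" if "v \<in> V0" for v using that V0(4) by (simp add: \<beta>_def)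
  define V' where "V' = V0 \<inter> P"
  have V'o: "openin (mtop N) V'" using V0(1) P by (auto simp: V'_def)
  have im: "restrict b P ` V' = b ` V'" by (auto simp: V'_def)
  have "openin (subtopology (mtop N) V0) V'"
    using V'o V0(1) by (auto simp: openin_open_subtopology V'_def)
  moreover have "continuous_map (subtopology (mtop Y) (b ` V0)) (subtopology (mtop N) V0) \<beta>"
    using smooth_maps_continuous[OF V0(5)] by (simp add: \<beta>_def)
  ultimately have "openin (subtopology (mtop Y) (b ` V0)) {y \<in> topspace (subtopology (mtop Y) (b ` V0)). \<beta> y \<in> V'}"
    by (intro openin_continuous_map_preimage)
  moreover have "{y \<in> topspace (subtopology (mtop Y) (b ` V0)). \<beta> y \<in> V'} = b ` V'"
    using openin_subset[OF V0(3)] by (auto simp: \<beta>b V'_def)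
  ultimately have bo: "openin (mtop Y) (b ` V')"
    using V0(3) by (simp add: openin_open_subtopology)
  have "restrict \<beta> (b ` V') \<in> smooth_maps (open_sub (open_sub Y (b ` V0)) (b ` V')) (open_sub N V0)"
    by (rule smooth_maps_restrict[OF V0(5)[folded \<beta>_def] is_manifold_open_sub[OF Y V0(3)] is_manifold_open_sub[OF N V0(1)]])
       (use bo V0(3) in \<open>auto simp: openin_open_subtopology V'_def\<close>)
  moreover have "open_sub (open_sub Y (b ` V0)) (b ` V') = open_sub Y (b ` V')"
    by (auto simp: open_sub_open_sub V'_def intro!: arg_cong[of _ _ "open_sub Y"])
  ultimately have "restrict \<beta> (b ` V') \<in> smooth_maps (open_sub Y (b ` V')) (open_sub N V0)" by simp
  then have "restrict \<beta> (b ` V') \<in> smooth_maps (open_sub Y (b ` V')) (open_sub (open_sub N V0) V')"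
    by (rule smooth_maps_into_open_sub[OF _ is_manifold_open_sub[OF Y bo]])
       (simp only: pts_open_sub[OF bo], auto simp: \<beta>b V'_def)
  moreover have "open_sub (open_sub N V0) V' = open_sub (open_sub N P) V'"
    by (auto simp: open_sub_open_sub V'_def intro!: arg_cong[of _ _ "open_sub N"])
  moreover have "restrict (inv_into V' (restrict b P)) (b ` V') = restrict \<beta> (b ` V')"
  proof (rule restrict_ext)
    fix y assume "y \<in> b ` V'"
    then obtain v where v: "v \<in> V'" "y = restrict b P v" by (auto simp: V'_def)
    have "inj_on (restrict b P) V'" using V0(4) by (auto simp: inj_on_def V'_def)
    then have "inv_into V' (restrict b P) y = v" unfolding v(2) by (rule inv_into_f_f[OF _ v(1)])
    then show "inv_into V' (restrict b P) y = \<beta> y" using v \<beta>b by (simp add: V'_def)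
  qed
  ultimately have "restrict (inv_into V' (restrict b P)) (restrict b P ` V')
      \<in> smooth_maps (open_sub Y (restrict b P ` V')) (open_sub (open_sub N P) V')"
    unfolding im by simp
  moreover have "inj_on (restrict b P) V'" using V0(4) by (auto simp: inj_on_def V'_def)
  moreover have "openin (mtop (open_sub N P)) V'" "u \<in> V'"
    using V'o P u V0(2) by (auto simp: openin_open_subtopology V'_def)
  ultimately show "\<exists>V. openin (mtop (open_sub N P)) V \<and> u \<in> V \<and> openin (mtop Y) (restrict b P ` V) \<and>
      inj_on (restrict b P) V \<and> restrict (inv_into V (restrict b P)) (restrict b P ` V)
        \<in> smooth_maps (open_sub Y (restrict b P ` V)) (open_sub (open_sub N P) V)"
    using bo im by (intro exI[of _ V']) simp
qed

section \<open>Charts of a stack\<close>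

lemma fibred_category: "fibred_in_groupoids X \<Longrightarrow> category X"
  by (simp add: fibred_in_groupoids_def)

lemma fibred_manifold: "fibred_in_groupoids X \<Longrightarrow> x \<in> Ob X \<Longrightarrow> is_manifold (pob X x)"
  by (simp add: fibred_in_groupoids_def over_manifolds_def)

lemma arr_comp:
  assumes "fibred_in_groupoids X" "arr X a x y" "arr X b y z"
  shows "arr X (comp X b a) x z"
proof -
  have "\<forall>a b x y z. arr X a x y \<and> arr X b y z \<longrightarrow> arr X (comp X b a) x z"
    using fibred_category[OF assms(1)] unfolding category_def by (elim conjE)
  from this[rule_format, of a x y b z] assms(2,3) show ?thesis by simp
qed

lemma comp_assoc:
  assumes "fibred_in_groupoids X" "arr X a w x" "arr X b x y" "arr X c y z"
  shows "comp X c (comp X b a) = comp X (comp X c b) a"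
proof -
  have "\<forall>a b c w x y z. arr X a w x \<and> arr X b x y \<and> arr X c y z \<longrightarrow>
        comp X c (comp X b a) = comp X (comp X c b) a"
    using fibred_category[OF assms(1)] unfolding category_def by (elim conjE)
  from this[rule_format, of a w x b y c z] assms(2-) show ?thesis by simp
qed

lemma par_smooth:
  assumes "fibred_in_groupoids X" "arr X a x y"
  shows "par X a \<in> smooth_maps (pob X x) (pob X y)"
proof -
  have "\<forall>a x y. arr X a x y \<longrightarrow> par X a \<in> smooth_maps (pob X x) (pob X y)"
    using assms(1) unfolding fibred_in_groupoids_def over_manifolds_def by (elim conjE)
  with assms(2) show ?thesis by simp
qed

lemma par_comp:
  assumes "fibred_in_groupoids X" "arr X a x y" "arr X b y z"
  shows "par X (comp X b a) = compose (pts (pob X x)) (par X b) (par X a)"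
proof -
  have "\<forall>a b x y z. arr X a x y \<and> arr X b y z \<longrightarrow>
        par X (comp X b a) = compose (pts (pob X x)) (par X b) (par X a)"
    using assms(1) unfolding fibred_in_groupoids_def over_manifolds_def by (elim conjE)
  from this[rule_format, of a x y b z] assms(2,3) show ?thesis by simp
qed

lemma arr_Ob: "arr X a x y \<Longrightarrow> x \<in> Ob X" "arr X a x y \<Longrightarrow> y \<in> Ob X"
  by (simp_all add: arr_def)

lemma pullback_exists:
  assumes "fibred_in_groupoids X" "x \<in> Ob X" "is_manifold V" "h \<in> smooth_maps V (pob X x)"
  obtains y a where "arr X a y x" "pob X y = V" "par X a = h"
proof -
  have "\<forall>x \<in> Ob X. \<forall>V h. is_manifold V \<and> h \<in> smooth_maps V (pob X x) \<longrightarrow>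
        (\<exists>y a. arr X a y x \<and> pob X y = V \<and> par X a = h)"
    using assms(1) unfolding fibred_in_groupoids_def by (elim conjE)
  from this[rule_format, of x V h] assms(2-) that show thesis by blast
qed

lemma cartesian_lift:
  assumes "fibred_in_groupoids X" "arr X a y x" "arr X b z x" "h \<in> smooth_maps (pob X z) (pob X y)"
    "par X b = compose (pts (pob X z)) (par X a) h"
  shows "\<exists>!c. arr X c z y \<and> par X c = h \<and> comp X a c = b"
proof -
  have "\<forall>a b x y z h. arr X a y x \<and> arr X b z x \<and> h \<in> smooth_maps (pob X z) (pob X y) \<and>
        par X b = compose (pts (pob X z)) (par X a) h \<longrightarrow>
        (\<exists>!c. arr X c z y \<and> par X c = h \<and> comp X a c = b)"
    using assms(1) unfolding fibred_in_groupoids_def by (elim conjE)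
  from this[rule_format, of a y x b z h] assms(2-) show ?thesis by simp
qed

text \<open>Both arrows are lifts of the same map through \<open>e\<close> with the same composite,
  and such a lift is unique. So \<open>e\<close> may be cancelled among arrows over the same
  map.\<close>

lemma cartesian_unique:
  assumes fib: "fibred_in_groupoids X" and e: "arr X e c x" and p: "arr X p z c" "arr X p' z c"
    and "par X p = par X p'" "comp X e p = comp X e p'"
  shows "p = p'"
proof -
  have "\<exists>!k. arr X k z c \<and> par X k = par X p \<and> comp X e k = comp X e p"
    by (rule cartesian_lift[OF fib e arr_comp[OF fib p(1) e] par_smooth[OF fib p(1)] par_comp[OF fib p(1) e]])
  with assms show ?thesis by auto
qed

lemma par_comp_apply:
  "fibred_in_groupoids X \<Longrightarrow> arr X a x y \<Longrightarrow> arr X b y z \<Longrightarrow> u \<in> pts (pob X x) \<Longrightarrow>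
    par X (comp X b a) u = par X b (par X a u)"
  by (simp add: par_comp compose_def)

lemma par_in_pts: "fibred_in_groupoids X \<Longrightarrow> arr X a x y \<Longrightarrow> u \<in> pts (pob X x) \<Longrightarrow> par X a u \<in> pts (pob X y)"
  by (rule smooth_maps_in_pts[OF par_smooth])

lemma etale_surjection_imp_etale: "etale_surjection X x \<Longrightarrow> etale X x"
  unfolding etale_surjection_def etale_def representable_with_def by blast

text \<open>The object \<open>c\<close> represents the composite of the inverse chart with the
  morphism \<open>x\<close>, and \<open>e\<close> is its cartesian arrow to \<open>x\<close>. The
  strong topology admits only sources that are literally \<open>euclidean_open n U\<close>, so
  charts of the manifold have to be turned into such objects.\<close>

definition chart_object :: "('o, 'a) cat_over \<Rightarrow> 'o \<Rightarrow> pt set \<Rightarrow> (pt \<Rightarrow> pt) \<Rightarrow> 'o \<Rightarrow> 'a \<Rightarrow> bool" where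
  "chart_object X x V \<phi> c e \<longleftrightarrow> (V, \<phi>) \<in> matlas (pob X x) \<and> arr X e c x \<and>
     pob X c = euclidean_open (mdim (pob X x)) (\<phi> ` V) \<and> par X e = restrict (inv_into V \<phi>) (\<phi> ` V)"

lemma chart_object_exists:
  assumes fib: "fibred_in_groupoids X" and x: "x \<in> Ob X" and V: "(V, \<phi>) \<in> matlas (pob X x)"
  shows "\<exists>c e. chart_object X x V \<phi> c e"
proof -
  note M = fibred_manifold[OF fib x]
  have "openin (Euclidean_space (mdim (pob X x))) (\<phi> ` V)"
    using manifold_chart[OF M V] by (simp add: is_chart_def)
  then obtain c e where "arr X e c x" "pob X c = euclidean_open (mdim (pob X x)) (\<phi> ` V)"
    "par X e = restrict (inv_into V \<phi>) (\<phi> ` V)"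
    using pullback_exists[OF fib x is_manifold_euclidean_open chart_inverse_smooth[OF M V]] by metis
  then show ?thesis using V unfolding chart_object_def by blast
qed

text \<open>The base change of a chart object along y is the part of the base change of x that lies over
  the domain of the chart.\<close>

lemma etale_chart_object:
  assumes fib: "fibred_in_groupoids X" and x: "etale X x" and co: "chart_object X x V \<phi> c e"
  shows "etale X c"
  unfolding etale_def representable_with_def
proof (intro conjI ballI)
  have V: "(V, \<phi>) \<in> matlas (pob X x)" and e: "arr X e c x"
    and pc: "pob X c = euclidean_open (mdim (pob X x)) (\<phi> ` V)"
    and pe: "par X e = restrict (inv_into V \<phi>) (\<phi> ` V)"
    using co by (simp_all add: chart_object_def)
  show "c \<in> Ob X" using arr_Ob(1)[OF e] .
  have xO: "x \<in> Ob X" using arr_Ob(2)[OF e] .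
  note M = fibred_manifold[OF fib xO]
  note ch = manifold_chart[OF M V]
  have ptc: "pts (pob X c) = \<phi> ` V"
    unfolding pc by (rule pts_euclidean_open) (use ch in \<open>simp add: is_chart_def\<close>)
  have inv: "inv_into V \<phi> (\<phi> v) = v" if "v \<in> V" for v
    using that is_chart_inj_on[OF ch] by simp
  fix y assume y: "y \<in> Ob X"
  obtain w a b where fp: "is_fibre_product X x y w a b" and ld: "local_diffeo (pob X w) (pob X y) (par X b)"
    using x y unfolding etale_def representable_with_def by blast
  have a: "arr X a w x" and b: "arr X b w y" using fp by (simp_all add: is_fibre_product_def)
  note N = fibred_manifold[OF fib arr_Ob(1)[OF a]]
  \<comment> \<open>The part of the fibre product lying over the chart domain; \<open>s\<close>
    below exhibits its restriction \<open>w'\<close>.\<close>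
  define P where "P = {u \<in> pts (pob X w). par X a u \<in> V}"
  note Po = chart_compose_smooth(1)[OF N M V par_smooth[OF fib a] P_def]
    and hs = chart_compose_smooth(2)[OF N M V par_smooth[OF fib a] P_def]
  define h where "h = (\<lambda>u\<in>P. \<phi> (par X a u))"
  obtain w' s where s: "arr X s w' w" "pob X w' = open_sub (pob X w) P" "par X s = inclusion P"
    using pullback_exists[OF fib arr_Ob(1)[OF a] is_manifold_open_sub[OF N Po] inclusion_smooth[OF N Po]] .
  have ptw: "pts (pob X w') = P" unfolding s(2) by (rule pts_open_sub[OF Po])
  \<comment> \<open>Over \<open>P\<close> the first projection factors through the inverse chart by
    \<open>h\<close>, so it lifts through the cartesian arrow \<open>e\<close> to the projection
    \<open>a'\<close> onto \<open>c\<close>.\<close>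
  have "par X (comp X a s) = compose (pts (pob X w')) (par X e) h"
    unfolding par_comp[OF fib s(1) a] ptw s(3) pe
    by (auto simp: compose_def fun_eq_iff inclusion_def h_def P_def inv)
  from cartesian_lift[OF fib e arr_comp[OF fib s(1) a] _ this]
  obtain a' where a': "arr X a' w' c" "par X a' = h" "comp X e a' = comp X a s"
    using hs by (auto simp: h_def s(2) pc)
  define b' where "b' = comp X b s"
  have b': "arr X b' w' y" unfolding b'_def by (rule arr_comp[OF fib s(1) b])
  have pb': "par X b' = restrict (par X b) P"
    unfolding b'_def par_comp[OF fib s(1) b] ptw s(3) by (auto simp: compose_def fun_eq_iff inclusion_def)
  have uni: "\<exists>!t. arr X t z w' \<and> comp X a' t = p \<and> comp X b' t = q"
    if p: "arr X p z c" and q: "arr X q z y" for z p q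
  proof -
    have ep: "arr X (comp X e p) z x" by (rule arr_comp[OF fib p e])
    have "\<exists>!t. arr X t z w \<and> comp X a t = comp X e p \<and> comp X b t = q"
      using fp ep q unfolding is_fibre_product_def by blast
    then obtain t where t: "arr X t z w" "comp X a t = comp X e p" "comp X b t = q"
      and tu: "\<And>t'. arr X t' z w \<Longrightarrow> comp X a t' = comp X e p \<Longrightarrow> comp X b t' = q \<Longrightarrow> t' = t" by blast
    note Z = fibred_manifold[OF fib arr_Ob(1)[OF t(1)]]
    have pp: "par X p u \<in> \<phi> ` V" if "u \<in> pts (pob X z)" for u
      using par_in_pts[OF fib p that] ptc by simp
    have at: "par X a (par X t u) = inv_into V \<phi> (par X p u)" if "u \<in> pts (pob X z)" for u
      using par_comp_apply[OF fib t(1) a that] par_comp_apply[OF fib p e that] t(2) pe pp[OF that] by simp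
    \<comment> \<open>The mediating arrow into \<open>w\<close> lands in \<open>P\<close>, because
      its composite with \<open>a\<close> factors through the inverse chart. Hence it lifts through
      \<open>s\<close>.\<close>
    have tP: "par X t u \<in> P" if "u \<in> pts (pob X z)" for u
      using par_in_pts[OF fib t(1) that] at[OF that] pp[OF that] by (simp add: P_def inv_into_into)
    have ts: "par X t \<in> smooth_maps (pob X z) (pob X w')"
      unfolding s(2) by (rule smooth_maps_into_open_sub[OF par_smooth[OF fib t(1)] Z]) (use tP in blast)
    have ptz: "par X t = compose (pts (pob X z)) (par X s) (par X t)"
      using tP smooth_maps_extensional[OF ts] unfolding s(3)
      by (auto simp: compose_def fun_eq_iff inclusion_def extensional_def)
    obtain t' where t': "arr X t' z w'" "par X t' = par X t" "comp X s t' = t"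
      using cartesian_lift[OF fib s(1) t(1) ts ptz] by blast
    have 1: "comp X a' t' = p"
    proof (rule cartesian_unique[OF fib e arr_comp[OF fib t'(1) a'(1)] p])
      show "comp X e (comp X a' t') = comp X e p"
        using comp_assoc[OF fib t'(1) a'(1) e] comp_assoc[OF fib t'(1) s(1) a] a'(3) t'(3) t(2) by simp
      have "compose (pts (pob X z)) h (par X t) u = par X p u" for u
      proof (cases "u \<in> pts (pob X z)")
        case True
        then show ?thesis using tP[OF True] at[OF True] pp[OF True]
          by (simp add: compose_def h_def f_inv_into_f)
      next
        case False
        then show ?thesis using smooth_maps_extensional[OF par_smooth[OF fib p]]
          by (simp add: compose_def extensional_def)
      qed
      then show "par X (comp X a' t') = par X p"
        unfolding par_comp[OF fib t'(1) a'(1)] a'(2) t'(2) by (rule ext)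
    qed
    have 2: "comp X b' t' = q"
      unfolding b'_def using comp_assoc[OF fib t'(1) s(1) b] t'(3) t(3) by simp
    \<comment> \<open>Composed with \<open>s\<close>, any competitor solves the universal problem of
      \<open>w\<close>; and \<open>s\<close> can be cancelled, as it lies over an inclusion.\<close>
    have 3: "t'' = t'" if t'': "arr X t'' z w'" "comp X a' t'' = p" "comp X b' t'' = q" for t''
    proof -
      have st: "comp X s t'' = t"
      proof (rule tu)
        show "arr X (comp X s t'') z w" by (rule arr_comp[OF fib t''(1) s(1)])
        show "comp X a (comp X s t'') = comp X e p"
          using comp_assoc[OF fib t''(1) s(1) a] comp_assoc[OF fib t''(1) a'(1) e] a'(3) t''(2) by simp
        show "comp X b (comp X s t'') = q"
          using comp_assoc[OF fib t''(1) s(1) b] t''(3) by (simp add: b'_def)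
      qed
      have "par X t'' u = par X t u" for u
      proof (cases "u \<in> pts (pob X z)")
        case True
        have "par X t'' u \<in> P" using par_in_pts[OF fib t''(1) True] ptw by simp
        then show ?thesis
          using par_comp_apply[OF fib t''(1) s(1) True] st s(3) by (simp add: inclusion_def)
      next
        case False
        then show ?thesis
          using smooth_maps_extensional[OF par_smooth[OF fib t''(1)]] smooth_maps_extensional[OF par_smooth[OF fib t(1)]]
          by (simp add: extensional_def)
      qed
      then have "par X t'' = par X t'" using t'(2) by auto
      then show ?thesis
        by (intro cartesian_unique[OF fib s(1) t''(1) t'(1)]) (simp_all add: st t'(3))
    qed
    show ?thesis
    proof (rule ex1I[of _ t'])
      show "arr X t' z w' \<and> comp X a' t' = p \<and> comp X b' t' = q" using t'(1) 1 2 by blast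
    qed (elim conjE, rule 3)
  qed
  have "is_fibre_product X c y w' a' b'"
    unfolding is_fibre_product_def by (intro conjI allI impI a'(1) b' uni; elim conjE)
  moreover have "local_diffeo (pob X w') (pob X y) (par X b')"
    unfolding s(2) pb' by (rule local_diffeo_restrict[OF ld N fibred_manifold[OF fib y] Po])
  ultimately show "\<exists>w a b. is_fibre_product X c y w a b \<and> local_diffeo (pob X w) (pob X y) (par X b)" by blast
qed

section \<open>Functions on the stack in local coordinates\<close>

lemma C_infinity_arr:
  "f \<in> C_infinity X \<Longrightarrow> arr X a x y \<Longrightarrow> u \<in> pts (pob X x) \<Longrightarrow> f x u = f y (par X a u)"
proof -
  assume f: "f \<in> C_infinity X" and a: "arr X a x y" and u: "u \<in> pts (pob X x)"
  from f a have "f x = compose (pts (pob X x)) (f y) (par X a)" unfolding C_infinity_def by blast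
  with u show ?thesis by (simp add: compose_def)
qed

lemma C_infinity_smooth:
  assumes "f \<in> C_infinity X" "y \<in> Ob X" "(W, \<psi>) \<in> matlas (pob X y)"
  shows "smooth_on (mdim (pob X y)) (\<psi> ` W) (f y \<circ> inv_into W \<psi>)"
proof -
  have "f y \<in> smooth_real_functions (pob X y)" using assms(1,2) unfolding C_infinity_def by blast
  then show ?thesis using assms(3) by (auto simp: smooth_real_functions_def)
qed

text \<open>The base change \<open>b\<close> of \<open>x\<close> along \<open>y\<close> is etale and
  surjective, so it has a local inverse \<beta> at \<open>u\<close>, and \<open>g\<close> is
  \<open>par X a\<close> after \<beta>, read in charts. Functions on the stack are compatible with
  the arrows w \<rightarrow> x, w \<rightarrow> y and c \<rightarrow> x, which gives the equation.
  The point \<open>p\<close> is fixed before \<open>V\<close> and \<open>Q\<close>, so that a member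
  of a cover can be chosen to fit it.\<close>

lemma local_form:
  assumes fib: "fibred_in_groupoids X" and x: "etale_surjection X x" and y: "y \<in> Ob X"
    and W: "(W, \<psi>) \<in> matlas (pob X y)" and u: "u \<in> W"
  obtains p where "p \<in> pts (pob X x)"
    "\<And>V \<phi> c e Q. chart_object X x V \<phi> c e \<Longrightarrow> p \<in> V \<Longrightarrow> \<phi> p \<in> Q \<Longrightarrow>
       openin (Euclidean_space (mdim (pob X x))) Q \<Longrightarrow>
       \<exists>D g. openin (Euclidean_space (mdim (pob X y))) D \<and> \<psi> u \<in> D \<and> D \<subseteq> \<psi> ` W \<and>
         smooth_between (mdim (pob X y)) D (mdim (pob X x)) g \<and> g ` D \<subseteq> Q \<and>
         (\<forall>f \<in> C_infinity X. \<forall>d \<in> D. f y (inv_into W \<psi> d) = f c (g d))"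
proof -
  note Y = fibred_manifold[OF fib y]
  note chW = manifold_chart[OF Y W]
  have uY: "u \<in> pts (pob X y)" using u is_chart_subset[OF chW] by blast
  obtain w a b where fp: "is_fibre_product X x y w a b"
    and ld: "local_diffeo (pob X w) (pob X y) (par X b)" and sj: "surjective (pob X w) (pob X y) (par X b)"
    using x y unfolding etale_surjection_def representable_with_def by blast
  have a: "arr X a w x" and b: "arr X b w y" using fp by (simp_all add: is_fibre_product_def)
  note N = fibred_manifold[OF fib arr_Ob(1)[OF a]]
  note M = fibred_manifold[OF fib arr_Ob(2)[OF a]]
  obtain v where v: "v \<in> pts (pob X w)" "par X b v = u"
    using sj uY unfolding surjective_def by (metis imageE)
  obtain V0 where V0: "openin (mtop (pob X w)) V0" "v \<in> V0" "openin (mtop (pob X y)) (par X b ` V0)" "inj_on (par X b) V0"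
    "restrict (inv_into V0 (par X b)) (par X b ` V0) \<in> smooth_maps (open_sub (pob X y) (par X b ` V0)) (open_sub (pob X w) V0)"
    using ld v(1) unfolding local_diffeo_def by blast
  define B where "B = par X b ` V0"
  define \<beta> where "\<beta> = restrict (inv_into V0 (par X b)) B"
  have Bo: "openin (mtop (pob X y)) B" using V0(3) by (simp add: B_def)
  have \<beta>s: "\<beta> \<in> smooth_maps (open_sub (pob X y) B) (open_sub (pob X w) V0)"
    using V0(5) by (simp add: B_def \<beta>_def)
  have \<beta>b: "\<beta> (par X b v') = v'" if "v' \<in> V0" for v' using that V0(4) by (simp add: \<beta>_def B_def)
  have b\<beta>: "par X b (\<beta> u') = u'" "\<beta> u' \<in> V0" if "u' \<in> B" for u'
    using that \<beta>b by (auto simp: B_def)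
  obtain V1 \<phi>1 where V1: "(V1, \<phi>1) \<in> matlas (pob X w)" "v \<in> V1" using chart_at[OF N v(1)] .
  note ch1 = manifold_chart[OF N V1(1)]
  have ac: "continuous_map (mtop (pob X w)) (mtop (pob X x)) (par X a)"
    using smooth_maps_continuous[OF par_smooth[OF fib a]] .
  show thesis
  proof (rule that[of "par X a v"])
    show "par X a v \<in> pts (pob X x)" by (rule par_in_pts[OF fib a v(1)])
    fix V \<phi> c e Q assume co: "chart_object X x V \<phi> c e" and pV: "par X a v \<in> V" "\<phi> (par X a v) \<in> Q"
      and Q: "openin (Euclidean_space (mdim (pob X x))) Q"
    have V: "(V, \<phi>) \<in> matlas (pob X x)" and e: "arr X e c x"
      and pc: "pob X c = euclidean_open (mdim (pob X x)) (\<phi> ` V)"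
      and pe: "par X e = restrict (inv_into V \<phi>) (\<phi> ` V)"
      using co by (simp_all add: chart_object_def)
    note ch = manifold_chart[OF M V]
    \<comment> \<open>The points of the fibre product that \<open>g\<close> will send into
      \<open>Q\<close>; \<open>A\<close> is the part of \<open>W\<close> that the local inverse
      carries into \<open>S\<close>.\<close>
    define S where "S = {v' \<in> V1. par X a v' \<in> {p \<in> V. \<phi> p \<in> Q}}"
    have So: "openin (mtop (pob X w)) S"
      unfolding S_def by (rule openin_chart_preimage[OF ch1 ac is_chart_open_preimage[OF ch Q]])
    define A where "A = {u' \<in> W \<inter> B. \<beta> u' \<in> S}"
    have \<beta>c: "continuous_map (subtopology (mtop (pob X y)) B) (mtop (pob X w)) \<beta>"
      using smooth_maps_continuous[OF \<beta>s] by (auto intro: continuous_map_into_fulltopology)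
    have WB: "openin (mtop (pob X y)) (W \<inter> B)" using chW Bo by (auto simp: is_chart_def)
    have "openin (subtopology (mtop (pob X y)) B) A"
      unfolding A_def by (rule openin_continuous_map_preimage_gen[OF \<beta>c _ So])
        (use WB Bo in \<open>auto simp: openin_open_subtopology\<close>)
    then have Ao: "openin (mtop (pob X y)) A" using Bo by (simp add: openin_open_subtopology)
    define D where "D = \<psi> ` A"
    have Do: "openin (Euclidean_space (mdim (pob X y))) D"
      unfolding D_def by (rule is_chart_open_image[OF chW Ao]) (auto simp: A_def)
    define g where "g d = \<phi> (par X a (\<beta> (inv_into W \<psi> d)))" for d
    have inv\<psi>: "inv_into W \<psi> (\<psi> u') = u'" if "u' \<in> W" for u'
      using that is_chart_inj_on[OF chW] by simp
    have inv\<psi>B: "inv_into (W \<inter> B) \<psi> (\<psi> u') = u'" if "u' \<in> W \<inter> B" for u'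
      using that inj_on_subset[OF is_chart_inj_on[OF chW], of "W \<inter> B"] by (intro inv_into_f_f) auto
    have inv1: "inv_into V1 \<phi>1 (\<phi>1 v') = v'" if "v' \<in> V1" for v'
      using that is_chart_inj_on[OF ch1] by simp
    have inv: "inv_into V \<phi> (\<phi> v) = v" if "v \<in> V" for v
      using that is_chart_inj_on[OF ch] by simp
    \<comment> \<open>Smoothness of maps is known only in charts, so \<open>g\<close> is factored
      through a chart \<open>\<phi>1\<close> of the fibre product.\<close>
    define g1 where "g1 = \<phi>1 \<circ> \<beta> \<circ> inv_into (W \<inter> B) \<psi>"
    define g2 where "g2 = \<phi> \<circ> par X a \<circ> inv_into V1 \<phi>1"
    define E where "E = {u' \<in> W \<inter> B. \<beta> u' \<in> V1 \<inter> V0}"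
    have Eo: "openin (Euclidean_space (mdim (pob X y))) (\<psi> ` E)"
    proof (rule is_chart_open_image[OF chW])
      have "openin (subtopology (mtop (pob X y)) B) E"
        unfolding E_def by (rule openin_continuous_map_preimage_gen[OF \<beta>c])
          (use WB Bo V0(1) ch1 in \<open>auto simp: openin_open_subtopology is_chart_def\<close>)
      then show "openin (mtop (pob X y)) E" using Bo by (simp add: openin_open_subtopology)
    qed (auto simp: E_def)
    have AE: "A \<subseteq> E" using b\<beta> by (auto simp: A_def E_def S_def)
    have "smooth_between (mdim (pob X y)) (\<psi> ` E) (mdim (pob X w)) g1"
      using smooth_maps_chart[OF \<beta>s matlas_open_subI[OF W] matlas_open_subI[OF V1(1)]]
      by (simp add: g1_def E_def)
    from smooth_between_subset[OF Eo Do _ this] have g1: "smooth_between (mdim (pob X y)) D (mdim (pob X w)) g1"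
      using AE by (auto simp: D_def)
    have Vo: "openin (mtop (pob X x)) V" using ch by (simp add: is_chart_def)
    have o2: "openin (Euclidean_space (mdim (pob X w))) (\<phi>1 ` {v' \<in> V1. par X a v' \<in> V})"
      by (rule is_chart_open_image[OF ch1 openin_chart_preimage[OF ch1 ac Vo]]) auto
    have g2: "smooth_between (mdim (pob X w)) (\<phi>1 ` {v' \<in> V1. par X a v' \<in> V}) (mdim (pob X x)) g2"
      unfolding g2_def by (rule smooth_maps_chart[OF par_smooth[OF fib a] V1(1) V])
    have g1im: "g1 ` D \<subseteq> \<phi>1 ` {v' \<in> V1. par X a v' \<in> V}"
      by (auto simp: D_def g1_def A_def S_def inv\<psi>B)
    have "g2 (g1 d) = g d" if "d \<in> D" for d
      using that by (auto simp: D_def g1_def g2_def g_def A_def S_def inv\<psi>B inv\<psi> inv1)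
    then have gs: "smooth_between (mdim (pob X y)) D (mdim (pob X x)) g"
      by (rule smooth_between_cong[OF Do _ smooth_between_compose[OF Do o2 g1 g1im g2]])
    have gQ: "g ` D \<subseteq> Q" by (auto simp: D_def g_def A_def S_def inv\<psi>)
    have "f y (inv_into W \<psi> d) = f c (g d)" if f: "f \<in> C_infinity X" and d: "d \<in> D" for f d
    proof -
      \<comment> \<open>The values are followed along c \<rightarrow> x \<leftarrow> w \<rightarrow>
        y, starting at \<open>g d\<close> and passing through the point \<open>\<beta> u'\<close> of
        \<open>w\<close>.\<close>
      obtain u' where u': "u' \<in> A" "d = \<psi> u'" using d by (auto simp: D_def)
      then have i: "inv_into W \<psi> d = u'" using inv\<psi> by (auto simp: A_def)
      have uB: "u' \<in> B" using u' by (auto simp: A_def)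
      have bw: "\<beta> u' \<in> pts (pob X w)" using b\<beta>(2)[OF uB] openin_subset[OF V0(1)] by blast
      have aV: "par X a (\<beta> u') \<in> V" using u' by (auto simp: A_def S_def)
      have gc: "g d \<in> \<phi> ` V" "g d = \<phi> (par X a (\<beta> u'))" using aV by (auto simp: g_def i)
      have "g d \<in> pts (pob X c)"
        unfolding pc using gc(1) ch by (subst pts_euclidean_open) (simp_all add: is_chart_def)
      then have "f c (g d) = f x (par X e (g d))" by (rule C_infinity_arr[OF f e])
      also have "\<dots> = f x (par X a (\<beta> u'))" using gc aV inv by (simp add: pe)
      also have "\<dots> = f w (\<beta> u')" using C_infinity_arr[OF f a bw] by simp
      also have "\<dots> = f y u'" using C_infinity_arr[OF f b bw] b\<beta>(1)[OF uB] by simp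
      finally show ?thesis by (simp add: i)
    qed
    moreover have "\<psi> u \<in> D"
    proof -
      have "u \<in> B" "\<beta> u = v" using V0(2) v(2) \<beta>b by (auto simp: B_def)
      then show ?thesis using u V1(2) pV by (auto simp: D_def A_def S_def)
    qed
    moreover have "D \<subseteq> \<psi> ` W" by (auto simp: D_def A_def)
    ultimately show "\<exists>D g. openin (Euclidean_space (mdim (pob X y))) D \<and> \<psi> u \<in> D \<and> D \<subseteq> \<psi> ` W \<and>
         smooth_between (mdim (pob X y)) D (mdim (pob X x)) g \<and> g ` D \<subseteq> Q \<and>
         (\<forall>f \<in> C_infinity X. \<forall>d \<in> D. f y (inv_into W \<psi> d) = f c (g d))"
      using Do gs gQ by (intro exI[of _ D] exI[of _ g]) simp
  qed
qed

section \<open>Completeness and the Baire property\<close>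

text \<open>A triple has two sets because two things are needed: basic neighbourhoods give bounds on
  a compact \<open>K\<close>, while limits of derivatives are taken on an open \<open>Q\<close>. The
  last clause records the local factorisation of every object through some \<open>Q\<close>, so the
  limit argument can work without further recourse to fibre products.\<close>

definition chart_cover :: "nat \<Rightarrow> ('o, 'a) cat_over \<Rightarrow> ('o \<times> pt set \<times> pt set) set \<Rightarrow> bool" where
  "chart_cover n X J \<longleftrightarrow> countable J \<and>
     (\<forall>(c, K, Q) \<in> J. etale X c \<and> openin (Euclidean_space n) Q \<and> Q \<subseteq> K \<and>
        (\<exists>U. openin (Euclidean_space n) U \<and> pob X c = euclidean_open n U \<and>
             K \<subseteq> U \<and> compactin (Euclidean_space n) K)) \<and>
     (\<forall>y \<in> Ob X. \<forall>(W, \<psi>) \<in> matlas (pob X y). \<forall>u \<in> W. \<exists>(c, K, Q) \<in> J. \<exists>D g.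
        openin (Euclidean_space (mdim (pob X y))) D \<and> \<psi> u \<in> D \<and> D \<subseteq> \<psi> ` W \<and>
        smooth_between (mdim (pob X y)) D n g \<and> g ` D \<subseteq> Q \<and>
        (\<forall>f \<in> C_infinity X. \<forall>d \<in> D. f y (inv_into W \<psi> d) = f c (g d)))"

text \<open>Small boxes in charts of the source of the etale surjection give an open cover; second
  countability makes it Lindelof. \<open>local_form\<close> turns covering the source into covering
  every object.\<close>

lemma chart_cover_exists:
  fixes X :: "('o, 'a) cat_over"
  assumes fib: "fibred_in_groupoids X" and x: "etale_surjection X x" and n: "mdim (pob X x) = n"
  shows "\<exists>J. chart_cover n X J"
proof -
  have xO: "x \<in> Ob X" using x by (simp add: etale_surjection_def representable_with_def)
  note M = fibred_manifold[OF fib xO]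
  note ch = manifold_chart[OF M, unfolded n]
  \<comment> \<open>\<open>S\<close> is the open set in the source manifold that the triple
    \<open>t\<close> describes in a chart. Subcovers are extracted among the sets \<open>S\<close>,
    and a triple is then chosen for each.\<close>
  define R where "R S t \<longleftrightarrow> (\<exists>V \<phi> e. chart_object X x V \<phi> (fst t) e \<and> S = {p \<in> V. \<phi> p \<in> snd (snd t)} \<and>
      openin (Euclidean_space n) (snd (snd t)) \<and> snd (snd t) \<subseteq> fst (snd t) \<and> fst (snd t) \<subseteq> \<phi> ` V \<and>
      compactin (Euclidean_space n) (fst (snd t)))" for S :: "pt set" and t :: "'o \<times> pt set \<times> pt set"
  define \<U> where "\<U> = {S. \<exists>t. R S t}"
  have opn: "openin (mtop (pob X x)) S" if "S \<in> \<U>" for S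
    using that is_chart_open_preimage[OF ch] unfolding \<U>_def R_def chart_object_def by blast
  have cover: "\<Union>\<U> = pts (pob X x)"
  proof
    show "\<Union>\<U> \<subseteq> pts (pob X x)" using opn openin_subset by blast
    show "pts (pob X x) \<subseteq> \<Union>\<U>"
    proof
      fix p assume "p \<in> pts (pob X x)"
      then obtain V \<phi> where V: "(V, \<phi>) \<in> matlas (pob X x)" "p \<in> V" by (rule chart_at[OF M])
      have o: "openin (Euclidean_space n) (\<phi> ` V)" using ch[OF V(1)] by (simp add: is_chart_def)
      have "\<phi> p \<in> \<phi> ` V" using V(2) by blast
      then obtain d where d: "d > 0" "open_box n (\<phi> p) d \<subseteq> \<phi> ` V" by (rule open_box_subset_open[OF o])
      have pE: "\<phi> p \<in> topspace (Euclidean_space n)" using o openin_subset V(2) by blast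
      obtain c e where co: "chart_object X x V \<phi> c e" using chart_object_exists[OF fib xO V(1)] by blast
      \<comment> \<open>With half the radius the closed box, too, stays inside the chart
        image.\<close>
      have "d / 2 < d" using d(1) by simp
      then have sub: "closed_box n (\<phi> p) (d / 2) \<subseteq> \<phi> ` V"
        by (rule order_trans[OF closed_box_subset_open_box d(2)])
      have "R {q \<in> V. \<phi> q \<in> open_box n (\<phi> p) (d / 2)} (c, closed_box n (\<phi> p) (d / 2), open_box n (\<phi> p) (d / 2))"
        unfolding R_def fst_conv snd_conv
        by (intro exI[of _ V] exI[of _ \<phi>] exI[of _ e] conjI refl openin_open_box compactin_closed_box open_box_subset_closed_box sub co)
      moreover have "p \<in> {q \<in> V. \<phi> q \<in> open_box n (\<phi> p) (d / 2)}"
        using V(2) in_open_box[OF pE, of "d / 2"] d(1) by simp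
      ultimately show "p \<in> \<Union>\<U>" unfolding \<U>_def by blast
    qed
  qed
  have "Lindelof_space (mtop (pob X x))"
    using M unfolding is_manifold_def by (intro second_countable_imp_Lindelof_space) (elim conjE)
  then have "\<exists>\<V>. countable \<V> \<and> \<V> \<subseteq> \<U> \<and> \<Union>\<V> = pts (pob X x)"
    by (rule Lindelof_spaceD) (rule opn, assumption, rule cover)
  then obtain \<V> where
    \<V>: "countable \<V>" "\<V> \<subseteq> \<U>" "\<Union>\<V> = pts (pob X x)" by (elim exE conjE)
  have "\<forall>S\<in>\<V>. \<exists>t. R S t" using \<V>(2) unfolding \<U>_def by (intro ballI) (drule (1) subsetD, simp)
  then have "\<exists>t. \<forall>S\<in>\<V>. R S (t S)" by (rule bchoice)
  then obtain t where t: "\<And>S. S \<in> \<V> \<Longrightarrow> R S (t S)" by (elim exE) (rule that, erule (1) bspec)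
  have "chart_cover n X (t ` \<V>)"
    unfolding chart_cover_def
  proof (intro conjI)
    show "countable (t ` \<V>)" using \<V>(1) by simp
    have *: "etale X c \<and> openin (Euclidean_space n) Q \<and> Q \<subseteq> K \<and>
        (\<exists>U. openin (Euclidean_space n) U \<and> pob X c = euclidean_open n U \<and>
             K \<subseteq> U \<and> compactin (Euclidean_space n) K)" if tS: "(c, K, Q) \<in> t ` \<V>" for c K Q
    proof -
      obtain S where S: "S \<in> \<V>" "t S = (c, K, Q)" using tS by (metis imageE)
      obtain V \<phi> e where V: "chart_object X x V \<phi> c e"
        and rest: "openin (Euclidean_space n) Q" "Q \<subseteq> K" "K \<subseteq> \<phi> ` V" "compactin (Euclidean_space n) K"
        using t[OF S(1)] unfolding R_def S(2) fst_conv snd_conv by blast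
      have "openin (Euclidean_space n) (\<phi> ` V)" "pob X c = euclidean_open n (\<phi> ` V)"
        using V ch n by (auto simp: chart_object_def is_chart_def)
      with rest etale_chart_object[OF fib etale_surjection_imp_etale[OF x] V] show ?thesis by blast
    qed
    then show "\<forall>(c, K, Q)\<in>t ` \<V>. etale X c \<and> openin (Euclidean_space n) Q \<and> Q \<subseteq> K \<and>
        (\<exists>U. openin (Euclidean_space n) U \<and> pob X c = euclidean_open n U \<and>
             K \<subseteq> U \<and> compactin (Euclidean_space n) K)" by (intro ballI) (simp only: split_paired_all case_prod_conv)
    have local: "\<exists>(c, K, Q) \<in> t ` \<V>. \<exists>D g.
        openin (Euclidean_space (mdim (pob X y))) D \<and> \<psi> u \<in> D \<and> D \<subseteq> \<psi> ` W \<and>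
        smooth_between (mdim (pob X y)) D n g \<and> g ` D \<subseteq> Q \<and>
        (\<forall>f \<in> C_infinity X. \<forall>d \<in> D. f y (inv_into W \<psi> d) = f c (g d))"
      if y: "y \<in> Ob X" and W: "(W, \<psi>) \<in> matlas (pob X y)" and u: "u \<in> W" for y W \<psi> u
    proof -
      obtain p where p: "p \<in> pts (pob X x)"
        "\<And>V \<phi> c e Q. chart_object X x V \<phi> c e \<Longrightarrow> p \<in> V \<Longrightarrow> \<phi> p \<in> Q \<Longrightarrow>
         openin (Euclidean_space n) Q \<Longrightarrow>
         \<exists>D g. openin (Euclidean_space (mdim (pob X y))) D \<and> \<psi> u \<in> D \<and> D \<subseteq> \<psi> ` W \<and>
           smooth_between (mdim (pob X y)) D n g \<and> g ` D \<subseteq> Q \<and>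
           (\<forall>f \<in> C_infinity X. \<forall>d \<in> D. f y (inv_into W \<psi> d) = f c (g d))"
        using local_form[OF fib x y W u, unfolded n] by metis
      obtain S where S: "S \<in> \<V>" "p \<in> S" using p(1) \<V>(3) by blast
      obtain c K Q where eq: "t S = (c, K, Q)" by (metis prod_cases3)
      obtain V \<phi> e where V: "chart_object X x V \<phi> c e" "S = {p \<in> V. \<phi> p \<in> Q}" "openin (Euclidean_space n) Q"
        using t[OF S(1)] unfolding R_def eq fst_conv snd_conv by blast
      have "p \<in> V" "\<phi> p \<in> Q" using S(2) V(2) by auto
      from p(2)[OF V(1) this V(3)] show ?thesis
        using S(1) eq by (intro bexI[of _ "(c, K, Q)"]) (auto intro: rev_image_eqI)
    qed
    show "\<forall>y \<in> Ob X. \<forall>(W, \<psi>) \<in> matlas (pob X y). \<forall>u \<in> W. \<exists>(c, K, Q) \<in> t ` \<V>. \<exists>D g.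
        openin (Euclidean_space (mdim (pob X y))) D \<and> \<psi> u \<in> D \<and> D \<subseteq> \<psi> ` W \<and>
        smooth_between (mdim (pob X y)) D n g \<and> g ` D \<subseteq> Q \<and>
        (\<forall>f \<in> C_infinity X. \<forall>d \<in> D. f y (inv_into W \<psi> d) = f c (g d))"
      by (intro ballI, simp only: split_paired_all case_prod_conv) (rule ballI, rule local)
  qed
  then show ?thesis by blast
qed

lemma chart_coverD:
  assumes "chart_cover n X J"
  shows "countable J"
    and "\<And>c K Q. (c, K, Q) \<in> J \<Longrightarrow> etale X c \<and> openin (Euclidean_space n) Q \<and> Q \<subseteq> K \<and>
        (\<exists>U. openin (Euclidean_space n) U \<and> pob X c = euclidean_open n U \<and>
             K \<subseteq> U \<and> compactin (Euclidean_space n) K)"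
    and "\<And>y W \<psi> u. y \<in> Ob X \<Longrightarrow> (W, \<psi>) \<in> matlas (pob X y) \<Longrightarrow> u \<in> W \<Longrightarrow> \<exists>c K Q D g. (c, K, Q) \<in> J \<and>
        openin (Euclidean_space (mdim (pob X y))) D \<and> \<psi> u \<in> D \<and> D \<subseteq> \<psi> ` W \<and>
        smooth_between (mdim (pob X y)) D n g \<and> g ` D \<subseteq> Q \<and>
        (\<forall>f \<in> C_infinity X. \<forall>d \<in> D. f y (inv_into W \<psi> d) = f c (g d))"
proof -
  note J = assms[unfolded chart_cover_def]
  show "countable J" using J by (rule conjunct1)
  show "etale X c \<and> openin (Euclidean_space n) Q \<and> Q \<subseteq> K \<and>
        (\<exists>U. openin (Euclidean_space n) U \<and> pob X c = euclidean_open n U \<and>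
             K \<subseteq> U \<and> compactin (Euclidean_space n) K)" if "(c, K, Q) \<in> J" for c K Q
    using bspec[OF conjunct1[OF conjunct2[OF J]] that] by (simp only: case_prod_conv)
  show "\<exists>c K Q D g. (c, K, Q) \<in> J \<and>
        openin (Euclidean_space (mdim (pob X y))) D \<and> \<psi> u \<in> D \<and> D \<subseteq> \<psi> ` W \<and>
        smooth_between (mdim (pob X y)) D n g \<and> g ` D \<subseteq> Q \<and>
        (\<forall>f \<in> C_infinity X. \<forall>d \<in> D. f y (inv_into W \<psi> d) = f c (g d))"
    if "y \<in> Ob X" "(W, \<psi>) \<in> matlas (pob X y)" "u \<in> W" for y W \<psi> u
    using bspec[OF bspec[OF bspec[OF conjunct2[OF conjunct2[OF J]] that(1)] that(2), unfolded case_prod_conv] that(3)]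
    by (simp only: Bex_def split_paired_Ex case_prod_conv) blast
qed

section \<open>Limits of functions on the stack\<close>

lemma C_infinity_limit:
  assumes fib: "fibred_in_groupoids X" and J: "chart_cover n X J" and G: "\<And>k. G k \<in> C_infinity X"
    and F: "\<And>c K Q. (c, K, Q) \<in> J \<Longrightarrow> \<exists>F. smooth_conv n Q (\<lambda>k. G k c) F"
  shows "\<exists>f \<in> C_infinity X. \<forall>y \<in> Ob X. \<forall>W \<psi>. (W, \<psi>) \<in> matlas (pob X y) \<longrightarrow>
      smooth_conv (mdim (pob X y)) (\<psi> ` W) (\<lambda>k. G k y \<circ> inv_into W \<psi>) (f y \<circ> inv_into W \<psi>)"
proof -
  \<comment> \<open>The limit is defined pointwise on all objects at once, so no gluing is required;
    the restrictions make \<open>f\<close> and its values extensional.\<close>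
  define f where "f = (\<lambda>y\<in>Ob X. \<lambda>u\<in>pts (pob X y). lim (\<lambda>k. G k y u))"
  have fy: "f y u = lim (\<lambda>k. G k y u)" if "y \<in> Ob X" "u \<in> pts (pob X y)" for y u
    using that by (simp add: f_def)
  have cv: "smooth_conv (mdim (pob X y)) (\<psi> ` W) (\<lambda>k. G k y \<circ> inv_into W \<psi>) (f y \<circ> inv_into W \<psi>)"
    if y: "y \<in> Ob X" and W: "(W, \<psi>) \<in> matlas (pob X y)" for y W \<psi>
  proof (rule smooth_conv_local)
    note ch = manifold_chart[OF fibred_manifold[OF fib y] W]
    show "openin (Euclidean_space (mdim (pob X y))) (\<psi> ` W)" using ch by (simp add: is_chart_def)
    fix z assume "z \<in> \<psi> ` W"
    then obtain u where u: "u \<in> W" "z = \<psi> u" by blast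
    obtain c K Q D g where cJ: "(c, K, Q) \<in> J"
      and D: "openin (Euclidean_space (mdim (pob X y))) D" "\<psi> u \<in> D" "D \<subseteq> \<psi> ` W"
      and g: "smooth_between (mdim (pob X y)) D n g" "g ` D \<subseteq> Q"
      and eq: "\<forall>f \<in> C_infinity X. \<forall>d \<in> D. f y (inv_into W \<psi> d) = f c (g d)"
      using chart_coverD(3)[OF J y W u(1)] by metis
    have Q: "openin (Euclidean_space n) Q" using chart_coverD(2)[OF J cJ] by blast
    obtain F' where F': "smooth_conv n Q (\<lambda>k. G k c) F'" using F[OF cJ] by blast
    have 1: "smooth_conv (mdim (pob X y)) D (\<lambda>k d. G k c (g d)) (\<lambda>d. F' (g d))"
      by (rule smooth_conv_compose[OF D(1) Q g F'])
    have "smooth_conv (mdim (pob X y)) D (\<lambda>k. G k y \<circ> inv_into W \<psi>) (f y \<circ> inv_into W \<psi>)"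
    proof (rule smooth_conv_cong[OF D(1) 1])
      fix d assume d: "d \<in> D"
      have Gk: "G k c (g d) = G k y (inv_into W \<psi> d)" for k
        using bspec[OF bspec[OF eq G] d] by (rule sym)
      then show "G k c (g d) = (G k y \<circ> inv_into W \<psi>) d" for k by simp
      have "(\<lambda>k. G k y (inv_into W \<psi> d)) \<longlonglongrightarrow> F' (g d)"
        using smooth_conv_pointwise[OF 1 d] by (simp only: Gk)
      moreover have "inv_into W \<psi> d \<in> pts (pob X y)"
        using is_chart_subset[OF ch] D(3) d by (auto intro: inv_into_into subsetD)
      ultimately show "F' (g d) = (f y \<circ> inv_into W \<psi>) d" by (simp add: fy[OF y] limI)
    qed
    then show "\<exists>D. openin (Euclidean_space (mdim (pob X y))) D \<and> z \<in> D \<and> D \<subseteq> \<psi> ` W \<and>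
        smooth_conv (mdim (pob X y)) D (\<lambda>k. G k y \<circ> inv_into W \<psi>) (f y \<circ> inv_into W \<psi>)"
      using D u(2) by (intro exI[of _ D]) simp
  qed
  have "f \<in> C_infinity X"
    unfolding C_infinity_def
  proof (intro CollectI conjI ballI allI impI)
    show "f \<in> extensional (Ob X)" by (simp add: f_def)
    show "f y \<in> smooth_real_functions (pob X y)" if y: "y \<in> Ob X" for y
      using cv[OF y] y by (auto simp: smooth_real_functions_def smooth_conv_def f_def)
    fix a x y assume a: "arr X a x y"
    \<comment> \<open>At corresponding points of \<open>x\<close> and \<open>y\<close> the two
      sequences of values are identical, so their limits agree.\<close>
    show "f x = compose (pts (pob X x)) (f y) (par X a)"
    proof
      fix u show "f x u = compose (pts (pob X x)) (f y) (par X a) u"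
      proof (cases "u \<in> pts (pob X x)")
        case True
        then show ?thesis
          using arr_Ob[OF a] par_in_pts[OF fib a True] C_infinity_arr[OF G a True] by (simp add: compose_def fy)
      next
        case False
        then show ?thesis using arr_Ob[OF a] by (simp add: compose_def f_def)
      qed
    qed
  qed
  then show ?thesis by (rule bexI[rotated]) (intro ballI allI impI cv)
qed

lemma C_infinity_smooth_euclidean:
  assumes f: "f \<in> C_infinity X" and c: "c \<in> Ob X" and U: "openin (Euclidean_space n) U" "pob X c = euclidean_open n U"
  shows "smooth_on n U (f c)"
proof (rule smooth_on_cong[OF U(1)])
  show "smooth_on n U (f c \<circ> inv_into U (\<lambda>x. x))"
    using C_infinity_smooth[OF f c, of U "\<lambda>x. x"] by (simp add: U(2))
qed (simp add: inv_into_ident)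

text \<open>Only objects over open subsets of Euclidean spaces are tested, since there derivatives
  make sense without a choice of chart. The sources in the definition of a basic neighbourhood are
  among them.\<close>

definition C_infinity_conv :: "('o, 'a) cat_over \<Rightarrow> (nat \<Rightarrow> 'o \<Rightarrow> pt \<Rightarrow> real) \<Rightarrow> ('o \<Rightarrow> pt \<Rightarrow> real) \<Rightarrow> bool" where
  "C_infinity_conv X G f \<longleftrightarrow> (\<forall>k. G k \<in> C_infinity X) \<and> f \<in> C_infinity X \<and>
     (\<forall>c \<in> Ob X. \<forall>n U. openin (Euclidean_space n) U \<and> pob X c = euclidean_open n U \<longrightarrow>
        smooth_conv n U (\<lambda>k. G k c) (f c))"

lemma C_infinity_complete:
  assumes fib: "fibred_in_groupoids X" and J: "chart_cover n X J" and G: "\<And>k. G k \<in> C_infinity X"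
    and C: "\<And>c K Q is. (c, K, Q) \<in> J \<Longrightarrow> is \<in> lists {..<n} \<Longrightarrow> uniformly_Cauchy_on Q (\<lambda>k. partials is (G k c))"
  obtains f where "C_infinity_conv X G f"
proof -
  have *: "\<exists>F. smooth_conv n Q (\<lambda>k. G k c) F" if cJ: "(c, K, Q) \<in> J" for c K Q
  proof -
    obtain U where U: "openin (Euclidean_space n) U" "pob X c = euclidean_open n U" "Q \<subseteq> U"
      and Q: "openin (Euclidean_space n) Q" and "etale X c"
      using chart_coverD(2)[OF J cJ] by (elim conjE exE) (metis order_trans)
    then have c: "c \<in> Ob X" by (simp add: etale_def representable_with_def)
    show ?thesis
      by (rule smooth_conv_if_uniformly_Cauchy[OF Q smooth_on_subset[OF U(1) Q U(3) C_infinity_smooth_euclidean[OF G c U(1,2)]] C[OF cJ]])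
  qed
  obtain f where f: "f \<in> C_infinity X" "\<forall>y \<in> Ob X. \<forall>W \<psi>. (W, \<psi>) \<in> matlas (pob X y) \<longrightarrow>
      smooth_conv (mdim (pob X y)) (\<psi> ` W) (\<lambda>k. G k y \<circ> inv_into W \<psi>) (f y \<circ> inv_into W \<psi>)"
    using C_infinity_limit[OF fib J G *] by (rule bexE)
  have "smooth_conv m U (\<lambda>k. G k c) (f c)" if c: "c \<in> Ob X" and U: "openin (Euclidean_space m) U" "pob X c = euclidean_open m U" for c m U
  proof (rule smooth_conv_cong[OF U(1)])
    show "smooth_conv m U (\<lambda>k. G k c \<circ> inv_into U (\<lambda>x. x)) (f c \<circ> inv_into U (\<lambda>x. x))"
      using f(2)[rule_format, OF c, of U "\<lambda>x. x"] by (simp add: U(2))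
  qed (simp_all add: inv_into_ident)
  then have "C_infinity_conv X G f" using f(1) G by (simp add: C_infinity_conv_def)
  then show thesis by (rule that)
qed

lemma uniformly_Cauchy_on_geometric:
  fixes F :: "nat \<Rightarrow> 'a \<Rightarrow> real"
  assumes "\<And>k x. k \<ge> N \<Longrightarrow> x \<in> Q \<Longrightarrow> \<bar>F (Suc k) x - F k x\<bar> \<le> (1/2)^k"
  shows "uniformly_Cauchy_on Q F"
proof (rule uniformly_Cauchy_onI')
  fix e :: real assume e: "e > 0"
  \<comment> \<open>The right-hand side is the exact value of the geometric sum of the bounds from k
    to k + d - 1, which lets the induction close.\<close>
  have *: "\<bar>F (k + d) x - F k x\<bar> \<le> 2 * (1/2)^k - 2 * (1/2)^(k + d)" if "k \<ge> N" "x \<in> Q" for k d x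
  proof (induction d)
    case (Suc d)
    have "\<bar>F (Suc (k + d)) x - F (k + d) x\<bar> \<le> (1/2)^(k + d)" using assms that by simp
    with Suc show ?case by simp
  qed simp
  obtain M where M: "(1/2::real)^M < e / 2" using real_arch_pow_inv[of "e/2" "1/2"] e by auto
  show "\<exists>M. \<forall>x\<in>Q. \<forall>m\<ge>M. \<forall>n>m. dist (F m x) (F n x) < e"
  proof (intro exI[of _ "max M N"] ballI allI impI)
    fix x m n assume x: "x \<in> Q" and m: "max M N \<le> m" and "m < n"
    then obtain d where d: "n = m + d" using less_imp_add_positive by blast
    have 1: "(1/2::real)^m \<le> (1/2)^M" using m by (intro power_decreasing) auto
    have 2: "0 < (1/2::real)^(m + d)" by simp
    have 3: "\<bar>F (m + d) x - F m x\<bar> \<le> 2 * (1/2)^m - 2 * (1/2)^(m + d)" using *[of m x d] x m by simp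
    show "dist (F m x) (F n x) < e"
      unfolding d dist_real_def using 1 2 3 M by linarith
  qed
qed

text \<open>Eventual membership is the right hypothesis: in the Baire argument only the terms from
  index k on are known to lie in the k-th set.\<close>

definition seq_closed :: "('o, 'a) cat_over \<Rightarrow> ('o \<Rightarrow> pt \<Rightarrow> real) set \<Rightarrow> bool" where
  "seq_closed X C \<longleftrightarrow> (\<forall>G f. C_infinity_conv X G f \<and> eventually (\<lambda>k. G k \<in> C) sequentially \<longrightarrow> f \<in> C)"

section \<open>Shrinking strong neighbourhoods\<close>

lemma finite_words: "finite {is \<in> lists {..<n::nat}. length is \<le> r}"
proof -
  have "{is \<in> lists {..<n}. length is \<le> r} = {is. set is \<subseteq> {..<n} \<and> length is \<le> r}" by auto
  then show ?thesis using finite_lists_length_le[of "{..<n}" r] by simp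
qed

text \<open>A continuous function below \<epsilon> on a compact set attains its maximum there, hence
  leaves a margin; finitely many functions have a common one.\<close>

lemma compact_strict_bound:
  fixes \<phi> :: "'i \<Rightarrow> 'b::topological_space \<Rightarrow> real"
  assumes "finite S" "compact K" "\<And>s. s \<in> S \<Longrightarrow> continuous_on K (\<phi> s)"
    and lt: "\<And>s k. s \<in> S \<Longrightarrow> k \<in> K \<Longrightarrow> \<phi> s k < \<epsilon>"
  shows "\<exists>\<delta>>0. \<forall>s\<in>S. \<forall>k\<in>K. \<phi> s k < \<epsilon> - \<delta>"
proof -
  \<comment> \<open>The maximum yields only a non-strict bound; the factor 2 leaves room to make it
    strict.\<close>
  have "\<exists>\<delta>>0. \<forall>k\<in>K. \<phi> s k \<le> \<epsilon> - 2 * \<delta>" if s: "s \<in> S" for s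
  proof (cases "K = {}")
    case False
    then obtain k0 where "k0 \<in> K" "\<forall>k\<in>K. \<phi> s k \<le> \<phi> s k0"
      using continuous_attains_sup[OF assms(2) _ assms(3)[OF s]] by blast
    then show ?thesis using lt[OF s, of k0] by (intro exI[of _ "(\<epsilon> - \<phi> s k0) / 2"]) (auto simp: field_simps)
  qed (auto intro: exI[of _ 1])
  then obtain \<delta> where \<delta>: "\<And>s. s \<in> S \<Longrightarrow> \<delta> s > 0" "\<And>s k. s \<in> S \<Longrightarrow> k \<in> K \<Longrightarrow> \<phi> s k \<le> \<epsilon> - 2 * \<delta> s"
    by metis
  define d where "d = Min (insert 1 (\<delta> ` S))"
  have d: "d > 0" "\<And>s. s \<in> S \<Longrightarrow> d \<le> \<delta> s" using assms(1) \<delta>(1) by (auto simp: d_def)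
  have "\<phi> s k < \<epsilon> - d" if "s \<in> S" "k \<in> K" for s k
    using \<delta>(2)[OF that] \<delta>(1)[OF that(1)] d(2)[OF that(1)] by linarith
  then show ?thesis using d(1) by blast
qed

lemma strong_nbhd_in_basis:
  fixes X :: "('o, 'a) cat_over" and I :: "('o \<times> pt set \<times> real) set"
  assumes "strong_data n X I c K \<epsilon>" "f \<in> C_infinity X"
  shows "strong_nbhd n X r I c K \<epsilon> f \<in> strong_basis n X"
  unfolding strong_basis_def using assms by blast

text \<open>Each \<open>K i\<close> is compact and there are finitely many words of length at most
  \<open>r\<close>, so \<open>g\<close> keeps a margin \<open>\<delta> i\<close> in every chart
  separately. Objects and compact sets are kept, so local finiteness is inherited even when
  \<open>I\<close> is infinite.\<close>

lemma strong_nbhd_refine: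
  fixes X :: "('o, 'a) cat_over" and I :: "('o \<times> pt set \<times> real) set"
  assumes sd: "strong_data n X I c K \<epsilon>" and f: "f \<in> C_infinity X" and g: "g \<in> strong_nbhd n X r I c K \<epsilon> f"
  shows "\<exists>B C. B \<in> strong_basis n X \<and> g \<in> B \<and> B \<subseteq> C \<and> C \<subseteq> strong_nbhd n X r I c K \<epsilon> f \<and> seq_closed X C"
proof -
  have gC: "g \<in> C_infinity X" using g by (simp add: strong_nbhd_def)
  have U: "\<exists>U. openin (Euclidean_space n) U \<and> pob X (c i) = euclidean_open n U \<and>
             K i \<subseteq> U \<and> compactin (Euclidean_space n) (K i)" if "i \<in> I" for i
    using sd that unfolding strong_data_def by blast
  have cO: "c i \<in> Ob X" if "i \<in> I" for i
    using sd that by (auto simp: strong_data_def etale_def representable_with_def)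
  have "\<exists>\<delta>>0. \<forall>is\<in>{is \<in> lists {..<n}. length is \<le> r}. \<forall>k\<in>K i.
      \<bar>partials is (g (c i)) k - partials is (f (c i)) k\<bar> < \<epsilon> i - \<delta>" if i: "i \<in> I" for i
  proof (rule compact_strict_bound[OF finite_words])
    obtain U where U: "openin (Euclidean_space n) U" "pob X (c i) = euclidean_open n U" "K i \<subseteq> U"
      "compactin (Euclidean_space n) (K i)" using U[OF i] by blast
    show "compact (K i)"
      using U(4) Euclidean_space_eq_top_of_set[of n] compactin_subtopology[of euclidean] by (metis compactin_euclidean_iff)
    show "\<bar>partials is (g (c i)) k - partials is (f (c i)) k\<bar> < \<epsilon> i"
      if "is \<in> {is \<in> lists {..<n}. length is \<le> r}" "k \<in> K i" for "is" k
      using g i that by (simp add: strong_nbhd_def)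
    show "continuous_on (K i) (\<lambda>k. \<bar>partials is (g (c i)) k - partials is (f (c i)) k\<bar>)"
      if "is \<in> {is \<in> lists {..<n}. length is \<le> r}" for "is"
    proof -
      have "continuous_on U (partials is (h (c i)))" if "h \<in> C_infinity X" for h
        using C_infinity_smooth_euclidean[OF that cO[OF i] U(1,2)] \<open>is \<in> _\<close>
        unfolding smooth_on_iff_C1_on[OF U(1)] C1_on_def by blast
      then have "continuous_on (K i) (partials is (h (c i)))" if "h \<in> C_infinity X" for h
        using that continuous_on_subset U(3) by blast
      then show ?thesis using f gC by (intro continuous_intros) auto
    qed
  qed
  then obtain \<delta> where \<delta>: "\<And>i. i \<in> I \<Longrightarrow> \<delta> i > 0"
    "\<And>i is k. i \<in> I \<Longrightarrow> is \<in> lists {..<n} \<Longrightarrow> length is \<le> r \<Longrightarrow> k \<in> K i \<Longrightarrow>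
      \<bar>partials is (g (c i)) k - partials is (f (c i)) k\<bar> < \<epsilon> i - \<delta> i" by simp metis
  \<comment> \<open>Non-strict inequalities with the margins as radii: they pass to limits, and the
    triangle inequality keeps \<open>C\<close> inside the given neighbourhood.\<close>
  define C where "C = {h \<in> C_infinity X. \<forall>i\<in>I. \<forall>k\<in>K i. \<forall>is\<in>lists {..<n}. length is \<le> r \<longrightarrow>
      \<bar>partials is (h (c i)) k - partials is (g (c i)) k\<bar> \<le> \<delta> i}"
  have "strong_data n X I c K \<delta>" using sd \<delta>(1) by (simp add: strong_data_def)
  then have "strong_nbhd n X r I c K \<delta> g \<in> strong_basis n X"
    using gC by (rule strong_nbhd_in_basis)
  moreover have "g \<in> strong_nbhd n X r I c K \<delta> g" using gC \<delta>(1) by (simp add: strong_nbhd_def)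
  moreover have "strong_nbhd n X r I c K \<delta> g \<subseteq> C"
    unfolding strong_nbhd_def C_def by (auto intro: less_imp_le)
  moreover have "C \<subseteq> strong_nbhd n X r I c K \<epsilon> f"
  proof
    fix h assume h: "h \<in> C"
    have "\<bar>partials is (h (c i)) k - partials is (f (c i)) k\<bar> < \<epsilon> i"
      if *: "i \<in> I" "k \<in> K i" "is \<in> lists {..<n}" "length is \<le> r" for i k "is"
    proof -
      have "\<bar>partials is (h (c i)) k - partials is (g (c i)) k\<bar> \<le> \<delta> i"
        using h * unfolding C_def by blast
      with \<delta>(2)[OF *(1,3,4,2)] show ?thesis by linarith
    qed
    then show "h \<in> strong_nbhd n X r I c K \<epsilon> f" using h by (simp add: strong_nbhd_def C_def)
  qed
  moreover have "seq_closed X C"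
    unfolding seq_closed_def
  proof (intro allI impI, elim conjE)
    fix G h assume G: "C_infinity_conv X G h" and ev: "eventually (\<lambda>k. G k \<in> C) sequentially"
    have "\<bar>partials is (h (c i)) k - partials is (g (c i)) k\<bar> \<le> \<delta> i"
      if *: "i \<in> I" "k \<in> K i" "is \<in> lists {..<n}" "length is \<le> r" for i k "is"
    proof -
      obtain U where U: "openin (Euclidean_space n) U" "pob X (c i) = euclidean_open n U" "K i \<subseteq> U"
        using U[OF *(1)] by blast
      have "smooth_conv n U (\<lambda>k. G k (c i)) (h (c i))"
        using G cO[OF *(1)] U(1,2) unfolding C_infinity_conv_def by blast
      then have "(\<lambda>j. partials is (G j (c i)) k) \<longlonglongrightarrow> partials is (h (c i)) k"
        using *(2,3) U(3) unfolding smooth_conv_def by blast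
      then have "(\<lambda>j. \<bar>partials is (G j (c i)) k - partials is (g (c i)) k\<bar>) \<longlonglongrightarrow>
          \<bar>partials is (h (c i)) k - partials is (g (c i)) k\<bar>"
        by (intro tendsto_intros)
      then show ?thesis
        by (rule tendsto_upperbound) (use ev * in \<open>auto simp: C_def elim!: eventually_mono\<close>)
    qed
    then show "h \<in> C" using G by (simp add: C_def C_infinity_conv_def)
  qed
  ultimately show ?thesis by blast
qed

text \<open>By induction on how the open set is generated from basic sets. The pairs are intersected
  for a binary intersection, and inherited from one member for a union.\<close>

lemma open_strong_refine:
  assumes "openin (strong_topology n X) A" "g \<in> A"
  shows "\<exists>B C. openin (strong_topology n X) B \<and> g \<in> B \<and> B \<subseteq> C \<and> C \<subseteq> A \<and> seq_closed X C"
proof -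
  have "generate_topology_on (strong_basis n X) A"
    using assms(1) by (simp add: strong_topology_def openin_topology_generated_by)
  then show ?thesis using assms(2)
  proof (induction A rule: generate_topology_on.induct)
    case (Int a b)
    then obtain B C B' C' where
      "openin (strong_topology n X) B" "g \<in> B" "B \<subseteq> C" "C \<subseteq> a" "seq_closed X C"
      "openin (strong_topology n X) B'" "g \<in> B'" "B' \<subseteq> C'" "C' \<subseteq> b" "seq_closed X C'" by blast
    moreover from this have "seq_closed X (C \<inter> C')"
      unfolding seq_closed_def by (auto simp: eventually_conj_iff)
    ultimately show ?case by (intro exI[of _ "B \<inter> B'"] exI[of _ "C \<inter> C'"]) auto
  next
    case (UN K)
    then obtain k where "k \<in> K" "g \<in> k" by blast
    with UN.IH[of k] show ?case by blast
  next
    case (Basis s)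
    then obtain r and I :: "('a \<times> pt set \<times> real) set" and c K \<epsilon> f where
      s: "strong_data n X I c K \<epsilon>" "f \<in> C_infinity X" "s = strong_nbhd n X r I c K \<epsilon> f"
      unfolding strong_basis_def by blast
    then obtain B C where B: "B \<in> strong_basis n X" and "g \<in> B" "B \<subseteq> C" "C \<subseteq> s" "seq_closed X C"
      using strong_nbhd_refine[OF s(1,2)] Basis.prems by blast
    then show ?case
      using topology_generated_by_Basis[OF B] unfolding strong_topology_def by blast
  qed simp
qed

text \<open>With finitely many indices the whole manifold can serve as the neighbourhood, with the
  identity arrow as the restriction.\<close>

lemma strong_data_finite:
  assumes fib: "fibred_in_groupoids X" and "finite I"
    and "\<And>i. i \<in> I \<Longrightarrow> etale X (c i) \<and> (\<exists>U. openin (Euclidean_space n) U \<and> pob X (c i) = euclidean_open n U \<and>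
             K i \<subseteq> U \<and> compactin (Euclidean_space n) (K i)) \<and> \<epsilon> i > 0"
  shows "strong_data n X I c K \<epsilon>"
  unfolding strong_data_def locally_finite_family_def
proof (intro conjI ballI)
  fix x u assume x: "x \<in> Ob X" and u: "u \<in> pts (pob X x)"
  have "arr X (idt X x) x x" using fibred_category[OF fib] x by (simp add: category_def)
  moreover have "par X (idt X x) = inclusion (pts (pob X x))"
    using fib x by (simp add: fibred_in_groupoids_def over_manifolds_def)
  ultimately have "is_restriction X (pts (pob X x)) (idt X x) x x"
    using open_sub_pts[OF fibred_manifold[OF fib x]] by (simp add: is_restriction_def)
  then show "\<exists>V r y. openin (mtop (pob X x)) V \<and> u \<in> V \<and> is_restriction X V r y x \<and>
          finite {i \<in> I. fibre_product_nonempty X y (c i)}"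
    using u assms(2) by (intro exI[of _ "pts (pob X x)"] exI[of _ "idt X x"] exI[of _ x]) simp
qed (use assms(3) in blast)+

lemma topspace_strong_topology:
  fixes X :: "('o, 'a) cat_over"
  assumes fib: "fibred_in_groupoids X"
  shows "topspace (strong_topology n X) = C_infinity X"
proof -
  have "f \<in> \<Union>(strong_basis n X)" if f: "f \<in> C_infinity X" for f
  proof -
    \<comment> \<open>The empty family imposes no condition, so its basic set is all of
      \<open>C_infinity X\<close>.\<close>
    have "strong_data n X ({} :: ('o \<times> pt set \<times> real) set) undefined undefined undefined"
      by (rule strong_data_finite[OF fib]) auto
    then have "strong_nbhd n X 0 ({} :: ('o \<times> pt set \<times> real) set) undefined undefined undefined f \<in> strong_basis n X"
      using f by (rule strong_nbhd_in_basis)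
    moreover have "f \<in> strong_nbhd n X 0 ({} :: ('o \<times> pt set \<times> real) set) undefined undefined undefined f"
      using f by (simp add: strong_nbhd_def)
    ultimately show ?thesis by blast
  qed
  moreover have "\<Union>(strong_basis n X) \<subseteq> C_infinity X"
    unfolding strong_basis_def strong_nbhd_def by blast
  ultimately show ?thesis unfolding strong_topology_def topology_generated_by_topspace by blast
qed

text \<open>The single number \<open>k\<close> bounds the charts considered and the order of
  derivatives, and also sets the tolerance. The bounds hold on the compact sets, hence on the
  \<open>Q\<close> inside them.\<close>

lemma strong_nbhd_on_chart_cover:
  fixes X :: "('o, 'a) cat_over"
  assumes fib: "fibred_in_groupoids X" and J: "chart_cover n X J" and g: "g \<in> C_infinity X"
  shows "\<exists>N. openin (strong_topology n X) N \<and> g \<in> N \<and>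
    (\<forall>h\<in>N. \<forall>(c, K, Q)\<in>J. to_nat_on J (c, K, Q) \<le> k \<longrightarrow>
       (\<forall>is\<in>lists {..<n}. length is \<le> k \<longrightarrow> (\<forall>x\<in>Q. \<bar>partials is (h c) x - partials is (g c) x\<bar> \<le> (1/2)^k)))"
proof -
  \<comment> \<open>Indices must have the type fixed in \<open>strong_basis\<close>, so the 1 is a
    placeholder: the tolerance is supplied as a constant function. Triples that differ only in
    \<open>Q\<close> may be identified, as they give the same condition.\<close>
  define I where "I = (\<lambda>(c, K, Q). (c, K, 1::real)) ` {j \<in> J. to_nat_on J j \<le> k}"
  have "finite {j \<in> J. to_nat_on J j \<le> k}"
  proof (rule finite_imageD)
    show "finite (to_nat_on J ` {j \<in> J. to_nat_on J j \<le> k})"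
      by (rule finite_subset[of _ "{..k}"]) auto
    show "inj_on (to_nat_on J) {j \<in> J. to_nat_on J j \<le> k}"
      using inj_on_to_nat_on[OF chart_coverD(1)[OF J]] by (rule inj_on_subset) blast
  qed
  then have "finite I" by (simp add: I_def)
  then have "strong_data n X I fst (fst \<circ> snd) (\<lambda>_. (1/2)^k)"
    by (rule strong_data_finite[OF fib]) (use chart_coverD(2)[OF J] in \<open>force simp: I_def\<close>)
  then have N: "strong_nbhd n X k I fst (fst \<circ> snd) (\<lambda>_. (1/2)^k) g \<in> strong_basis n X" (is "?N \<in> _")
    using g by (rule strong_nbhd_in_basis)
  show ?thesis
  proof (intro exI[of _ ?N] conjI ballI)
    show "openin (strong_topology n X) ?N"
      unfolding strong_topology_def by (rule topology_generated_by_Basis[OF N])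
    show "g \<in> ?N" using g by (simp add: strong_nbhd_def)
    fix h j assume h: "h \<in> ?N" and j: "j \<in> J"
    obtain c K Q where eq: "j = (c, K, Q)" by (metis prod_cases3)
    have "\<bar>partials is (h c) x - partials is (g c) x\<bar> \<le> (1/2)^k"
      if "to_nat_on J (c, K, Q) \<le> k" "is \<in> lists {..<n}" "length is \<le> k" "x \<in> Q" for "is" x
    proof -
      have "(c, K, 1) \<in> I" using j eq that(1) by (force simp: I_def)
      moreover have "x \<in> K" using chart_coverD(2)[OF J] j eq that(4) by blast
      ultimately show ?thesis
        using h that(2,3) unfolding strong_nbhd_def by force
    qed
    then show "case j of (c, K, Q) \<Rightarrow> to_nat_on J (c, K, Q) \<le> k \<longrightarrow>
       (\<forall>is\<in>lists {..<n}. length is \<le> k \<longrightarrow> (\<forall>x\<in>Q. \<bar>partials is (h c) x - partials is (g c) x\<bar> \<le> (1/2)^k))"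
      unfolding eq case_prod_conv by blast
  qed
qed

theorem theorem6p7:
  fixes X :: "('o, 'a) cat_over" and n :: nat
    and \<G> :: "('o \<Rightarrow> pt \<Rightarrow> real) set set"
  assumes "DM_stack n X"
    and "countable \<G>"
    and "\<And>A. A \<in> \<G> \<Longrightarrow>
           openin (strong_topology n X) A \<and> strong_topology n X closure_of A = C_infinity X"
  shows "strong_topology n X closure_of (C_infinity X \<inter> \<Inter>\<G>) = C_infinity X"
proof -
  let ?T = "strong_topology n X"
  have fib: "fibred_in_groupoids X"
    using assms(1) by (simp add: DM_stack_def differentiable_stack_def stack_def)
  obtain J where J: "chart_cover n X J"
    using assms(1) chart_cover_exists[OF fib] by (auto simp: DM_stack_def)
  note top = topspace_strong_topology[OF fib, of n]
  \<comment> \<open>Inserting the whole space makes the family nonempty, so that it can be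
    enumerated, possibly with repetitions.\<close>
  define A where "A = from_nat_into (insert (C_infinity X) \<G>)"
  have rA: "range A = insert (C_infinity X) \<G>"
    unfolding A_def using assms(2) by (intro range_from_nat_into) auto
  have A: "openin ?T (A k)" "?T closure_of (A k) = C_infinity X" for k
  proof -
    have "A k \<in> insert (C_infinity X) \<G>" using rA by blast
    moreover have "openin ?T (C_infinity X)" "?T closure_of (C_infinity X) = C_infinity X"
      using openin_topspace[of ?T] closure_of_topspace[of ?T] unfolding top .
    ultimately show "openin ?T (A k)" "?T closure_of (A k) = C_infinity X" using assms(3) by auto
  qed
  have "C_infinity X \<subseteq> ?T closure_of (C_infinity X \<inter> \<Inter>\<G>)"
  proof
    fix f0 assume f0: "f0 \<in> C_infinity X"
    show "f0 \<in> ?T closure_of (C_infinity X \<inter> \<Inter>\<G>)"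
      unfolding in_closure_of
    proof (intro conjI allI impI)
      show "f0 \<in> topspace ?T" using f0 top by simp
      fix O' assume O': "f0 \<in> O' \<and> openin ?T O'"
      \<comment> \<open>The state of the construction: the current function, an open set around it,
        and a set stable under limits that contains this open set.\<close>
      define P where "P s \<longleftrightarrow> (case s of (g, B, C) \<Rightarrow>
          openin ?T B \<and> g \<in> B \<and> B \<subseteq> C \<and> seq_closed X C)"
        for s :: "('o \<Rightarrow> pt \<Rightarrow> real) \<times> ('o \<Rightarrow> pt \<Rightarrow> real) set \<times> ('o \<Rightarrow> pt \<Rightarrow> real) set"
      define R where "R k g h \<longleftrightarrow> (\<forall>(c, K, Q)\<in>J. to_nat_on J (c, K, Q) \<le> k \<longrightarrow>
          (\<forall>is\<in>lists {..<n}. length is \<le> k \<longrightarrow>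
            (\<forall>x\<in>Q. \<bar>partials is (h c) x - partials is (g c) x\<bar> \<le> (1/2)^k)))"
        for k :: nat and g h :: "'o \<Rightarrow> pt \<Rightarrow> real"
      \<comment> \<open>The clause for k = 0 anchors the whole chain in \<open>O'\<close>; each
        later stable set lies in the open set of the previous stage and in the dense set
        \<open>A k\<close>.\<close>
      have "\<exists>s. \<forall>k. (P (s k) \<and> (k = 0 \<longrightarrow> snd (snd (s k)) \<subseteq> O')) \<and>
          (R k (fst (s k)) (fst (s (Suc k))) \<and> snd (snd (s (Suc k))) \<subseteq> A k \<inter> fst (snd (s k)))"
      proof (rule dependent_nat_choice)
        obtain B C where "openin ?T B" "f0 \<in> B" "B \<subseteq> C" "C \<subseteq> O'" "seq_closed X C"
          using open_strong_refine O' by metis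
        then show "\<exists>s. P s \<and> (0 = 0 \<longrightarrow> snd (snd s) \<subseteq> O')"
          by (intro exI[of _ "(f0, B, C)"]) (simp add: P_def)
      next
        fix s and k :: nat assume "P s \<and> (k = 0 \<longrightarrow> snd (snd s) \<subseteq> O')"
        moreover obtain g B C where s: "s = (g, B, C)" by (metis prod_cases3)
        ultimately have B: "openin ?T B" "g \<in> B" by (auto simp: P_def)
        then have g: "g \<in> C_infinity X" using openin_subset top by blast
        have "\<exists>N. openin ?T N \<and> g \<in> N \<and> (\<forall>h\<in>N. R k g h)"
          unfolding R_def by (rule strong_nbhd_on_chart_cover[OF fib J g])
        then obtain N where N: "openin ?T N" "g \<in> N" "\<forall>h\<in>N. R k g h" by (elim exE conjE)
        \<comment> \<open>Density is applied to \<open>B \<inter> N\<close>, so the new function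
          obeys the earlier constraints and is close to \<open>g\<close> on the charts numbered up
          to k.\<close>
        have "g \<in> ?T closure_of (A k)" using g A(2) by simp
        moreover have "g \<in> B \<inter> N" "openin ?T (B \<inter> N)" using B N(1,2) by auto
        ultimately have "\<exists>h. h \<in> A k \<and> h \<in> B \<inter> N" unfolding in_closure_of by (elim conjE) (drule spec, erule mp, rule conjI)
        then obtain h where h: "h \<in> A k" "h \<in> B \<inter> N" by (elim exE conjE)
        then have "h \<in> A k \<inter> B" by simp
        from open_strong_refine[OF openin_Int[OF A(1) B(1)] this]
        obtain B' C' where "openin ?T B'" "h \<in> B'" "B' \<subseteq> C'" "C' \<subseteq> A k \<inter> B" "seq_closed X C'"
          by (elim exE conjE)
        then show "\<exists>s'. (P s' \<and> (Suc k = 0 \<longrightarrow> snd (snd s') \<subseteq> O')) \<and>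
            (R k (fst s) (fst s') \<and> snd (snd s') \<subseteq> A k \<inter> fst (snd s))"
          using N(3) h by (intro exI[of _ "(h, B', C')"]) (simp add: P_def s)
      qed
      then obtain s where s: "\<And>k. P (s k)" "snd (snd (s 0)) \<subseteq> O'"
        "\<And>k. R k (fst (s k)) (fst (s (Suc k)))" "\<And>k. snd (snd (s (Suc k))) \<subseteq> A k \<inter> fst (snd (s k))" by metis
      define g B C where "g k = fst (s k)" and "B k = fst (snd (s k))" and "C k = snd (snd (s k))" for k
      have gBC: "openin ?T (B k)" "g k \<in> B k" "B k \<subseteq> C k" "seq_closed X (C k)" for k
        using s(1)[of k] by (auto simp: P_def g_def B_def C_def case_prod_beta)
      have gR: "R k (g k) (g (Suc k))" and CA: "C (Suc k) \<subseteq> A k" and CB: "C (Suc k) \<subseteq> B k" for k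
        using s(3,4)[of k] by (auto simp: g_def B_def C_def)
      have gC: "g k \<in> C_infinity X" for k using gBC(1,2) openin_subset top by blast
      \<comment> \<open>A chart and a word enter the estimate once k has reached both the number of
        the chart and the length of the word.\<close>
      have "uniformly_Cauchy_on Q (\<lambda>k. partials is (g k c))"
        if "(c, K, Q) \<in> J" "is \<in> lists {..<n}" for c K Q "is"
        by (rule uniformly_Cauchy_on_geometric[of "max (to_nat_on J (c, K, Q)) (length is)"])
           (use gR that in \<open>fastforce simp: R_def\<close>)
      from C_infinity_complete[OF fib J gC this] obtain f where f: "C_infinity_conv X g f" .
      \<comment> \<open>For j \<ge> k this gives g j \<in> B j \<subseteq> B k \<subseteq> C k, the
        eventual membership that puts the limit into every \<open>C k\<close>.\<close>
      have "decseq B"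
        using gBC(3) CB by (intro decseq_SucI) (meson order_trans)
      then have "g j \<in> C k" if "j \<ge> k" for j k
        using gBC(2,3) that unfolding decseq_def by blast
      then have fC: "f \<in> C k" for k
        using gBC(4)[of k] f unfolding seq_closed_def by (meson eventually_sequentiallyI)
      \<comment> \<open>Index shift: the k-th dense set contains the stable set of stage k +
        1.\<close>
      have "f \<in> A k" for k using fC CA by blast
      then have "f \<in> \<Inter>\<G>" using rA by blast
      moreover have "f \<in> O'" using fC[of 0] s(2) by (auto simp: C_def)
      moreover have "f \<in> C_infinity X" using f by (simp add: C_infinity_conv_def)
      ultimately show "\<exists>y. y \<in> C_infinity X \<inter> \<Inter>\<G> \<and> y \<in> O'" by blast
    qed
  qed
  then show ?thesis using closure_of_subset_topspace[of ?T] top by blast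
qed

end
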